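(* Let $\Gamma\colon [0,T]\times \Omega \to\mathbb{R}$ be an adapted process with continuous paths such that, for some constant $L_\Gamma\ge 0$, $\Gamma_t\colon\Omega\to\mathbb{R}$ is $L_\Gamma$-Lipschitz with respect to $\|\cdot\|_\infty$ for every $t\in[0,T]$, let $$S_t:=\operatorname*{ess\,sup}_{\tau \text{ stopping time},\ t\leq \tau\leq T} E[\Gamma_{\tau}\,|\,\mathcal{F}_t],\qquad t\in[0,T],$$ and let $\mu$ be the law of $S$ on $C([0,T],\mathbb{R})$. Let $P^\infty$ be the infinite product of $P$, let $(S^n)_{n\in\mathbb{N}}$ be i.i.d. random variables under $P^\infty$ with distribution $\mu$, and let $\mu_N:=\frac1N\sum_{n=1}^N\delta_{S^n}$ for $N\ge1$. Then there is $c>0$ such that $$P^\infty\Big( \Big| \mathcal{W}_2(\mu,\mu_N) -E_{P^\infty}[\mathcal{W}_2(\mu,\mu_N)] \Big| \ge x \Big) \leq 2\exp(-cx^2N)$$ for every $x>0$ and $N\geq 1$.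
   Context: Fix $T>0$ and $d\ge 1$. $\Omega=C([0,T],\mathbb{R}^d)$ with the maximum norm $\|\omega\|_\infty=\max_{t\in[0,T]}|\omega(t)|$; $W_t(\omega)=\omega(t)$ is the canonical process, $P$ is the Wiener measure on $\Omega$, and $(\mathcal{F}_t)_{t\in[0,T]}$ is the $P$-completion of the filtration $\sigma(W_s: s\le t)$. Adaptedness and stopping times refer to $(\mathcal F_t)$. For Borel probability measures $\mu,\nu$ on $E=C([0,T],\mathbb{R})$ (with the maximum norm), $\mathcal{W}_2(\mu,\nu)=\big(\inf_\pi\int_{E\times E}\|\omega-\eta\|_\infty^2\,\pi(d\omega,d\eta)\big)^{1/2}$, the infimum being over all couplings $\pi$ of $\mu$ and $\nu$. The process $S$ has continuous paths, so its law is a Borel probability measure on $E$. *)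

theory Defs
  imports "HOL-Analysis.Urysohn" "HOL-Probability.Probability"
begin

section \<open>Path spaces\<close>

text \<open>
  The space of continuous functions on \<open>[0,T]\<close> with the maximum norm is the library's space of
  bounded continuous functions on the subspace \<open>{0..T}\<close>, with the supremum metric. Its elements
  are functions on all of \<open>\<real>\<close> that equal \<^const>\<open>undefined\<close> outside \<open>{0..T}\<close>; the two lemmas
  unfold what the points and the distance are.
\<close>

definition path_metric :: "real \<Rightarrow> (real \<Rightarrow> 'a::metric_space) metric" where
  "path_metric T = cfunspace (top_of_set {0..T}) euclidean_metric"

lemma mspace_path_metric:
  "mspace (path_metric T) = {f \<in> extensional {0..T}. continuous_on {0..T} f}"
proof -
  have "bounded (f ` {0..T})" if "continuous_on {0..T} f" for f :: "real \<Rightarrow> 'a"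
    using that by (intro compact_imp_bounded compact_continuous_image) auto
  moreover have "Metric_space.mbounded UNIV dist B \<longleftrightarrow> bounded B" for B :: "'a set"
    by simp
  ultimately show ?thesis
    by (auto simp: path_metric_def)
qed

lemma mdist_path_metric:
  assumes "0 \<le> T" "f \<in> mspace (path_metric T)" "g \<in> mspace (path_metric T)"
  shows "mdist (path_metric T) f g = (SUP t\<in>{0..T}. dist (f t) (g t))"
proof -
  have "f \<in> mspace (funspace {0..T} euclidean_metric)" "g \<in> mspace (funspace {0..T} euclidean_metric)"
    using assms(2,3) cfunspace_subset_funspace[of "top_of_set {0..T}" "euclidean_metric :: 'a metric"]
    by (auto simp: path_metric_def simp del: mspace_cfunspace mspace_funspace)
  then have "f \<in> Metric_space.fspace UNIV dist {0..T}" "g \<in> Metric_space.fspace UNIV dist {0..T}"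
    by simp_all
  with assms(1) show ?thesis
    by (simp add: path_metric_def mdist_cfunspace_eq_mdist_funspace Met_TC.fdist_def)
qed

definition metric_borel :: "'a metric \<Rightarrow> 'a measure" where
  "metric_borel m = sigma (mspace m) {U. openin (mtopology_of m) U}"

abbreviation path_borel :: "real \<Rightarrow> (real \<Rightarrow> 'a::metric_space) measure" where
  "path_borel T \<equiv> metric_borel (path_metric T)"

lemma space_metric_borel [simp]: "space (metric_borel m) = mspace m"
  by (simp add: metric_borel_def space_measure_of_conv)


section \<open>Wiener measure and its completed filtration\<close>

text \<open>
  The law of a standard \<open>d\<close>-dimensional Brownian motion started at \<open>0\<close>. The independence clause
  covers the increments over consecutive intervals and the \<open>d\<close> coordinates simultaneously.
\<close>

definition wiener_measure :: "real \<Rightarrow> (real \<Rightarrow> real ^ 'd::finite) measure \<Rightarrow> bool" where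
  "wiener_measure T P \<longleftrightarrow>
     prob_space P \<and> sets P = sets (path_borel T) \<and>
     (AE \<omega> in P. \<omega> 0 = 0) \<and>
     (\<forall>s t i. 0 \<le> s \<and> s < t \<and> t \<le> T \<longrightarrow>
        distributed P lborel (\<lambda>\<omega>. (\<omega> t - \<omega> s) $ i) (normal_density 0 (sqrt (t - s)))) \<and>
     (\<forall>(n::nat) t. 0 \<le> t 0 \<and> (\<forall>k<n. t k < t (Suc k)) \<and> t n \<le> T \<longrightarrow>
        prob_space.indep_vars P (\<lambda>_. borel)
          (\<lambda>(k, i) \<omega>. (\<omega> (t (Suc k)) - \<omega> (t k)) $ i) ({..<n} \<times> (UNIV :: 'd set)))"

text \<open>
  Times outside \<open>[0,T]\<close> are included only because the index type is \<^typ>\<open>real\<close>: the filtration is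
  trivial up to null sets before \<open>0\<close> and constant after \<open>T\<close>, so for \<open>{0..T}\<close>-valued times
  \<^const>\<open>stopping_time\<close> imposes no condition beyond those at \<open>t \<in> {0..T}\<close>.
\<close>

definition completed_filtration ::
  "real \<Rightarrow> (real \<Rightarrow> 'a::metric_space) measure \<Rightarrow> real \<Rightarrow> (real \<Rightarrow> 'a) measure" where
  "completed_filtration T P t = sigma (space P)
     ({(\<lambda>\<omega>. \<omega> s) -` B \<inter> space P | s B. 0 \<le> s \<and> s \<le> t \<and> s \<le> T \<and> B \<in> sets borel}
      \<union> null_sets (completion P))"


section \<open>Optimal stopping\<close>

text \<open>
  Essential supremum of a family of random variables (the library's \<^const>\<open>esssup\<close> is that of a
  single function): the least a.e. upper bound, determined up to null sets. It suffices to compare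
  with real-valued upper bounds, since \<open>Y\<close> itself is real-valued.
\<close>

definition is_ess_sup :: "'a measure \<Rightarrow> ('a \<Rightarrow> real) set \<Rightarrow> ('a \<Rightarrow> real) \<Rightarrow> bool" where
  "is_ess_sup M \<X> Y \<longleftrightarrow>
     Y \<in> borel_measurable M \<and> (\<forall>X\<in>\<X>. AE \<omega> in M. X \<omega> \<le> Y \<omega>) \<and>
     (\<forall>Z\<in>borel_measurable M. (\<forall>X\<in>\<X>. AE \<omega> in M. X \<omega> \<le> Z \<omega>) \<longrightarrow> (AE \<omega> in M. Y \<omega> \<le> Z \<omega>))"

text \<open>
  Each value \<open>S t\<close> is an essential supremum and hence only determined up to a null set; the process
  \<open>S\<close> is a version with continuous paths, any two of which are indistinguishable.
\<close>

definition optimal_stopping_value ::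
  "real \<Rightarrow> (real \<Rightarrow> 'a::metric_space) measure \<Rightarrow> (real \<Rightarrow> (real \<Rightarrow> 'a) \<Rightarrow> real) \<Rightarrow>
   (real \<Rightarrow> (real \<Rightarrow> 'a) \<Rightarrow> real) \<Rightarrow> bool" where
  "optimal_stopping_value T P \<Gamma> S \<longleftrightarrow>
     (\<forall>\<omega>\<in>space P. continuous_on {0..T} (\<lambda>t. S t \<omega>)) \<and>
     (\<forall>t\<in>{0..T}. is_ess_sup (completion P)
        {real_cond_exp (completion P) (completed_filtration T P t) (\<lambda>\<omega>. \<Gamma> (\<tau> \<omega>) \<omega>) | \<tau>.
           stopping_time (completed_filtration T P) \<tau> \<and> (\<forall>\<omega>\<in>space P. t \<le> \<tau> \<omega> \<and> \<tau> \<omega> \<le> T)}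
        (S t))"

definition path_law ::
  "real \<Rightarrow> 'b measure \<Rightarrow> (real \<Rightarrow> 'b \<Rightarrow> 'a::metric_space) \<Rightarrow> (real \<Rightarrow> 'a) measure" where
  "path_law T M S = distr M (path_borel T) (\<lambda>\<omega>. \<lambda>t\<in>{0..T}. S t \<omega>)"


section \<open>Wasserstein distance and empirical measures\<close>

definition couplings :: "'a measure \<Rightarrow> 'b measure \<Rightarrow> ('a \<times> 'b) measure set" where
  "couplings \<mu> \<nu> =
     {\<pi>. sets \<pi> = sets (\<mu> \<Otimes>\<^sub>M \<nu>) \<and> distr \<pi> \<mu> fst = \<mu> \<and> distr \<pi> \<nu> snd = \<nu>}"

text \<open>
  The infimum is taken in \<^typ>\<open>ennreal\<close>. It is finite for measures with finite second moment, which
  is the case of interest; the value would be \<open>0\<close> if it were infinite.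
\<close>

definition wasserstein2 :: "'a metric \<Rightarrow> 'a measure \<Rightarrow> 'a measure \<Rightarrow> real" where
  "wasserstein2 m \<mu> \<nu> =
     sqrt (enn2real (INF \<pi>\<in>couplings \<mu> \<nu>. \<integral>\<^sup>+ (x, y). ennreal ((mdist m x y)\<^sup>2) \<partial>\<pi>))"

definition empirical_measure :: "'a measure \<Rightarrow> nat \<Rightarrow> (nat \<Rightarrow> 'a) \<Rightarrow> 'a measure" where
  "empirical_measure M N x = measure_of (space M) (sets M)
     (\<lambda>A. ennreal (1 / real N) * (\<Sum>n = 1..N. emeasure (return M (x n)) A))"

lemma emeasure_empirical_measure:
  assumes "A \<in> sets M"
  shows "emeasure (empirical_measure M N x) A
    = ennreal (1 / real N) * (\<Sum>n = 1..N. emeasure (return M (x n)) A)"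
proof (rule emeasure_measure_of[OF empirical_measure_def])
  show "countably_additive (sets (empirical_measure M N x))
     (\<lambda>A. ennreal (1 / real N) * (\<Sum>n = 1..N. emeasure (return M (x n)) A))"
  proof (rule countably_additiveI)
    fix A :: "nat \<Rightarrow> _"
    assume A: "range A \<subseteq> sets (empirical_measure M N x)" "disjoint_family A"
    then have "range A \<subseteq> sets (return M (x n))" for n
      by (simp add: empirical_measure_def sets.sigma_sets_eq sets.space_closed)
    then show "(\<Sum>i. ennreal (1 / real N) * (\<Sum>n = 1..N. emeasure (return M (x n)) (A i)))
      = ennreal (1 / real N) * (\<Sum>n = 1..N. emeasure (return M (x n)) (\<Union>i. A i))"
      using A(2) by (simp add: suminf_emeasure[symmetric] suminf_sum)
  qed
qed (use assms sets.space_closed in \<open>auto simp: positive_def empirical_measure_def sets.sigma_sets_eq\<close>)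

end

theory Submission
  imports Defs
begin

text \<open>
  The random variable \<open>W\<^sub>2(\<mu>, \<mu>\<^sub>N)\<close> has the law of a Lipschitz function of \<open>N\<close> independent Brownian paths,
  with a Lipschitz constant of order \<open>1 / sqrt N\<close> for the \<open>\<ell>\<^sup>2\<close> sum of the maximum norms, and Wiener measure
  concentrates such functions at a Gaussian rate that does not depend on the number of paths. There are
  three ingredients.

  Concentration. Call a measure \<open>M\<close> with cost \<open>c\<close> a space with property \<open>\<tau>\<close> if \<open>u x * v y \<le> exp (c x y)\<close>
  for all \<open>x, y\<close> forces \<open>\<integral>u dM * \<integral>v dM \<le> 1\<close> (Maurey). For a one-dimensional Gaussian measure of
  variance \<open>\<sigma>\<^sup>2\<close> and the cost \<open>(x - y)\<^sup>2 / (4 \<sigma>\<^sup>2)\<close> this is the Prekopa-Leindler inequality, and the property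
  passes to products with the sum of the costs (\<open>property_tau_PiM\<close>). A polygonal path with \<open>n\<close> steps
  is driven by \<open>n\<close> Gaussian vectors of variance \<open>T / n\<close>, and by Cauchy-Schwarz its squared maximum norm is at most
  \<open>n\<close> times the sum of the squared increments. The two factors \<open>n\<close> cancel, so inserting \<open>u = exp (l F)\<close>
  and \<open>v = exp (- l\<^sup>2 K\<^sup>2 T - l F)\<close> for a \<open>K\<close>-Lipschitz \<open>F\<close> gives
  \<open>\<integral> exp (l F) * \<integral> exp (- l F) \<le> exp (l\<^sup>2 K\<^sup>2 T)\<close>, a bound that survives the limit \<open>n \<longrightarrow> \<infinity>\<close>
  (\<open>exp_Lipschitz\<close>). Taking the norm for \<open>F\<close> gives exponential moments of Wiener measure, and for a
  centred \<open>F\<close> the second integral is at least \<open>1\<close>, so Chernoff's bound yields \<open>concentration_Lipschitz\<close>.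

  The value process. Given \<open>\<F>\<^sub>s\<close>, the conditional expectation keeps the path up to \<open>s\<close> and averages over
  the later increments. Two paths that are continued by the same increments stay at the distance
  that they had on \<open>[0, s]\<close>, so this averaging preserves Lipschitz constants, and so does the maximum with
  the reward. Hence every Snell envelope on a finite grid is \<open>L\<close>-Lipschitz. For \<open>t\<close> in a grid the essential supremum
  \<open>S t\<close> agrees almost surely with the supremum of countably many such envelopes
  (\<open>ess_sup_Lipschitz\<close>), and continuity of the paths of \<open>S\<close> gives one null set for all \<open>t\<close>.

  The Wasserstein distance. If the samples \<open>x\<^sub>i\<close> move to \<open>y\<^sub>i\<close>, a coupling with the first empirical measure
  is turned into one with the second by sending the mass over \<open>x\<^sub>i\<close> to \<open>y\<^sub>i\<close>; thus \<open>W\<^sub>2(\<mu>, \<mu>\<^sub>N)\<close> is a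
  \<open>1 / sqrt N\<close>-Lipschitz function of the samples (\<open>wasserstein2_empirical_Lipschitz\<close>).

  Composing the last two gives a function that is Lipschitz on a set of full measure; its McShane
  extension is Lipschitz everywhere and concentrates.
\<close>

section \<open>The Prekopa-Leindler inequality on the line\<close>

lemma emeasure_lborel_translate:
  fixes c :: real
  assumes "A \<in> sets borel"
  shows "emeasure lborel ((\<lambda>x. x + c) -` A) = emeasure lborel A"
proof -
  have eq: "(\<lambda>x. x + c) = (+) c" by (auto simp: fun_eq_iff)
  have "emeasure lborel A = emeasure (distr lborel borel ((+) c)) A"
    by (subst lborel_distr_plus) simp
  also have "\<dots> = emeasure lborel ((\<lambda>x. x + c) -` A)"
    using assms by (subst emeasure_distr) (auto simp: eq)
  finally show ?thesis by simp
qed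

text \<open>
  Pick \<open>a\<close> in \<open>A\<close> near its supremum and \<open>b\<close> in \<open>B\<close> near its infimum. The translates \<open>A + b\<close> and \<open>a + B\<close>
  both lie in \<open>D\<close>, and they overlap only in a short interval around \<open>a + b\<close>.
\<close>

lemma emeasure_add_le_bounded:
  fixes A B D :: "real set"
  assumes [measurable]: "A \<in> sets borel" "B \<in> sets borel" "D \<in> sets borel"
    and ne: "A \<noteq> {}" "B \<noteq> {}" and bdd: "bdd_above A" "bdd_below B"
    and sum: "\<And>a b. a \<in> A \<Longrightarrow> b \<in> B \<Longrightarrow> a + b \<in> D"
  shows "emeasure lborel A + emeasure lborel B \<le> emeasure lborel D"
proof (rule ennreal_le_epsilon)
  fix e :: real assume e: "0 < e"
  obtain a where a: "a \<in> A" "Sup A - e/2 < a"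
    using less_cSup_iff[OF ne(1) bdd(1), of "Sup A - e/2"] e by auto
  obtain b where b: "b \<in> B" "b < Inf B + e/2"
    using cInf_less_iff[OF ne(2) bdd(2), of "Inf B + e/2"] e by auto
  let ?X = "(\<lambda>x. x + (-b)) -` A" and ?Y = "(\<lambda>x. x + (-a)) -` B"
  have meas: "?X \<in> sets borel" "?Y \<in> sets borel"
    using measurable_sets_borel[of "\<lambda>x. x + (-b)" borel A] measurable_sets_borel[of "\<lambda>x. x + (-a)" borel B]
    by auto
  have sub: "?X \<union> ?Y \<subseteq> D"
  proof
    fix x assume "x \<in> ?X \<union> ?Y"
    then consider "x - b \<in> A" | "x - a \<in> B" by auto
    then show "x \<in> D"
      using sum[of "x - b" b] sum[of a "x - a"] a(1) b(1) by cases simp_all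
  qed
  have "?X \<inter> ?Y \<subseteq> {a + Inf B..Sup A + b}"
  proof
    fix x assume "x \<in> ?X \<inter> ?Y"
    then have "x - b \<le> Sup A" "Inf B \<le> x - a"
      using cSup_upper[OF _ bdd(1), of "x - b"] cInf_lower[OF _ bdd(2), of "x - a"] by simp_all
    then show "x \<in> {a + Inf B..Sup A + b}" by simp
  qed
  then have "emeasure lborel (?X \<inter> ?Y) \<le> emeasure lborel {a + Inf B..Sup A + b}"
    by (intro emeasure_mono) auto
  also have "\<dots> \<le> ennreal e"
    using a b by (cases "a + Inf B \<le> Sup A + b") (auto intro!: ennreal_leI)
  finally have inter: "emeasure lborel (?X \<inter> ?Y) \<le> ennreal e" .
  have "emeasure lborel A + emeasure lborel B = emeasure lborel ?X + emeasure lborel ?Y"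
    using emeasure_lborel_translate[of A "-b"] emeasure_lborel_translate[of B "-a"] by simp
  also have "\<dots> = emeasure lborel (?X \<union> ?Y) + emeasure lborel (?X \<inter> ?Y)"
    using meas by (intro emeasure_Un_Int) auto
  also have "\<dots> \<le> emeasure lborel D + ennreal e"
    using sub inter by (intro add_mono emeasure_mono) auto
  finally show "emeasure lborel A + emeasure lborel B \<le> emeasure lborel D + ennreal e" .
qed

lemma emeasure_add_le:
  fixes A B D :: "real set"
  assumes [measurable]: "A \<in> sets borel" "B \<in> sets borel" "D \<in> sets borel"
    and ne: "A \<noteq> {}" "B \<noteq> {}"
    and sum: "\<And>a b. a \<in> A \<Longrightarrow> b \<in> B \<Longrightarrow> a + b \<in> D"
  shows "emeasure lborel A + emeasure lborel B \<le> emeasure lborel D"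
proof -
  obtain a b where ab: "a \<in> A" "b \<in> B" using ne by auto
  define A' B' where "A' n = A \<inter> {..a + real n}" and "B' n = B \<inter> {b - real n..}" for n
  have "(\<lambda>n. emeasure lborel (A' n)) \<longlonglongrightarrow> emeasure lborel (\<Union>n. A' n)"
    by (rule Lim_emeasure_incseq) (auto simp: A'_def incseq_def)
  moreover have "(\<lambda>n. emeasure lborel (B' n)) \<longlonglongrightarrow> emeasure lborel (\<Union>n. B' n)"
    by (rule Lim_emeasure_incseq) (auto simp: B'_def incseq_def)
  moreover have "(\<Union>n. A' n) = A"
  proof -
    have "\<exists>n. x \<le> a + real n" for x
      using real_arch_simple[of "x - a"] by (auto simp: algebra_simps)
    then show ?thesis by (auto simp: A'_def)
  qed
  moreover have "(\<Union>n. B' n) = B"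
  proof -
    have "\<exists>n. b - real n \<le> x" for x
      using real_arch_simple[of "b - x"] by (auto simp: algebra_simps)
    then show ?thesis by (auto simp: B'_def)
  qed
  ultimately have lim: "(\<lambda>n. emeasure lborel (A' n) + emeasure lborel (B' n)) \<longlonglongrightarrow> emeasure lborel A + emeasure lborel B"
    by (auto intro!: tendsto_add)
  show ?thesis
  proof (rule tendsto_upperbound[OF lim])
    show "\<forall>\<^sub>F n in sequentially. emeasure lborel (A' n) + emeasure lborel (B' n) \<le> emeasure lborel D"
    proof (intro always_eventually allI emeasure_add_le_bounded)
      fix n
      show "bdd_above (A' n)" "bdd_below (B' n)"
        by (auto simp: A'_def B'_def intro!: bdd_aboveI[of _ "a + real n"] bdd_belowI[of _ "b - real n"])
      show "A' n \<noteq> {}" "B' n \<noteq> {}" using ab by (auto simp: A'_def B'_def intro: exI[of _ a] exI[of _ b])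
    qed (auto simp: A'_def B'_def intro: sum)
  qed simp
qed

lemma brunn_minkowski_midpoint:
  fixes A B C :: "real set"
  assumes [measurable]: "A \<in> sets borel" "B \<in> sets borel" "C \<in> sets borel"
    and ne: "A \<noteq> {}" "B \<noteq> {}"
    and mid: "\<And>a b. a \<in> A \<Longrightarrow> b \<in> B \<Longrightarrow> (a + b) / 2 \<in> C"
  shows "emeasure lborel A + emeasure lborel B \<le> 2 * emeasure lborel C"
proof -
  have "emeasure lborel A + emeasure lborel B \<le> emeasure lborel ((\<lambda>x. x / 2) -` C)"
    using measurable_sets_borel[of "\<lambda>x. x / 2" borel C]
    by (intro emeasure_add_le ne) (auto intro: mid)
  also have "\<dots> = 2 * emeasure lborel C"
  proof -
    let ?D = "(\<lambda>x. x / 2) -` C"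
    have "\<bar>1/2::real\<bar> ^ DIM(real) = 1/2" "(\<lambda>x::real. 0 + (1/2) *\<^sub>R x) = (\<lambda>x. x / 2)"
      by (auto simp: fun_eq_iff)
    then have "(lborel :: real measure) = density (distr lborel borel (\<lambda>x. x / 2)) (\<lambda>_. ennreal (1/2))"
      using lborel_affine[where 'a=real, of "1/2" 0] by (simp only:)
    then have "emeasure lborel C = emeasure (density (distr lborel borel (\<lambda>x. x / 2)) (\<lambda>_. ennreal (1/2))) C"
      by (rule arg_cong)
    also have "\<dots> = ennreal (1/2) * emeasure lborel ?D"
      by (subst emeasure_density_const) (auto simp: emeasure_distr)
    finally have eq: "emeasure lborel C = ennreal (1/2) * emeasure lborel ?D" .
    have "2 * ennreal (1/2) = 1"
      by (subst ennreal_numeral[symmetric], subst ennreal_mult[symmetric]) auto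
    then show ?thesis
      by (simp add: eq mult.assoc[symmetric])
  qed
  finally show ?thesis .
qed

lemma nn_integral_layer:
  fixes f :: "'a \<Rightarrow> real"
  assumes "sigma_finite_measure M" and [measurable]: "f \<in> borel_measurable M"
    and "\<And>x. 0 \<le> f x"
  shows "(\<integral>\<^sup>+ x. ennreal (f x) \<partial>M) = (\<integral>\<^sup>+ t. emeasure M {x \<in> space M. 0 < t \<and> t < f x} \<partial>lborel)"
proof -
  interpret sigma_finite_measure M by fact
  interpret pair_sigma_finite M lborel ..
  have "(\<integral>\<^sup>+ x. ennreal (f x) \<partial>M) = (\<integral>\<^sup>+ x. (\<integral>\<^sup>+ t. indicator {t. 0 < t \<and> t < f x} t \<partial>lborel) \<partial>M)"
  proof (rule nn_integral_cong)
    fix x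
    have "{t. 0 < t \<and> t < f x} = {0<..<f x}" by auto
    then show "ennreal (f x) = (\<integral>\<^sup>+ t. indicator {t. 0 < t \<and> t < f x} t \<partial>lborel)"
      using assms(3)[of x] by simp
  qed
  also have "\<dots> = (\<integral>\<^sup>+ x. (\<integral>\<^sup>+ t. indicator {p\<in>space (M \<Otimes>\<^sub>M lborel). 0 < snd p \<and> snd p < f (fst p)} (x, t) \<partial>lborel) \<partial>M)"
    by (intro nn_integral_cong) (auto simp: indicator_def space_pair_measure)
  also have "\<dots> = (\<integral>\<^sup>+ t. (\<integral>\<^sup>+ x. indicator {p\<in>space (M \<Otimes>\<^sub>M lborel). 0 < snd p \<and> snd p < f (fst p)} (x, t) \<partial>M) \<partial>lborel)"
    by (rule Fubini'[symmetric]) measurable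
  also have "\<dots> = (\<integral>\<^sup>+ t. emeasure M {x \<in> space M. 0 < t \<and> t < f x} \<partial>lborel)"
  proof (rule nn_integral_cong)
    fix t :: real
    have "(\<integral>\<^sup>+ x. indicator {p\<in>space (M \<Otimes>\<^sub>M lborel). 0 < snd p \<and> snd p < f (fst p)} (x, t) \<partial>M)
      = (\<integral>\<^sup>+ x. indicator {x \<in> space M. 0 < t \<and> t < f x} x \<partial>M)"
      by (intro nn_integral_cong) (auto simp: indicator_def space_pair_measure)
    then show "(\<integral>\<^sup>+ x. indicator {p\<in>space (M \<Otimes>\<^sub>M lborel). 0 < snd p \<and> snd p < f (fst p)} (x, t) \<partial>M) = emeasure M {x \<in> space M. 0 < t \<and> t < f x}"
      by simp
  qed
  finally show ?thesis .
qed

lemma ennreal_mult_le_sum_square: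
  fixes x y :: ennreal
  assumes "x + y \<le> 2 * z"
  shows "x * y \<le> z * z"
proof (cases "z = \<top>")
  case True
  then show ?thesis by simp
next
  case False
  then obtain c where c: "z = ennreal c" "0 \<le> c" by (cases z) auto
  then have fin: "x + y \<le> ennreal (2 * c)"
    using assms by (simp add: ennreal_mult)
  then have "x \<noteq> \<top>" "y \<noteq> \<top>" by (auto simp: top_unique)
  then obtain a b where ab: "x = ennreal a" "0 \<le> a" "y = ennreal b" "0 \<le> b"
    by (cases x; cases y) auto
  then have "a + b \<le> 2 * c"
    using fin c by (simp flip: ennreal_plus)
  then have "(a + b)\<^sup>2 \<le> (2 * c)\<^sup>2" using ab by (intro power_mono) auto
  moreover have "4 * (a * b) \<le> (a + b)\<^sup>2"
    using sum_squares_bound[of a b] by (simp add: power2_sum)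
  ultimately have "a * b \<le> c * c" by (simp add: power2_eq_square)
  then show ?thesis using ab c by (simp flip: ennreal_mult)
qed

text \<open>
  For \<open>0 < t < 1\<close> the superlevel sets of \<open>f\<close> and \<open>g\<close> are nonempty, because both functions have supremum \<open>1\<close>,
  and the midpoints of their points lie in the superlevel set of \<open>h\<close>. The Brunn-Minkowski
  inequality compares the lengths of these sets, and integration over \<open>t\<close> compares the integrals.
\<close>

lemma prekopa_leindler_normalized:
  fixes f g h :: "real \<Rightarrow> real"
  assumes [measurable]: "f \<in> borel_measurable borel" "g \<in> borel_measurable borel" "h \<in> borel_measurable borel"
    and nonneg: "\<And>x. 0 \<le> f x" "\<And>x. 0 \<le> g x" "\<And>x. 0 \<le> h x"
    and le1: "\<And>x. f x \<le> 1" "\<And>x. g x \<le> 1"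
    and sup1: "\<And>t. t < 1 \<Longrightarrow> \<exists>x. t < f x" "\<And>t. t < 1 \<Longrightarrow> \<exists>x. t < g x"
    and mid: "\<And>x y. f x * g y \<le> (h ((x + y) / 2))\<^sup>2"
  shows "(\<integral>\<^sup>+ x. ennreal (f x) \<partial>lborel) + (\<integral>\<^sup>+ x. ennreal (g x) \<partial>lborel) \<le> 2 * (\<integral>\<^sup>+ x. ennreal (h x) \<partial>lborel)"
proof -
  let ?L = "\<lambda>f t. emeasure lborel {x \<in> space lborel. 0 < t \<and> t < (f x :: real)}"
  have layer: "?L f t + ?L g t \<le> 2 * ?L h t" for t
  proof (cases "0 < t \<and> t < 1")
    case True
    show ?thesis
    proof (rule brunn_minkowski_midpoint)
      show "{x \<in> space lborel. 0 < t \<and> t < f x} \<noteq> {}" "{x \<in> space lborel. 0 < t \<and> t < g x} \<noteq> {}"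
        using sup1[of t] True by auto
      fix a b assume "a \<in> {x \<in> space lborel. 0 < t \<and> t < f x}" "b \<in> {x \<in> space lborel. 0 < t \<and> t < g x}"
      then have "t * t < f a * g b" by (intro mult_strict_mono) auto
      then have "t\<^sup>2 < (h ((a + b) / 2))\<^sup>2" using mid[of a b] by (simp add: power2_eq_square)
      then show "(a + b) / 2 \<in> {x \<in> space lborel. 0 < t \<and> t < h x}"
        using True nonneg(3) power_less_imp_less_base[of t 2] by auto
    qed measurable
  next
    case False
    then have "\<not> (0 < t \<and> t < f x)" "\<not> (0 < t \<and> t < g x)" for x
      using le1[of x] by linarith+
    then show ?thesis by (simp only: simp_thms Collect_empty_eq Collect_const if_False emeasure_empty) simp
  qed
  have "(\<integral>\<^sup>+ x. ennreal (f x) \<partial>lborel) + (\<integral>\<^sup>+ x. ennreal (g x) \<partial>lborel) = (\<integral>\<^sup>+ t. ?L f t + ?L g t \<partial>lborel)"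
    by (subst (1 2) nn_integral_layer)
       (use nonneg in \<open>auto simp: sigma_finite_lborel intro!: nn_integral_add[symmetric]\<close>)
  also have "\<dots> \<le> (\<integral>\<^sup>+ t. 2 * ?L h t \<partial>lborel)"
    by (intro nn_integral_mono layer)
  also have "\<dots> = 2 * (\<integral>\<^sup>+ x. ennreal (h x) \<partial>lborel)"
    by (subst nn_integral_layer)
       (use nonneg in \<open>auto simp: sigma_finite_lborel intro!: nn_integral_cmult\<close>)
  finally show ?thesis .
qed

text \<open>
  Dividing \<open>f\<close> and \<open>g\<close> by their suprema \<open>a\<close> and \<open>b\<close>, and \<open>h\<close> by \<open>sqrt (a * b)\<close>, reduces the multiplicative
  inequality to the additive one for normalized functions.
\<close>

lemma prekopa_leindler_bounded:
  fixes f g h :: "real \<Rightarrow> real"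
  assumes [measurable]: "f \<in> borel_measurable borel" "g \<in> borel_measurable borel" "h \<in> borel_measurable borel"
    and nonneg: "\<And>x. 0 \<le> f x" "\<And>x. 0 \<le> g x" "\<And>x. 0 \<le> h x"
    and bdd: "bdd_above (range f)" "bdd_above (range g)"
    and mid: "\<And>x y. f x * g y \<le> (h ((x + y) / 2))\<^sup>2"
  shows "(\<integral>\<^sup>+ x. ennreal (f x) \<partial>lborel) * (\<integral>\<^sup>+ x. ennreal (g x) \<partial>lborel)
    \<le> (\<integral>\<^sup>+ x. ennreal (h x) \<partial>lborel) * (\<integral>\<^sup>+ x. ennreal (h x) \<partial>lborel)"
proof -
  define a b where "a = (SUP x. f x)" and "b = (SUP x. g x)"
  have up: "f x \<le> a" "g x \<le> b" for x
    using cSUP_upper[OF _ bdd(1)] cSUP_upper[OF _ bdd(2)] by (auto simp: a_def b_def)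
  have ab: "0 \<le> a" "0 \<le> b" using up[of 0] nonneg[of 0] by linarith+
  show ?thesis
  proof (cases "a = 0 \<or> b = 0")
    case True
    then have "(\<forall>x. f x = 0) \<or> (\<forall>x. g x = 0)"
      using up nonneg by (metis order_antisym)
    then show ?thesis by (auto simp: zero_ennreal_def[symmetric])
  next
    case False
    then have pos: "0 < a" "0 < b" using ab by auto
    let ?c = "sqrt (a * b)"
    have c: "0 < ?c" "?c\<^sup>2 = a * b" "?c * ?c = a * b" using pos by auto
    have "(\<integral>\<^sup>+ x. ennreal (f x / a) \<partial>lborel) + (\<integral>\<^sup>+ x. ennreal (g x / b) \<partial>lborel) \<le> 2 * (\<integral>\<^sup>+ x. ennreal (h x / ?c) \<partial>lborel)"
    proof (rule prekopa_leindler_normalized)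
      show "\<exists>x. t < f x / a" if "t < 1" for t
        using that pos less_cSUP_iff[OF _ bdd(1), of "t * a"] by (auto simp: field_simps a_def[symmetric])
      show "\<exists>x. t < g x / b" if "t < 1" for t
        using that pos less_cSUP_iff[OF _ bdd(2), of "t * b"] by (auto simp: field_simps b_def[symmetric])
      show "f x / a * (g y / b) \<le> (h ((x + y) / 2) / ?c)\<^sup>2" for x y
        using mid[of x y] pos unfolding power_divide c(2) by (simp add: divide_right_mono)
    qed (use pos nonneg up c(1) in \<open>auto simp del: real_sqrt_gt_0_iff\<close>)
    then have le: "(\<integral>\<^sup>+ x. ennreal (f x / a) \<partial>lborel) * (\<integral>\<^sup>+ x. ennreal (g x / b) \<partial>lborel)
       \<le> (\<integral>\<^sup>+ x. ennreal (h x / ?c) \<partial>lborel) * (\<integral>\<^sup>+ x. ennreal (h x / ?c) \<partial>lborel)"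
      by (rule ennreal_mult_le_sum_square)
    have scale: "(\<integral>\<^sup>+ x. ennreal (k x) \<partial>lborel) = ennreal r * (\<integral>\<^sup>+ x. ennreal (k x / r) \<partial>lborel)"
      if [measurable]: "k \<in> borel_measurable borel" and "0 < r" "\<And>x. 0 \<le> k x" for k :: "real \<Rightarrow> real" and r
    proof -
      have "(\<integral>\<^sup>+ x. ennreal (k x) \<partial>lborel) = (\<integral>\<^sup>+ x. ennreal r * ennreal (k x / r) \<partial>lborel)"
        using that by (intro nn_integral_cong) (simp flip: ennreal_mult)
      then show ?thesis by (simp add: nn_integral_cmult)
    qed
    have "(\<integral>\<^sup>+ x. ennreal (f x) \<partial>lborel) * (\<integral>\<^sup>+ x. ennreal (g x) \<partial>lborel)
      = ennreal (a * b) * ((\<integral>\<^sup>+ x. ennreal (f x / a) \<partial>lborel) * (\<integral>\<^sup>+ x. ennreal (g x / b) \<partial>lborel))"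
      using pos nonneg by (subst scale[of f a], simp, simp, simp, subst scale[of g b]) (simp_all add: ennreal_mult mult_ac)
    also have "\<dots> \<le> ennreal (a * b) * ((\<integral>\<^sup>+ x. ennreal (h x / ?c) \<partial>lborel) * (\<integral>\<^sup>+ x. ennreal (h x / ?c) \<partial>lborel))"
      by (intro mult_left_mono le) simp
    also have "\<dots> = (ennreal ?c * (\<integral>\<^sup>+ x. ennreal (h x / ?c) \<partial>lborel)) * (ennreal ?c * (\<integral>\<^sup>+ x. ennreal (h x / ?c) \<partial>lborel))"
    proof -
      have "ennreal (a * b) = ennreal ?c * ennreal ?c"
        using c(1,3) by (metis ennreal_mult less_imp_le)
      then show ?thesis by (simp only: mult_ac)
    qed
    also have "\<dots> = (\<integral>\<^sup>+ x. ennreal (h x) \<partial>lborel) * (\<integral>\<^sup>+ x. ennreal (h x) \<partial>lborel)"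
      using c(1) nonneg(3) by (subst (1 2) scale[of h ?c, symmetric]) simp_all
    finally show ?thesis .
  qed
qed

section \<open>Property (tau) and its tensorization\<close>

text \<open>
  Maurey's property \<open>\<tau>\<close>, in the form of a statement about pairs of functions instead of an
  infimal convolution: this avoids any question about the measurability of an infimum over \<open>y\<close>.
\<close>

definition property_tau :: "'a measure \<Rightarrow> ('a \<Rightarrow> 'a \<Rightarrow> real) \<Rightarrow> bool" where
  "property_tau M c \<longleftrightarrow>
     (\<forall>u\<in>borel_measurable M. \<forall>v\<in>borel_measurable M.
        (\<forall>x\<in>space M. \<forall>y\<in>space M. u x * v y \<le> ennreal (exp (c x y))) \<longrightarrow>
        (\<integral>\<^sup>+ x. u x \<partial>M) * (\<integral>\<^sup>+ y. v y \<partial>M) \<le> 1)"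

lemma property_tauD:
  assumes "property_tau M c" "u \<in> borel_measurable M" "v \<in> borel_measurable M"
    and "\<And>x y. x \<in> space M \<Longrightarrow> y \<in> space M \<Longrightarrow> u x * v y \<le> ennreal (exp (c x y))"
  shows "(\<integral>\<^sup>+ x. u x \<partial>M) * (\<integral>\<^sup>+ y. v y \<partial>M) \<le> 1"
  using assms by (auto simp: property_tau_def)

text \<open>
  Integrate out one coordinate at a time. For fixed values \<open>x\<close>, \<open>y\<close> of the other coordinates, the property of
  the factor \<open>M i\<close> bounds the product of the partial integrals by the exponential of the remaining
  cost, which is the hypothesis needed to apply the property of the remaining factors.
\<close>

lemma property_tau_PiM:
  assumes prob: "\<And>i. prob_space (M i)" and "finite I"
    and tau: "\<And>i. i \<in> I \<Longrightarrow> property_tau (M i) (c i)"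
  shows "property_tau (PiM I M) (\<lambda>x y. \<Sum>i\<in>I. c i (x i) (y i))"
  using \<open>finite I\<close> tau
proof (induction I rule: finite_induct)
  case empty
  show ?case by (simp add: property_tau_def PiM_empty nn_integral_count_space_finite)
next
  case (insert i I)
  interpret product_prob_space M by (rule product_prob_spaceI) (rule prob)
  show ?case
    unfolding property_tau_def
  proof (intro ballI impI)
    fix u v :: "('a \<Rightarrow> 'b) \<Rightarrow> ennreal"
    assume meas [measurable]: "u \<in> borel_measurable (PiM (insert i I) M)" "v \<in> borel_measurable (PiM (insert i I) M)"
    assume le: "\<forall>x\<in>space (PiM (insert i I) M). \<forall>y\<in>space (PiM (insert i I) M).
      u x * v y \<le> ennreal (exp (\<Sum>i\<in>insert i I. c i (x i) (y i)))"
    have sp: "x(i := a) \<in> space (PiM (insert i I) M)" if "x \<in> space (PiM I M)" "a \<in> space (M i)" for x a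
      using that insert.hyps by (auto simp: space_PiM PiE_def Pi_def extensional_def)
    have [measurable]: "(\<lambda>a. u (x(i := a))) \<in> borel_measurable (M i)" "(\<lambda>a. v (x(i := a))) \<in> borel_measurable (M i)"
      if "x \<in> space (PiM I M)" for x
      using that insert.hyps by (auto intro!: measurable_compose[OF measurable_component_update] meas)
    have [measurable]: "(\<lambda>x. \<integral>\<^sup>+ a. u (x(i := a)) \<partial>M i) \<in> borel_measurable (PiM I M)"
      "(\<lambda>x. \<integral>\<^sup>+ a. v (x(i := a)) \<partial>M i) \<in> borel_measurable (PiM I M)"
      by measurable
    have "(\<integral>\<^sup>+ x. (\<integral>\<^sup>+ a. u (x(i := a)) \<partial>M i) \<partial>PiM I M) * (\<integral>\<^sup>+ x. (\<integral>\<^sup>+ a. v (x(i := a)) \<partial>M i) \<partial>PiM I M) \<le> 1"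
    proof (rule property_tauD[OF insert.IH])
      fix x y assume xy: "x \<in> space (PiM I M)" "y \<in> space (PiM I M)"
      let ?s = "\<Sum>i\<in>I. c i (x i) (y i)"
      have "(\<integral>\<^sup>+ a. u (x(i := a)) \<partial>M i) * (\<integral>\<^sup>+ a. ennreal (exp (- ?s)) * v (y(i := a)) \<partial>M i) \<le> 1"
      proof (rule property_tauD[of "M i" "c i"])
        fix a b assume ab: "a \<in> space (M i)" "b \<in> space (M i)"
        have "u (x(i := a)) * v (y(i := b)) \<le> ennreal (exp (\<Sum>j\<in>insert i I. c j ((x(i := a)) j) ((y(i := b)) j)))"
          using le sp[OF xy(1) ab(1)] sp[OF xy(2) ab(2)] by blast
        also have "(\<Sum>j\<in>insert i I. c j ((x(i := a)) j) ((y(i := b)) j)) = c i a b + ?s"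
          using insert.hyps by (auto intro!: sum.cong)
        finally have "ennreal (exp (- ?s)) * (u (x(i := a)) * v (y(i := b))) \<le> ennreal (exp (- ?s)) * ennreal (exp (c i a b + ?s))"
          by (rule mult_left_mono) simp
        also have "\<dots> = ennreal (exp (c i a b))"
          by (simp flip: ennreal_mult exp_add)
        finally show "u (x(i := a)) * (ennreal (exp (- ?s)) * v (y(i := b))) \<le> ennreal (exp (c i a b))"
          by (simp add: mult_ac)
      qed (use xy insert.prems in auto)
      moreover have cmult: "(\<integral>\<^sup>+ a. ennreal (exp (- ?s)) * v (y(i := a)) \<partial>M i)
          = ennreal (exp (- ?s)) * (\<integral>\<^sup>+ a. v (y(i := a)) \<partial>M i)"
        using xy by (intro nn_integral_cmult) auto
      ultimately have "ennreal (exp ?s) * (ennreal (exp (- ?s)) * ((\<integral>\<^sup>+ a. u (x(i := a)) \<partial>M i) * (\<integral>\<^sup>+ a. v (y(i := a)) \<partial>M i))) \<le> ennreal (exp ?s) * 1"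
        by (intro mult_left_mono) (simp_all only: cmult mult_ac zero_le)
      then show "(\<integral>\<^sup>+ a. u (x(i := a)) \<partial>M i) * (\<integral>\<^sup>+ a. v (y(i := a)) \<partial>M i) \<le> ennreal (exp ?s)"
        by (simp add: mult.assoc[symmetric] flip: ennreal_mult exp_add)
    qed (use insert.prems in auto)
    then show "(\<integral>\<^sup>+ x. u x \<partial>PiM (insert i I) M) * (\<integral>\<^sup>+ x. v x \<partial>PiM (insert i I) M) \<le> 1"
      using insert.hyps by (simp add: product_nn_integral_insert)
  qed
qed

text \<open>
  If \<open>\<phi>\<close> is the density, then \<open>\<phi> x * \<phi> y * exp ((x - y)\<^sup>2 / (4 \<sigma>\<^sup>2)) = \<phi> ((x + y) / 2)\<^sup>2\<close> by the parallelogram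
  identity, so \<open>u \<phi>\<close>, \<open>v \<phi>\<close> and \<open>\<phi>\<close> satisfy the hypothesis of the Prekopa-Leindler inequality.
  Truncation handles unbounded \<open>u\<close> and \<open>v\<close>.
\<close>

lemma property_tau_gauss:
  assumes "0 < \<sigma>"
  shows "property_tau (density lborel (normal_density 0 \<sigma>)) (\<lambda>x y. (x - y)\<^sup>2 / (4 * \<sigma>\<^sup>2))"
  unfolding property_tau_def
proof (intro ballI impI)
  let ?G = "density lborel (normal_density 0 \<sigma>)" and ?\<phi> = "normal_density 0 \<sigma>"
  fix u v :: "real \<Rightarrow> ennreal"
  assume "u \<in> borel_measurable ?G" "v \<in> borel_measurable ?G"
  then have [measurable]: "u \<in> borel_measurable borel" "v \<in> borel_measurable borel" by auto
  assume le: "\<forall>x\<in>space ?G. \<forall>y\<in>space ?G. u x * v y \<le> ennreal (exp ((x - y)\<^sup>2 / (4 * \<sigma>\<^sup>2)))"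
  define trunc where "trunc w n x = enn2real (min (w x) (of_nat n))" for w :: "real \<Rightarrow> ennreal" and n :: nat and x
  have trunc_fin: "min (w x) (of_nat n) < \<top>" for w :: "real \<Rightarrow> ennreal" and n :: nat and x
    by (simp add: min_less_iff_disj of_nat_less_top)
  have trunc_eq: "ennreal (trunc w n x) = min (w x) (of_nat n)" for w n x
    unfolding trunc_def using trunc_fin by simp
  have trunc_bd: "0 \<le> trunc w n x" "trunc w n x \<le> real n" for w n x
  proof -
    show "0 \<le> trunc w n x" by (simp add: trunc_def)
    have "ennreal (trunc w n x) \<le> ennreal (real n)" by (simp add: trunc_eq ennreal_of_nat_eq_real_of_nat)
    then show "trunc w n x \<le> real n" by simp
  qed
  have [measurable]: "trunc w n \<in> borel_measurable borel" if [measurable]: "w \<in> borel_measurable borel" for w n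
    unfolding trunc_def by measurable
  have phi_le: "?\<phi> x \<le> 1 / sqrt (2 * pi * \<sigma>\<^sup>2)" for x
    unfolding normal_density_def using assms by (intro mult_left_le) auto
  have mass: "(\<integral>\<^sup>+ x. ennreal (?\<phi> x) \<partial>lborel) = 1"
  proof -
    interpret prob_space ?G by (rule prob_space_normal_density) fact
    show ?thesis using emeasure_space_1 by (simp add: emeasure_density)
  qed
  have trunc_le: "(\<integral>\<^sup>+ x. trunc u n x \<partial>?G) * (\<integral>\<^sup>+ x. trunc v n x \<partial>?G) \<le> 1" for n
  proof -
    have "(\<integral>\<^sup>+ x. ennreal (?\<phi> x * trunc u n x) \<partial>lborel) * (\<integral>\<^sup>+ x. ennreal (?\<phi> x * trunc v n x) \<partial>lborel)
      \<le> (\<integral>\<^sup>+ x. ennreal (?\<phi> x) \<partial>lborel) * (\<integral>\<^sup>+ x. ennreal (?\<phi> x) \<partial>lborel)"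
    proof (rule prekopa_leindler_bounded)
      show "?\<phi> x * trunc u n x * (?\<phi> y * trunc v n y) \<le> (?\<phi> ((x + y) / 2))\<^sup>2" for x y
      proof -
        have "ennreal (trunc u n x * trunc v n y) \<le> u x * v y"
          using trunc_bd by (simp add: ennreal_mult trunc_eq mult_mono)
        also have "\<dots> \<le> ennreal (exp ((x - y)\<^sup>2 / (4 * \<sigma>\<^sup>2)))" using le by simp
        finally have *: "trunc u n x * trunc v n y \<le> exp ((x - y)\<^sup>2 / (4 * \<sigma>\<^sup>2))" by simp
        have "?\<phi> x * trunc u n x * (?\<phi> y * trunc v n y) = ?\<phi> x * ?\<phi> y * (trunc u n x * trunc v n y)" by simp
        also have "\<dots> \<le> ?\<phi> x * ?\<phi> y * exp ((x - y)\<^sup>2 / (4 * \<sigma>\<^sup>2))"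
          using * by (intro mult_left_mono) auto
        also have "\<dots> = (1 / sqrt (2 * pi * \<sigma>\<^sup>2))\<^sup>2 * exp (- x\<^sup>2 / (2 * \<sigma>\<^sup>2) + - y\<^sup>2 / (2 * \<sigma>\<^sup>2) + (x - y)\<^sup>2 / (4 * \<sigma>\<^sup>2))"
          by (simp add: normal_density_def power2_eq_square flip: exp_add)
        also have "- x\<^sup>2 / (2 * \<sigma>\<^sup>2) + - y\<^sup>2 / (2 * \<sigma>\<^sup>2) + (x - y)\<^sup>2 / (4 * \<sigma>\<^sup>2) = 2 * (- ((x + y) / 2)\<^sup>2 / (2 * \<sigma>\<^sup>2))"
          using assms by (simp add: field_simps power2_eq_square)
        also have "(1 / sqrt (2 * pi * \<sigma>\<^sup>2))\<^sup>2 * exp (2 * (- ((x + y) / 2)\<^sup>2 / (2 * \<sigma>\<^sup>2))) = (?\<phi> ((x + y) / 2))\<^sup>2"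
          by (simp only: normal_density_def power_mult_distrib exp_double diff_0_right)
        finally show ?thesis .
      qed
      have bd: "bdd_above (range (\<lambda>x. ?\<phi> x * trunc w n x))" for w
        by (intro bdd_aboveI2[where M="1 / sqrt (2 * pi * \<sigma>\<^sup>2) * real n"] mult_mono phi_le trunc_bd) auto
      show "bdd_above (range (\<lambda>x. ?\<phi> x * trunc u n x))" "bdd_above (range (\<lambda>x. ?\<phi> x * trunc v n x))"
        by (rule bd)+
    qed (use trunc_bd in auto)
    then show ?thesis
      by (simp add: mass nn_integral_density ennreal_mult trunc_bd)
  qed
  have SUP_min: "(SUP n. min a (of_nat n)) = a" for a :: ennreal
  proof (cases a)
    case (real r)
    obtain n where n: "r \<le> real n" using real_arch_simple by blast
    then have "a = min a (of_nat n)" using real by (simp add: min_def ennreal_of_nat_eq_real_of_nat)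
    then have "a \<le> (SUP n. min a (of_nat n))" by (metis SUP_upper UNIV_I)
    then show ?thesis by (intro antisym SUP_least) auto
  next
    case top
    then show ?thesis by (simp add: ennreal_SUP_of_nat_eq_top)
  qed
  have incseq: "incseq (\<lambda>n x. min (w x) (of_nat n))" for w :: "real \<Rightarrow> ennreal"
    by (intro incseq_SucI le_funI min.mono) simp_all
  have sup: "(\<integral>\<^sup>+ x. w x \<partial>?G) = (SUP n. \<integral>\<^sup>+ x. trunc w n x \<partial>?G)"
    if [measurable]: "w \<in> borel_measurable borel" for w
  proof -
    have "(\<integral>\<^sup>+ x. (SUP n. min (w x) (of_nat n)) \<partial>?G) = (SUP n. \<integral>\<^sup>+ x. min (w x) (of_nat n) \<partial>?G)"
      by (rule nn_integral_monotone_convergence_SUP[OF incseq]) simp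
    then show ?thesis unfolding SUP_min trunc_eq .
  qed
  have mono: "(\<integral>\<^sup>+ x. trunc w n x \<partial>?G) \<le> (\<integral>\<^sup>+ x. trunc w m x \<partial>?G)" if "n \<le> m" for w n m
    unfolding trunc_eq using incseqD[OF incseq that] by (intro nn_integral_mono) (simp add: le_fun_def)
  have "(\<integral>\<^sup>+ x. trunc u n x \<partial>?G) * (\<integral>\<^sup>+ x. trunc v m x \<partial>?G) \<le> 1" for n m
    by (rule order_trans[OF mult_mono[OF mono mono] trunc_le[of "max n m"]]) auto
  then show "(\<integral>\<^sup>+ x. u x \<partial>?G) * (\<integral>\<^sup>+ x. v x \<partial>?G) \<le> 1"
    by (subst (1 2) sup) (auto simp: SUP_mult_left_ennreal SUP_mult_right_ennreal intro!: SUP_least)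
qed

section \<open>Paths, polygonal interpolation and measurability\<close>

abbreviation pdist :: "real \<Rightarrow> (real \<Rightarrow> 'a::metric_space) \<Rightarrow> (real \<Rightarrow> 'a) \<Rightarrow> real" where
  "pdist T \<equiv> mdist (path_metric T)"

abbreviation paths :: "real \<Rightarrow> (real \<Rightarrow> 'a::metric_space) set" where
  "paths T \<equiv> mspace (path_metric T)"

lemma pdist_ge:
  assumes "0 \<le> T" "x \<in> paths T" "y \<in> paths T" "t \<in> {0..T}"
  shows "dist (x t) (y t) \<le> pdist T x y"
proof -
  have "compact ((\<lambda>t. dist (x t) (y t)) ` {0..T})"
    using assms by (intro compact_continuous_image continuous_intros) (auto simp: mspace_path_metric)
  then have "bdd_above ((\<lambda>t. dist (x t) (y t)) ` {0..T})"
    by (intro bounded_imp_bdd_above compact_imp_bounded)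
  then show ?thesis
    unfolding mdist_path_metric[OF assms(1-3)] using assms(4) by (intro cSUP_upper)
qed

lemma pdist_le:
  assumes "0 \<le> T" "x \<in> paths T" "y \<in> paths T" "\<And>t. t \<in> {0..T} \<Longrightarrow> dist (x t) (y t) \<le> c"
  shows "pdist T x y \<le> c"
  unfolding mdist_path_metric[OF assms(1-3)] using assms(1,4) by (intro cSUP_least) auto

lemma mdist_triangle_abs:
  assumes "x \<in> mspace m" "y \<in> mspace m" "z \<in> mspace m"
  shows "\<bar>mdist m x z - mdist m y z\<bar> \<le> mdist m x y"
  using mdist_triangle[of x m y z] mdist_triangle[of y m x z] assms by (simp add: mdist_commute abs_le_iff)

text \<open>
  The function that is \<open>0\<close> before the \<open>k\<close>-th of \<open>n\<close> equal subintervals of \<open>[0, T]\<close>, \<open>1\<close> after it, and linear on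
  it. Sums of ramps describe polygonal paths through their increments, and since ramps take values in \<open>[0, 1]\<close>
  the maximum norm of such a path is at most the sum of the norms of its increments.
\<close>

definition ramp :: "real \<Rightarrow> nat \<Rightarrow> nat \<Rightarrow> real \<Rightarrow> real" where
  "ramp T n k t = max 0 (min 1 (t * real n / T - real k))"

definition polygonal :: "real \<Rightarrow> nat \<Rightarrow> 'a \<Rightarrow> (nat \<Rightarrow> 'a) \<Rightarrow> real \<Rightarrow> 'a::real_normed_vector" where
  "polygonal T n a z = (\<lambda>t\<in>{0..T}. a + (\<Sum>k<n. ramp T n k t *\<^sub>R z k))"

definition gridpt :: "real \<Rightarrow> nat \<Rightarrow> nat \<Rightarrow> real" where
  "gridpt T n k = T * real k / real n"

lemma gridpt_refine: "gridpt T (Suc n * q) (Suc n * m) = gridpt T q m"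
  using mult_divide_mult_cancel_left[of "real (Suc n)" "T * real m" "real q"]
  unfolding gridpt_def of_nat_mult by (simp add: mult_ac del: of_nat_Suc)

definition interpolate :: "real \<Rightarrow> nat \<Rightarrow> (real \<Rightarrow> 'a) \<Rightarrow> real \<Rightarrow> 'a::real_normed_vector" where
  "interpolate T n x = polygonal T n (x 0) (\<lambda>k. x (gridpt T n (Suc k)) - x (gridpt T n k))"

lemma ramp_bounds: "0 \<le> ramp T n k t" "ramp T n k t \<le> 1"
  by (auto simp: ramp_def)

lemma polygonal_in_paths: "polygonal T n a z \<in> paths T"
proof -
  have "continuous_on {0..T} (\<lambda>t. a + (\<Sum>k<n. ramp T n k t *\<^sub>R z k))"
    unfolding ramp_def divide_inverse by (intro continuous_intros)
  then show ?thesis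
    unfolding mspace_path_metric polygonal_def
    by (auto intro: continuous_on_eq)
qed

lemma interpolate_in_paths: "interpolate T n x \<in> paths T"
  by (simp add: interpolate_def polygonal_in_paths)

lemma pdist_polygonal_le:
  assumes "0 \<le> T"
  shows "pdist T (polygonal T n a z) (polygonal T n b w) \<le> norm (a - b) + (\<Sum>k<n. norm (z k - w k))"
proof (rule pdist_le[OF assms polygonal_in_paths polygonal_in_paths])
  fix t assume t: "t \<in> {0..T}"
  have "dist (polygonal T n a z t) (polygonal T n b w t) = norm ((a - b) + (\<Sum>k<n. ramp T n k t *\<^sub>R (z k - w k)))"
    using t by (simp add: polygonal_def dist_norm scaleR_diff_right sum_subtractf algebra_simps)
  also have "\<dots> \<le> norm (a - b) + (\<Sum>k<n. norm (ramp T n k t *\<^sub>R (z k - w k)))"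
    by (intro order_trans[OF norm_triangle_ineq] add_left_mono norm_sum)
  also have "\<dots> \<le> norm (a - b) + (\<Sum>k<n. norm (z k - w k))"
    by (intro add_left_mono sum_mono) (simp add: ramp_bounds mult_left_le_one_le)
  finally show "dist (polygonal T n a z t) (polygonal T n b w t) \<le> norm (a - b) + (\<Sum>k<n. norm (z k - w k))" .
qed

lemma gridpt_bounds:
  assumes "0 \<le> T" "k \<le> n"
  shows "gridpt T n k \<in> {0..T}"
proof (cases "n = 0")
  case False
  then show ?thesis using assms by (auto simp: gridpt_def field_simps intro!: mult_left_mono)
qed (use assms in \<open>auto simp: gridpt_def\<close>)

lemma interpolate_eq:
  assumes "0 < T" "j < n" "gridpt T n j \<le> t" "t \<le> gridpt T n (Suc j)"
  shows "interpolate T n x t = x (gridpt T n j) + ramp T n j t *\<^sub>R (x (gridpt T n (Suc j)) - x (gridpt T n j))"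
proof -
  have n: "0 < real n" using assms by simp
  have t: "real j \<le> t * real n / T" "t * real n / T \<le> real j + 1"
    using assms n by (auto simp: gridpt_def field_simps)
  have "t \<in> {0..T}"
    using gridpt_bounds[of T j n] gridpt_bounds[of T "Suc j" n] assms by auto
  then have "interpolate T n x t = x 0 + (\<Sum>k<n. ramp T n k t *\<^sub>R (x (gridpt T n (Suc k)) - x (gridpt T n k)))"
    by (simp add: interpolate_def polygonal_def)
  also have "{..<n} = {..<j} \<union> {j} \<union> {Suc j..<n}" using assms(2) by auto
  also have "(\<Sum>k\<in>\<dots>. ramp T n k t *\<^sub>R (x (gridpt T n (Suc k)) - x (gridpt T n k)))
    = (\<Sum>k<j. ramp T n k t *\<^sub>R (x (gridpt T n (Suc k)) - x (gridpt T n k)))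
      + ramp T n j t *\<^sub>R (x (gridpt T n (Suc j)) - x (gridpt T n j))
      + (\<Sum>k=Suc j..<n. ramp T n k t *\<^sub>R (x (gridpt T n (Suc k)) - x (gridpt T n k)))"
    by (subst sum.union_disjoint, auto)+
  also have "(\<Sum>k<j. ramp T n k t *\<^sub>R (x (gridpt T n (Suc k)) - x (gridpt T n k)))
    = (\<Sum>k<j. x (gridpt T n (Suc k)) - x (gridpt T n k))"
  proof (intro sum.cong refl)
    fix k assume "k \<in> {..<j}"
    then have "real k + 1 \<le> t * real n / T" using t by (simp add: less_eq_real_def) linarith
    then have "ramp T n k t = 1" by (simp add: ramp_def)
    then show "ramp T n k t *\<^sub>R (x (gridpt T n (Suc k)) - x (gridpt T n k)) = x (gridpt T n (Suc k)) - x (gridpt T n k)" by simp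
  qed
  also have "\<dots> = x (gridpt T n j) - x (gridpt T n 0)"
    by (rule sum_lessThan_telescope)
  also have "(\<Sum>k=Suc j..<n. ramp T n k t *\<^sub>R (x (gridpt T n (Suc k)) - x (gridpt T n k))) = 0"
  proof (intro sum.neutral ballI)
    fix k assume "k \<in> {Suc j..<n}"
    then have "t * real n / T \<le> real k" using t by simp
    then have "ramp T n k t = 0" by (simp add: ramp_def)
    then show "ramp T n k t *\<^sub>R (x (gridpt T n (Suc k)) - x (gridpt T n k)) = 0" by simp
  qed
  finally show ?thesis by (simp add: gridpt_def)
qed

lemma grid_cell:
  assumes "0 < T" "0 < n" "t \<in> {0..T}"
  obtains j where "j < n" "gridpt T n j \<le> t" "t \<le> gridpt T n (Suc j)"
proof (cases "t = T")
  case True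
  show ?thesis
  proof
    show "n - 1 < n" "gridpt T n (n - 1) \<le> t" "t \<le> gridpt T n (Suc (n - 1))"
      using assms True by (auto simp: gridpt_def field_simps)
  qed
next
  case False
  define j where "j = nat \<lfloor>t * n / T\<rfloor>"
  have nn: "0 \<le> t * n / T" using assms by auto
  have j: "real j \<le> t * n / T" "t * n / T < real j + 1"
    using nn by (auto simp: j_def)
  have "t * n / T < n" using assms False by (auto simp: field_simps)
  then have "j < n" using j(1) by linarith
  then show ?thesis
    using that[of j] j assms by (auto simp: gridpt_def field_simps)
qed

lemma interpolate_tendsto:
  fixes x :: "real \<Rightarrow> 'a::real_normed_vector"
  assumes "0 < T" "x \<in> paths T"
  shows "(\<lambda>n. pdist T (interpolate T n x) x) \<longlonglongrightarrow> 0"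
proof (rule LIMSEQ_I)
  fix r :: real assume r: "0 < r"
  have "uniformly_continuous_on {0..T} x"
    using assms by (intro compact_uniformly_continuous) (auto simp: mspace_path_metric)
  then obtain d where d: "0 < d" "\<And>s t. s \<in> {0..T} \<Longrightarrow> t \<in> {0..T} \<Longrightarrow> dist s t < d \<Longrightarrow> dist (x s) (x t) < r / 3"
    using r unfolding uniformly_continuous_on_def by (metis divide_pos_pos zero_less_numeral)
  obtain n0 :: nat where n0: "T / d < real n0" using reals_Archimedean2 by blast
  show "\<exists>no. \<forall>n\<ge>no. norm (pdist T (interpolate T n x) x - 0) < r"
  proof (intro exI allI impI)
    fix n assume n: "n0 \<le> n"
    have npos: "0 < n" using n0 n assms d(1) by (cases n) (auto simp: zero_less_divide_iff not_less field_simps)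
    have mesh: "T / real n < d"
    proof -
      have "T < d * real n0" using n0 d(1) by (simp add: field_simps)
      also have "\<dots> \<le> d * real n" using n d(1) by (intro mult_left_mono) auto
      finally show ?thesis using npos by (simp add: field_simps)
    qed
    have "pdist T (interpolate T n x) x \<le> 2 * (r / 3)"
    proof (rule pdist_le[OF _ interpolate_in_paths assms(2)])
      fix t assume t: "t \<in> {0..T}"
      obtain j where j: "j < n" "gridpt T n j \<le> t" "t \<le> gridpt T n (Suc j)"
        using grid_cell[OF assms(1) npos t] by blast
      let ?a = "gridpt T n j" and ?b = "gridpt T n (Suc j)"
      have ab: "?a \<in> {0..T}" "?b \<in> {0..T}"
        using gridpt_bounds[of T j n] gridpt_bounds[of T "Suc j" n] j assms by auto
      have "?b - ?a = T / real n" by (simp add: gridpt_def field_simps flip: add_divide_distrib)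
      then have "dist ?a t < d" "dist ?b t < d" using j mesh by (auto simp: dist_real_def)
      then have *: "norm (x ?a - x t) < r / 3" "norm (x ?b - x t) < r / 3"
        using d(2) ab t by (auto simp: dist_norm)
      let ?l = "ramp T n j t"
      have "interpolate T n x t - x t = (1 - ?l) *\<^sub>R (x ?a - x t) + ?l *\<^sub>R (x ?b - x t)"
        by (simp add: interpolate_eq[OF assms(1) j] algebra_simps)
      also have "norm \<dots> \<le> \<bar>1 - ?l\<bar> * norm (x ?a - x t) + \<bar>?l\<bar> * norm (x ?b - x t)"
        by (rule order_trans[OF norm_triangle_ineq]) simp
      also have "\<dots> \<le> 1 * (r / 3) + 1 * (r / 3)"
        using * ramp_bounds[of T n j t] by (intro add_mono mult_mono) auto
      finally show "dist (interpolate T n x t) (x t) \<le> 2 * (r / 3)" by (simp add: dist_norm)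
    qed (use assms in auto)
    also have "\<dots> < r" using r by simp
    finally show "norm (pdist T (interpolate T n x) x - 0) < r"
      by simp
  qed
qed

text \<open>
  Replacing each path by its polygonal interpolation turns \<open>F\<close> into a continuous function of finitely many
  path values, and the interpolations converge uniformly. Hence a Lipschitz functional of the paths is
  measurable as soon as all evaluations are.
\<close>

lemma borel_measurable_Lipschitz_paths:
  fixes F :: "(nat \<Rightarrow> real \<Rightarrow> 'a::euclidean_space) \<Rightarrow> real"
  assumes "0 < T" "finite I" "0 \<le> K"
    and Lip: "\<And>x y. x \<in> I \<rightarrow>\<^sub>E paths T \<Longrightarrow> y \<in> I \<rightarrow>\<^sub>E paths T \<Longrightarrow> \<bar>F x - F y\<bar> \<le> K * (\<Sum>j\<in>I. pdist T (x j) (y j))"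
    and Y: "\<And>j \<omega>. j \<in> I \<Longrightarrow> \<omega> \<in> space M \<Longrightarrow> Y j \<omega> \<in> paths T"
    and meas: "\<And>j t. j \<in> I \<Longrightarrow> t \<in> {0..T} \<Longrightarrow> (\<lambda>\<omega>. Y j \<omega> t) \<in> borel_measurable M"
  shows "(\<lambda>\<omega>. F (\<lambda>j\<in>I. Y j \<omega>)) \<in> borel_measurable M"
proof (rule borel_measurable_LIMSEQ_real)
  fix \<omega> assume \<omega>: "\<omega> \<in> space M"
  show "(\<lambda>n. F (\<lambda>j\<in>I. interpolate T n (Y j \<omega>))) \<longlonglongrightarrow> F (\<lambda>j\<in>I. Y j \<omega>)"
  proof (rule Lim_transform2[OF tendsto_const Lim_null_comparison])
    show "\<forall>\<^sub>F n in sequentially. norm (F (\<lambda>j\<in>I. Y j \<omega>) - F (\<lambda>j\<in>I. interpolate T n (Y j \<omega>)))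
      \<le> K * (\<Sum>j\<in>I. pdist T (interpolate T n (Y j \<omega>)) (Y j \<omega>))"
    proof (intro always_eventually allI)
      fix n
      have "\<bar>F (\<lambda>j\<in>I. Y j \<omega>) - F (\<lambda>j\<in>I. interpolate T n (Y j \<omega>))\<bar>
        \<le> K * (\<Sum>j\<in>I. pdist T ((\<lambda>j\<in>I. Y j \<omega>) j) ((\<lambda>j\<in>I. interpolate T n (Y j \<omega>)) j))"
        using Y[OF _ \<omega>] by (intro Lip) (auto simp: interpolate_in_paths)
      then show "norm (F (\<lambda>j\<in>I. Y j \<omega>) - F (\<lambda>j\<in>I. interpolate T n (Y j \<omega>)))
        \<le> K * (\<Sum>j\<in>I. pdist T (interpolate T n (Y j \<omega>)) (Y j \<omega>))"
        by (simp add: mdist_commute cong: sum.cong)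
    qed
    have "(\<lambda>n. K * (\<Sum>j\<in>I. pdist T (interpolate T n (Y j \<omega>)) (Y j \<omega>))) \<longlonglongrightarrow> K * (\<Sum>j\<in>I. 0)"
      using Y[OF _ \<omega>] assms(1) by (intro tendsto_intros interpolate_tendsto)
    then show "(\<lambda>n. K * (\<Sum>j\<in>I. pdist T (interpolate T n (Y j \<omega>)) (Y j \<omega>))) \<longlonglongrightarrow> 0" by simp
  qed
next
  fix n
  define G where "G z = F (\<lambda>j\<in>I. polygonal T n (z (j, 0)) (\<lambda>k. z (j, Suc k) - z (j, k)))" for z :: "nat \<times> nat \<Rightarrow> 'a"
  define Z where "Z \<omega> = (\<lambda>(j, k). if j \<in> I \<and> k \<le> n then Y j \<omega> (gridpt T n k) else 0)" for \<omega>
  have "continuous_on UNIV G"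
    unfolding continuous_on_eq_continuous_at[OF open_UNIV] isCont_def
  proof (intro ballI)
    fix z :: "nat \<times> nat \<Rightarrow> 'a"
    let ?b = "\<lambda>w. K * (\<Sum>j\<in>I. norm (w (j, 0) - z (j, 0)) + (\<Sum>k<n. norm ((w (j, Suc k) - w (j, k)) - (z (j, Suc k) - z (j, k)))))"
    show "G \<midarrow>z\<rightarrow> G z"
    proof (rule LIM_zero_cancel, rule Lim_null_comparison)
      show "\<forall>\<^sub>F w in at z. norm (G w - G z) \<le> ?b w"
      proof (intro always_eventually allI)
        fix w
        have "\<bar>G w - G z\<bar> \<le> K * (\<Sum>j\<in>I. pdist T (polygonal T n (w (j, 0)) (\<lambda>k. w (j, Suc k) - w (j, k))) (polygonal T n (z (j, 0)) (\<lambda>k. z (j, Suc k) - z (j, k))))"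
          unfolding G_def by (rule order_trans[OF Lip]) (auto simp: polygonal_in_paths)
        also have "\<dots> \<le> ?b w"
          using assms(1,3) by (intro mult_left_mono sum_mono pdist_polygonal_le) auto
        finally show "norm (G w - G z) \<le> ?b w" by simp
      qed
      have ev: "((\<lambda>w. w i) \<longlongrightarrow> z i) (at z)" for i
        by (rule continuous_on_product_coordinates[unfolded continuous_on_def, rule_format, OF UNIV_I])
      have "(?b \<longlongrightarrow> K * (\<Sum>j\<in>I. norm (z (j, 0) - z (j, 0)) + (\<Sum>k<n. norm ((z (j, Suc k) - z (j, k)) - (z (j, Suc k) - z (j, k)))))) (at z)"
        by (intro tendsto_intros ev)
      then show "(?b \<longlongrightarrow> 0) (at z)" by simp
    qed
  qed
  then have G: "G \<in> borel_measurable (PiM UNIV (\<lambda>_. borel))"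
    using borel_measurable_continuous_onI[of G] measurable_cong_sets[OF sets_PiM_equal_borel refl] by blast
  have Z: "Z \<in> measurable M (PiM UNIV (\<lambda>_. borel))"
  proof (rule measurable_PiM_single')
    fix i :: "nat \<times> nat"
    obtain j k where i: "i = (j, k)" by (cases i)
    show "(\<lambda>\<omega>. Z \<omega> i) \<in> borel_measurable M"
      using meas[of j "gridpt T n k"] gridpt_bounds[of T k n] assms(1)
      by (cases "j \<in> I \<and> k \<le> n") (auto simp: Z_def i)
  qed (auto simp: Z_def)
  have "(\<lambda>\<omega>. F (\<lambda>j\<in>I. interpolate T n (Y j \<omega>))) = (\<lambda>\<omega>. G (Z \<omega>))"
  proof
    fix \<omega>
    have "interpolate T n (Y j \<omega>) = polygonal T n (Z \<omega> (j, 0)) (\<lambda>k. Z \<omega> (j, Suc k) - Z \<omega> (j, k))" if "j \<in> I" for j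
      using that by (auto simp: interpolate_def polygonal_def Z_def gridpt_def fun_eq_iff restrict_def intro!: sum.cong)
    then show "F (\<lambda>j\<in>I. interpolate T n (Y j \<omega>)) = G (Z \<omega>)"
      unfolding G_def by (intro arg_cong[where f=F]) (auto simp: fun_eq_iff restrict_def)
  qed
  then show "(\<lambda>\<omega>. F (\<lambda>j\<in>I. interpolate T n (Y j \<omega>))) \<in> borel_measurable M"
    using measurable_compose[OF Z G] by simp
qed

lemma sets_metric_borel: "sets (metric_borel m) = sigma_sets (mspace m) {U. openin (mtopology_of m) U}"
proof -
  have "{U. openin (mtopology_of m) U} \<subseteq> Pow (mspace m)"
    using openin_subset[of "mtopology_of m"] by auto
  then show ?thesis by (simp add: metric_borel_def)
qed

lemma openin_mtopology_of_iff:
  "openin (mtopology_of m) U \<longleftrightarrow> U \<subseteq> mspace m \<and> (\<forall>x\<in>U. \<exists>r>0. \<forall>y\<in>mspace m. mdist m x y < r \<longrightarrow> y \<in> U)"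
proof -
  interpret Metric_space "mspace m" "mdist m" by (rule Metric_space_mspace_mdist)
  have "mball x r \<subseteq> U \<longleftrightarrow> (\<forall>y\<in>mspace m. mdist m x y < r \<longrightarrow> y \<in> U)" if "U \<subseteq> mspace m" "x \<in> U" for x r
    using that by (auto simp: in_mball subset_iff)
  then show ?thesis
    unfolding mtopology_of_def openin_mtopology by (auto simp: Ball_def)
qed

lemma measurable_evaluation:
  assumes "0 \<le> T" "t \<in> {0..T}"
  shows "(\<lambda>x. x t :: 'a::metric_space) \<in> borel_measurable (path_borel T)"
proof (rule borel_measurableI)
  fix S :: "'a set" assume S: "open S"
  have "openin (mtopology_of (path_metric T)) ((\<lambda>x. x t) -` S \<inter> paths T)"
    unfolding openin_mtopology_of_iff
  proof (intro conjI ballI)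
    fix x assume x: "x \<in> (\<lambda>x. x t) -` S \<inter> paths T"
    then obtain r where r: "0 < r" "\<And>y. dist y (x t) < r \<Longrightarrow> y \<in> S"
      using S unfolding open_dist by auto
    show "\<exists>r>0. \<forall>y\<in>paths T. pdist T x y < r \<longrightarrow> y \<in> (\<lambda>x. x t) -` S \<inter> paths T"
    proof (intro exI[of _ r] conjI ballI impI r(1))
      fix y :: "real \<Rightarrow> 'a" assume y: "y \<in> paths T" "pdist T x y < r"
      have "dist (y t) (x t) < r" using pdist_ge[OF assms(1) _ y(1) assms(2), of x] x y by (simp add: dist_commute)
      then show "y \<in> (\<lambda>x. x t) -` S \<inter> paths T" using r y by auto
    qed
  qed auto
  then show "(\<lambda>x. x t) -` S \<inter> space (path_borel T) \<in> sets (path_borel T)"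
    by (auto simp: sets_metric_borel)
qed

text \<open>
  The value \<open>1\<close> for the empty set keeps the function Lipschitz and positive on the whole space, so
  that an open set is always the positivity set of the distance to its complement.
\<close>

definition mdist_to_set :: "'a metric \<Rightarrow> 'a set \<Rightarrow> 'a \<Rightarrow> real" where
  "mdist_to_set m A x = (if A = {} then 1 else INF y\<in>A. mdist m x y)"

lemma mdist_to_set_nonneg: "0 \<le> mdist_to_set m A x"
  by (auto simp: mdist_to_set_def intro!: cINF_greatest)

lemma mdist_to_set_Lipschitz:
  assumes "A \<subseteq> mspace m" "x \<in> mspace m" "y \<in> mspace m"
  shows "\<bar>mdist_to_set m A x - mdist_to_set m A y\<bar> \<le> mdist m x y"
proof (cases "A = {}")
  case False
  have bdd: "bdd_below (mdist m x ` A)" for x by (rule bdd_belowI2[of _ 0]) simp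
  have *: "mdist_to_set m A x \<le> mdist_to_set m A y + mdist m x y" if "x \<in> mspace m" "y \<in> mspace m" for x y
  proof -
    have "mdist_to_set m A x - mdist m x y \<le> mdist m y a" if a: "a \<in> A" for a
    proof -
      have "mdist_to_set m A x \<le> mdist m x a"
        unfolding mdist_to_set_def using False a bdd by (auto intro!: cINF_lower)
      then show ?thesis using mdist_triangle[of x m y a] \<open>x \<in> mspace m\<close> \<open>y \<in> mspace m\<close> a assms(1) by auto
    qed
    then have "mdist_to_set m A x - mdist m x y \<le> mdist_to_set m A y"
      unfolding mdist_to_set_def[of m A y] using False by (auto intro!: cINF_greatest)
    then show ?thesis by simp
  qed
  show ?thesis using *[OF assms(2,3)] *[OF assms(3,2)] by (simp add: mdist_commute abs_le_iff)
qed (simp add: mdist_to_set_def)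

lemma mdist_to_set_pos_iff:
  assumes "openin (mtopology_of m) U" "x \<in> mspace m"
  shows "0 < mdist_to_set m (mspace m - U) x \<longleftrightarrow> x \<in> U"
proof (cases "mspace m - U = {}")
  case True
  then show ?thesis using assms by (auto simp: mdist_to_set_def)
next
  case False
  have bdd: "bdd_below (mdist m x ` A)" for A by (rule bdd_belowI2[of _ 0]) simp
  show ?thesis
  proof
    assume pos: "0 < mdist_to_set m (mspace m - U) x"
    show "x \<in> U"
    proof (rule ccontr)
      assume "x \<notin> U"
      then have "mdist_to_set m (mspace m - U) x \<le> mdist m x x"
        unfolding mdist_to_set_def using False assms bdd by (auto intro!: cINF_lower)
      also have "mdist m x x = 0" using assms(2) by simp
      finally show False using pos by simp
    qed
  next
    assume "x \<in> U"
    then obtain r where r: "0 < r" "\<And>y. y \<in> mspace m \<Longrightarrow> mdist m x y < r \<Longrightarrow> y \<in> U"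
      using assms(1) unfolding openin_mtopology_of_iff by blast
    have "r \<le> (INF y\<in>mspace m - U. mdist m x y)"
    proof (rule cINF_greatest[OF False])
      fix y assume "y \<in> mspace m - U"
      then show "r \<le> mdist m x y" using r(2)[of y] by force
    qed
    then have "r \<le> mdist_to_set m (mspace m - U) x"
      by (simp only: mdist_to_set_def False if_False)
    then show "0 < mdist_to_set m (mspace m - U) x" using r(1) by simp
  qed
qed

text \<open>
  The distance to the complement of an open set \<open>U\<close> is a Lipschitz functional, hence measurable by the
  preceding result, and \<open>U\<close> is the set where it is positive. So the evaluations generate the Borel sets.
\<close>

lemma measurable_path_borelI:
  fixes Y :: "'b \<Rightarrow> real \<Rightarrow> 'a::euclidean_space"
  assumes "0 < T"
    and Y: "\<And>\<omega>. \<omega> \<in> space M \<Longrightarrow> Y \<omega> \<in> paths T"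
    and meas: "\<And>t. t \<in> {0..T} \<Longrightarrow> (\<lambda>\<omega>. Y \<omega> t) \<in> borel_measurable M"
  shows "Y \<in> measurable M (path_borel T)"
proof (rule measurable_sigma_sets[OF sets_metric_borel])
  fix U :: "(real \<Rightarrow> 'a) set" assume "U \<in> {U. openin (mtopology_of (path_metric T)) U}"
  then have U: "openin (mtopology_of (path_metric T)) U" by simp
  let ?f = "mdist_to_set (path_metric T) (paths T - U)"
  have "(\<lambda>\<omega>. ?f ((\<lambda>j\<in>{0}. Y \<omega>) (0::nat))) \<in> borel_measurable M"
    by (rule borel_measurable_Lipschitz_paths[OF assms(1), where K=1 and F="\<lambda>z. ?f (z 0)"])
       (auto intro!: mdist_to_set_Lipschitz Y meas)
  then have "{\<omega> \<in> space M. 0 < ?f (Y \<omega>)} \<in> sets M" by simp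
  also have "{\<omega> \<in> space M. 0 < ?f (Y \<omega>)} = Y -` U \<inter> space M"
    using mdist_to_set_pos_iff[OF U] Y by auto
  finally show "Y -` U \<inter> space M \<in> sets M" .
qed (use openin_subset[of "mtopology_of (path_metric T)"] Y in auto)

text \<open>
  The indicator function of an open set \<open>U\<close> is the limit of the Lipschitz functions \<open>min 1 (n * d(x, U\<^sup>c))\<close>, and the open
  sets are a generator that is closed under intersections.
\<close>

lemma metric_borel_eqI:
  assumes "prob_space M" "prob_space N" and sets: "sets M = sets (metric_borel m)" "sets N = sets (metric_borel m)"
    and eq: "\<And>f. f \<in> borel_measurable (metric_borel m) \<Longrightarrow> (\<And>x. 0 \<le> f x) \<Longrightarrow> (\<And>x. f x \<le> 1) \<Longrightarrow>
       (\<exists>K\<ge>0. \<forall>x\<in>mspace m. \<forall>y\<in>mspace m. \<bar>f x - f y\<bar> \<le> K * mdist m x y) \<Longrightarrow>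
       (\<integral>\<^sup>+ x. ennreal (f x) \<partial>M) = (\<integral>\<^sup>+ x. ennreal (f x) \<partial>N)"
  shows "M = N"
proof -
  interpret M: prob_space M by fact
  interpret N: prob_space N by fact
  have space: "space M = mspace m" "space N = mspace m"
    using sets sets_eq_imp_space_eq[of _ "metric_borel m"] by auto
  show ?thesis
  proof (rule measure_eqI_generator_eq[where E="{U. openin (mtopology_of m) U}" and A="\<lambda>_. mspace m" and \<Omega>="mspace m"])
    show "Int_stable {U. openin (mtopology_of m) U}" by (auto simp: Int_stable_def)
    show "{U. openin (mtopology_of m) U} \<subseteq> Pow (mspace m)" using openin_subset[of "mtopology_of m"] by auto
    show "range (\<lambda>_. mspace m) \<subseteq> {U. openin (mtopology_of m) U}" by (auto simp: openin_mtopology_of_iff intro: exI[of _ 1])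
    show "emeasure M (mspace m) \<noteq> \<infinity>" by (simp flip: space)
    fix U assume "U \<in> {U. openin (mtopology_of m) U}"
    then have U: "openin (mtopology_of m) U" by simp
    then have Us: "U \<subseteq> mspace m" and [measurable]: "U \<in> sets (metric_borel m)"
      using openin_subset[of "mtopology_of m"] by (auto simp: sets_metric_borel)
    let ?f = "mdist_to_set m (mspace m - U)"
    have "?f \<in> borel_measurable (metric_borel m)"
    proof (rule borel_measurableI_greater)
      fix a
      have "openin (mtopology_of m) {x \<in> mspace m. a < ?f x}"
        unfolding openin_mtopology_of_iff
      proof (intro conjI ballI)
        fix x assume x: "x \<in> {x \<in> mspace m. a < ?f x}"
        show "\<exists>r>0. \<forall>y\<in>mspace m. mdist m x y < r \<longrightarrow> y \<in> {x \<in> mspace m. a < ?f x}"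
          using x mdist_to_set_Lipschitz[of "mspace m - U" m x]
          by (intro exI[of _ "?f x - a"]) (auto simp: abs_le_iff, force)
      qed auto
      then show "{x \<in> space (metric_borel m). a < ?f x} \<in> sets (metric_borel m)"
        by (auto simp: sets_metric_borel)
    qed
    then have [measurable]: "?f \<in> borel_measurable (metric_borel m)" .
    define g where "g n x = min 1 (real n * ?f x)" for n x
    have gm: "g n \<in> borel_measurable (metric_borel m)" for n unfolding g_def by measurable
    have g_lim: "(\<lambda>n. g n x) \<longlonglongrightarrow> indicator U x" if x: "x \<in> mspace m" for x
    proof (cases "x \<in> U")
      case True
      then have pos: "0 < ?f x" using mdist_to_set_pos_iff[OF U x] by simp
      obtain n0 :: nat where n0: "1 / ?f x < real n0" using reals_Archimedean2 by blast
      have "g n x = 1" if "n0 \<le> n" for n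
      proof -
        have "1 / ?f x \<le> real n" using n0 that by linarith
        then show ?thesis using pos by (simp add: g_def field_simps min_def)
      qed
      then have "\<forall>\<^sub>F n in sequentially. g n x = 1" by (auto simp: eventually_sequentially)
      then show ?thesis using True by (simp add: tendsto_eventually)
    next
      case False
      then have "?f x = 0" using mdist_to_set_pos_iff[OF U x] mdist_to_set_nonneg[of m "mspace m - U" x] by auto
      then show ?thesis using False by (simp add: g_def)
    qed
    have lim: "(\<lambda>n. \<integral>\<^sup>+ x. ennreal (g n x) \<partial>Q) \<longlonglongrightarrow> emeasure Q U"
      if Q: "prob_space Q" "sets Q = sets (metric_borel m)" for Q
    proof -
      interpret Q: prob_space Q by fact
      have sp: "space Q = mspace m" using Q(2) sets_eq_imp_space_eq[of Q "metric_borel m"] by simp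
      have [measurable]: "g n \<in> borel_measurable Q" for n using gm measurable_cong_sets[OF Q(2) refl] by blast
      have "(\<lambda>n. \<integral>\<^sup>+ x. ennreal (g n x) \<partial>Q) \<longlonglongrightarrow> (\<integral>\<^sup>+ x. ennreal (indicator U x) \<partial>Q)"
      proof (rule nn_integral_dominated_convergence[where w="\<lambda>_. 1"])
        show "AE x in Q. (\<lambda>n. ennreal (g n x)) \<longlonglongrightarrow> ennreal (indicator U x)"
          using g_lim by (intro AE_I2 tendsto_ennrealI) (simp add: sp)
      qed (use Q in \<open>auto simp: g_def Q.emeasure_space_1\<close>)
      then show ?thesis using Q by (simp add: ennreal_indicator)
    qed
    have "(\<integral>\<^sup>+ x. ennreal (g n x) \<partial>M) = (\<integral>\<^sup>+ x. ennreal (g n x) \<partial>N)" for n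
    proof (rule eq[OF gm])
      show "\<exists>K\<ge>0. \<forall>x\<in>mspace m. \<forall>y\<in>mspace m. \<bar>g n x - g n y\<bar> \<le> K * mdist m x y"
      proof (intro exI[of _ "real n"] conjI ballI)
        fix x y assume xy: "x \<in> mspace m" "y \<in> mspace m"
        have "\<bar>g n x - g n y\<bar> \<le> \<bar>real n * ?f x - real n * ?f y\<bar>" by (auto simp: g_def min_def)
        also have "\<dots> = real n * \<bar>?f x - ?f y\<bar>" by (simp add: abs_mult flip: right_diff_distrib)
        also have "\<dots> \<le> real n * mdist m x y"
          using xy by (intro mult_left_mono mdist_to_set_Lipschitz) auto
        finally show "\<bar>g n x - g n y\<bar> \<le> real n * mdist m x y" .
      qed simp
    qed (auto simp: g_def mdist_to_set_nonneg)
    then show "emeasure M U = emeasure N U"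
      using lim[OF assms(1) sets(1)] lim[OF assms(2) sets(2)] LIMSEQ_unique by auto
  qed (auto simp: sets sets_metric_borel)
qed

section \<open>Gaussian concentration on Wiener space\<close>

definition l2_dist :: "'a metric \<Rightarrow> 'i set \<Rightarrow> ('i \<Rightarrow> 'a) \<Rightarrow> ('i \<Rightarrow> 'a) \<Rightarrow> real" where
  "l2_dist m I x y = sqrt (\<Sum>i\<in>I. (mdist m (x i) (y i))\<^sup>2)"

lemma l2_dist_triangle:
  assumes "x \<in> I \<rightarrow>\<^sub>E mspace m" "y \<in> I \<rightarrow>\<^sub>E mspace m" "z \<in> I \<rightarrow>\<^sub>E mspace m"
  shows "l2_dist m I x z \<le> l2_dist m I x y + l2_dist m I y z"
proof -
  have "l2_dist m I x z \<le> L2_set (\<lambda>i. mdist m (x i) (y i) + mdist m (y i) (z i)) I"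
    unfolding l2_dist_def L2_set_def[symmetric]
    using assms by (intro L2_set_mono mdist_triangle) auto
  also have "\<dots> \<le> L2_set (\<lambda>i. mdist m (x i) (y i)) I + L2_set (\<lambda>i. mdist m (y i) (z i)) I"
    by (rule L2_set_triangle_ineq)
  finally show ?thesis by (simp add: l2_dist_def L2_set_def)
qed

definition Lipschitz_l2 :: "real \<Rightarrow> nat set \<Rightarrow> real \<Rightarrow> ((nat \<Rightarrow> real \<Rightarrow> 'a::metric_space) \<Rightarrow> real) \<Rightarrow> bool" where
  "Lipschitz_l2 T I K F \<longleftrightarrow>
     (\<forall>x\<in>I \<rightarrow>\<^sub>E paths T. \<forall>y\<in>I \<rightarrow>\<^sub>E paths T. \<bar>F x - F y\<bar> \<le> K * l2_dist (path_metric T) I x y)"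

lemma Lipschitz_l2I:
  assumes "\<And>x y. x \<in> I \<rightarrow>\<^sub>E paths T \<Longrightarrow> y \<in> I \<rightarrow>\<^sub>E paths T \<Longrightarrow> \<bar>F x - F y\<bar> \<le> K * l2_dist (path_metric T) I x y"
  shows "Lipschitz_l2 T I K F"
  using assms by (auto simp: Lipschitz_l2_def)

lemma Lipschitz_l2D:
  assumes "Lipschitz_l2 T I K F" "x \<in> I \<rightarrow>\<^sub>E paths T" "y \<in> I \<rightarrow>\<^sub>E paths T"
  shows "\<bar>F x - F y\<bar> \<le> K * l2_dist (path_metric T) I x y"
  using assms by (auto simp: Lipschitz_l2_def)

lemma l2_dist_le_sum: "l2_dist m I x y \<le> (\<Sum>i\<in>I. mdist m (x i) (y i))"
  using L2_set_le_sum_abs[of "\<lambda>i. mdist m (x i) (y i)" I] by (simp add: l2_dist_def L2_set_def)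

abbreviation exp_moment :: "'a measure \<Rightarrow> ('a \<Rightarrow> real) \<Rightarrow> real \<Rightarrow> ennreal" where
  "exp_moment M F l \<equiv> \<integral>\<^sup>+ \<omega>. ennreal (exp (l * F \<omega>)) \<partial>M"

locale wiener_space =
  fixes T :: real and P :: "(real \<Rightarrow> real ^ 'd::finite) measure"
  assumes T_pos: "0 < T" and wiener: "wiener_measure T P"
begin

lemma T_nonneg: "0 \<le> T" using T_pos by simp

sublocale prob_space P
  using wiener by (simp add: wiener_measure_def)

lemma sets_P [measurable_cong]: "sets P = sets (path_borel T)"
  using wiener by (simp add: wiener_measure_def)

lemma space_P: "space P = paths T"
  using sets_eq_imp_space_eq[OF sets_P] by simp

lemma measurable_eval: "t \<in> {0..T} \<Longrightarrow> (\<lambda>\<omega>. \<omega> t) \<in> borel_measurable P"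
  using measurable_evaluation[OF T_nonneg] measurable_cong_sets[OF sets_P refl] by blast

lemma AE_start: "AE \<omega> in P. \<omega> 0 = 0"
  using wiener by (simp add: wiener_measure_def)

definition increments :: "nat \<Rightarrow> (real \<Rightarrow> real ^ 'd) \<Rightarrow> nat \<times> 'd \<Rightarrow> real" where
  "increments n \<omega> = (\<lambda>(k, i)\<in>{..<n} \<times> UNIV. (\<omega> (gridpt T n (Suc k)) - \<omega> (gridpt T n k)) $ i)"

definition gauss :: "nat \<Rightarrow> real measure" where
  "gauss n = density lborel (normal_density 0 (sqrt (T / real n)))"

abbreviation gauss_vector :: "nat \<Rightarrow> (nat \<times> 'd \<Rightarrow> real) measure" where
  "gauss_vector n \<equiv> PiM ({..<n} \<times> UNIV) (\<lambda>_. gauss n)"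

definition path_of :: "nat \<Rightarrow> (nat \<times> 'd \<Rightarrow> real) \<Rightarrow> real \<Rightarrow> real ^ 'd" where
  "path_of n z = polygonal T n 0 (\<lambda>k. \<chi> i. z (k, i))"

lemma path_of_in_paths: "path_of n z \<in> paths T"
  by (simp add: path_of_def polygonal_in_paths)

lemma prob_space_gauss: "0 < n \<Longrightarrow> prob_space (gauss n)"
  unfolding gauss_def using T_pos by (intro prob_space_normal_density) simp

lemma sets_gauss [simp, measurable_cong]: "sets (gauss n) = sets borel"
  by (simp add: gauss_def)

lemma sets_gauss_vector: "sets (gauss_vector n) = sets (PiM ({..<n} \<times> UNIV) (\<lambda>_. borel))"
  by (intro sets_PiM_cong) auto

lemma prob_space_gauss_vector: "0 < n \<Longrightarrow> prob_space (gauss_vector n)"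
  by (intro prob_space_PiM prob_space_gauss)

lemma measurable_increments:
  assumes "\<And>t. t \<in> {0..T} \<Longrightarrow> (\<lambda>\<omega>. Y \<omega> t) \<in> borel_measurable M"
  shows "(\<lambda>\<omega>. increments n (Y \<omega>)) \<in> measurable M (PiM ({..<n} \<times> UNIV) (\<lambda>_. borel))"
  unfolding increments_def
proof (rule measurable_restrict)
  fix p :: "nat \<times> 'd" assume p: "p \<in> {..<n} \<times> UNIV"
  obtain k i where ki: "p = (k, i)" by (cases p)
  have [measurable]: "(\<lambda>\<omega>. Y \<omega> (gridpt T n (Suc k))) \<in> borel_measurable M" "(\<lambda>\<omega>. Y \<omega> (gridpt T n k)) \<in> borel_measurable M"
    using p ki gridpt_bounds[of T "Suc k" n] gridpt_bounds[of T k n] T_nonneg by (auto intro!: assms)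
  have "(\<lambda>\<omega>. (Y \<omega> (gridpt T n (Suc k)) - Y \<omega> (gridpt T n k)) $ i) \<in> borel_measurable M"
    by (rule measurable_compose[OF _ borel_measurable_continuous_onI[OF continuous_on_component[OF continuous_on_id]]]) measurable
  then show "(\<lambda>\<omega>. case p of (k, i) \<Rightarrow> (Y \<omega> (gridpt T n (Suc k)) - Y \<omega> (gridpt T n k)) $ i) \<in> borel_measurable M"
    by (simp add: ki)
qed

lemma distr_increments:
  assumes "0 < n"
  shows "distr P (PiM ({..<n} \<times> UNIV) (\<lambda>_. borel)) (increments n) = gauss_vector n"
proof -
  let ?J = "{..<n} \<times> (UNIV :: 'd set)" and ?t = "\<lambda>k. gridpt T n k"
  let ?X = "\<lambda>(k, i) \<omega>. (\<omega> (?t (Suc k)) - \<omega> (?t k)) $ i"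
  have t: "0 \<le> ?t 0" "\<forall>k<n. ?t k < ?t (Suc k)" "?t n \<le> T"
    using T_pos assms by (auto simp: gridpt_def field_simps)
  have bounds: "?t k \<in> {0..T}" if "k \<le> n" for k using gridpt_bounds[OF T_nonneg that] .
  have indep: "indep_vars (\<lambda>_. borel) ?X ?J"
    using wiener t unfolding wiener_measure_def by blast
  have distr: "distr P borel (?X j) = gauss n" if j: "j \<in> ?J" for j
  proof -
    obtain k i where ki: "j = (k, i)" "k < n" using j by (cases j) auto
    have "distributed P lborel (\<lambda>\<omega>. (\<omega> (?t (Suc k)) - \<omega> (?t k)) $ i) (normal_density 0 (sqrt (?t (Suc k) - ?t k)))"
      using wiener t bounds[of "Suc k"] bounds[of k] ki unfolding wiener_measure_def by auto
    then have "distr P lborel (\<lambda>\<omega>. (\<omega> (?t (Suc k)) - \<omega> (?t k)) $ i) = density lborel (normal_density 0 (sqrt (?t (Suc k) - ?t k)))"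
      by (rule distributed_distr_eq_density)
    moreover have "?t (Suc k) - ?t k = T / n" using assms by (simp add: gridpt_def field_simps flip: add_divide_distrib)
    ultimately show ?thesis by (simp add: ki gauss_def cong: distr_cong)
  qed
  have ne: "?J \<noteq> {}" using assms by auto
  have "distr P (PiM ?J (\<lambda>_. borel)) (\<lambda>\<omega>. \<lambda>j\<in>?J. ?X j \<omega>) = PiM ?J (\<lambda>j. distr P borel (?X j))"
    using indep indep_vars_iff_distr_eq_PiM'[OF ne, where M'="\<lambda>_. borel" and X="?X"] unfolding indep_vars_def by blast
  also have "\<dots> = gauss_vector n" using distr by (intro PiM_cong) auto
  also have "(\<lambda>\<omega>. \<lambda>j\<in>?J. ?X j \<omega>) = increments n"
    by (auto simp: increments_def fun_eq_iff restrict_def)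
  finally show ?thesis .
qed

lemma measurable_increments_P: "increments n \<in> measurable P (gauss_vector n)"
  using measurable_increments[where Y="\<lambda>\<omega>. \<omega>" and M=P and n=n] measurable_eval measurable_cong_sets[OF refl sets_gauss_vector] by blast

lemma distr_increments': "0 < n \<Longrightarrow> distr P (gauss_vector n) (increments n) = gauss_vector n"
proof -
  assume n: "0 < n"
  have "distr P (gauss_vector n) (increments n) = distr P (PiM ({..<n} \<times> UNIV) (\<lambda>_. borel)) (increments n)"
    by (rule distr_cong) (simp_all add: sets_gauss_vector)
  then show ?thesis by (simp add: distr_increments[OF n])
qed

lemma path_of_increments:
  assumes "\<omega> 0 = 0"
  shows "path_of n (increments n \<omega>) = interpolate T n \<omega>"
proof -
  have "(\<chi> i. increments n \<omega> (k, i)) = \<omega> (gridpt T n (Suc k)) - \<omega> (gridpt T n k)" if "k < n" for k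
    using that by (simp add: vec_eq_iff increments_def)
  then show ?thesis
    unfolding path_of_def interpolate_def polygonal_def assms
    by (intro restrict_ext arg_cong2[where f="(+)"] refl sum.cong) auto
qed

text \<open>
  The factor \<open>n\<close> is the price of Cauchy-Schwarz; it is compensated by the variance \<open>T / n\<close> of the increments.
\<close>

lemma pdist_path_of_le:
  "(pdist T (path_of n z) (path_of n w))\<^sup>2 \<le> real n * (\<Sum>p\<in>{..<n} \<times> UNIV. (z p - w p)\<^sup>2)"
proof -
  let ?v = "\<lambda>k. (\<chi> i. z (k, i) - w (k, i)) :: real ^ 'd"
  have "(\<chi> i. z (k, i)) - (\<chi> i. w (k, i)) = ?v k" for k by (simp add: vec_eq_iff)
  then have "pdist T (path_of n z) (path_of n w) \<le> (\<Sum>k<n. norm (?v k))"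
    unfolding path_of_def using pdist_polygonal_le[OF T_nonneg, of n "0 :: real ^ 'd" "\<lambda>k. \<chi> i. z (k, i)" 0 "\<lambda>k. \<chi> i. w (k, i)"] by simp
  then have "(pdist T (path_of n z) (path_of n w))\<^sup>2 \<le> (\<Sum>k<n. norm (?v k))\<^sup>2"
    by (intro power_mono) auto
  also have "\<dots> = (\<Sum>k<n. 1 * norm (?v k))\<^sup>2" by simp
  also have "\<dots> \<le> (\<Sum>k<n. 1\<^sup>2) * (\<Sum>k<n. (norm (?v k))\<^sup>2)"
    by (rule Cauchy_Schwarz_ineq_sum)
  also have "\<dots> = real n * (\<Sum>k<n. \<Sum>i\<in>UNIV. (z (k, i) - w (k, i))\<^sup>2)"
    by (simp add: norm_vec_def L2_set_def sum_nonneg)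
  also have "(\<Sum>k<n. \<Sum>i\<in>UNIV. (z (k, i) - w (k, i))\<^sup>2) = (\<Sum>p\<in>{..<n} \<times> UNIV. (z p - w p)\<^sup>2)"
    by (simp add: sum.cartesian_product)
  finally show ?thesis .
qed

lemma measurable_path_of:
  "path_of n \<in> measurable (PiM ({..<n} \<times> UNIV) (\<lambda>_. borel)) (path_borel T)"
proof (rule measurable_path_borelI[OF T_pos path_of_in_paths])
  fix t assume t: "t \<in> {0..T}"
  have "(\<lambda>z. (\<Sum>k<n. ramp T n k t *\<^sub>R (\<chi> i. z (k, i)) :: real ^ 'd)) \<in> borel_measurable (PiM ({..<n} \<times> UNIV) (\<lambda>_. borel))"
  proof (intro borel_measurable_sum borel_measurable_scaleR borel_measurable_const)
    fix k assume "k \<in> {..<n}"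
    then have "(\<lambda>z. z (k, i)) \<in> borel_measurable (PiM ({..<n} \<times> UNIV) (\<lambda>_. borel :: real measure))" for i :: 'd
      by (intro measurable_component_singleton) auto
    then show "(\<lambda>z. (\<chi> i. z (k, i)) :: real ^ 'd) \<in> borel_measurable (PiM ({..<n} \<times> UNIV) (\<lambda>_. borel))"
      by (subst borel_measurable_euclidean_space) (auto simp: Basis_vec_def inner_axis)
  qed
  then show "(\<lambda>z. path_of n z t) \<in> borel_measurable (PiM ({..<n} \<times> UNIV) (\<lambda>_. borel))"
    using t by (simp add: path_of_def polygonal_def)
qed

text \<open>
  The cost is the sum of the one-dimensional costs \<open>(z - w)\<^sup>2 / (4 \<sigma>\<^sup>2)\<close> with \<open>\<sigma>\<^sup>2 = T / n\<close>.
\<close>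

lemma property_tau_gauss_paths:
  assumes "0 < n" "finite I"
  shows "property_tau (PiM I (\<lambda>_. gauss_vector n))
     (\<lambda>z w. \<Sum>j\<in>I. \<Sum>p\<in>{..<n} \<times> UNIV. real n * (z j p - w j p)\<^sup>2 / (4 * T))"
proof (intro property_tau_PiM prob_space_gauss_vector prob_space_gauss assms)
  have "0 < sqrt (T / real n)" using T_pos assms by simp
  from property_tau_gauss[OF this]
  show "property_tau (gauss n) (\<lambda>x y. real n * (x - y)\<^sup>2 / (4 * T))"
    using T_pos assms by (simp add: gauss_def field_simps)
qed auto

lemma ennreal_liminf_mult_le:
  fixes a b :: "nat \<Rightarrow> ennreal"
  assumes "\<And>n. a n * b n \<le> c"
  shows "liminf a * liminf b \<le> c"
proof -
  have "(INF k\<in>{n..}. a k) * (INF k\<in>{m..}. b k) \<le> c" for n m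
  proof -
    have "(INF k\<in>{n..}. a k) * (INF k\<in>{m..}. b k) \<le> a (max n m) * b (max n m)"
      by (intro mult_mono INF_lower) auto
    then show ?thesis using assms order_trans by blast
  qed
  then show ?thesis
    unfolding liminf_SUP_INF by (auto simp: SUP_mult_left_ennreal SUP_mult_right_ennreal intro!: SUP_least)
qed

lemma measurable_Lipschitz_l2:
  fixes F :: "(nat \<Rightarrow> real \<Rightarrow> 'a::euclidean_space) \<Rightarrow> real"
  assumes "finite I" "0 \<le> K"
    and Lip: "Lipschitz_l2 T I K F"
  shows "F \<in> borel_measurable (PiM I (\<lambda>_. path_borel T))"
proof -
  have "(\<lambda>x. F (\<lambda>j\<in>I. x j)) \<in> borel_measurable (PiM I (\<lambda>_. path_borel T))"
  proof (rule borel_measurable_Lipschitz_paths[OF T_pos assms(1,2), where Y="\<lambda>j x. x j"])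
    fix x y :: "nat \<Rightarrow> real \<Rightarrow> 'a" assume xy: "x \<in> I \<rightarrow>\<^sub>E paths T" "y \<in> I \<rightarrow>\<^sub>E paths T"
    show "\<bar>F x - F y\<bar> \<le> K * (\<Sum>j\<in>I. pdist T (x j) (y j))"
      using order_trans[OF Lipschitz_l2D[OF Lip xy] mult_left_mono[OF l2_dist_le_sum assms(2)]] .
  next
    fix j t assume j: "j \<in> I" and t: "t \<in> {0..T}"
    show "(\<lambda>x. x j t) \<in> borel_measurable (PiM I (\<lambda>_. path_borel T))"
      by (rule measurable_compose[OF measurable_component_singleton[OF j] measurable_evaluation[OF T_nonneg t]])
  qed (auto simp: space_PiM)
  then show ?thesis
    by (rule measurable_cong[THEN iffD1, rotated]) (auto simp: space_PiM PiE_def extensional_restrict)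
qed

text \<open>
  Property \<open>\<tau>\<close> with \<open>u = exp (l * F)\<close> and \<open>v = exp (- l\<^sup>2 * K\<^sup>2 * T - l * F)\<close>. If \<open>r\<close> is the distance of two
  tuples of polygonal paths, then the cost of their increments is at least \<open>r\<^sup>2 / (4 * T)\<close>, and
  \<open>l * (F z - F w) \<le> \<bar>l\<bar> * K * r \<le> l\<^sup>2 * K\<^sup>2 * T + r\<^sup>2 / (4 * T)\<close>.
\<close>

lemma exp_Lipschitz_polygonal:
  fixes F :: "(nat \<Rightarrow> real \<Rightarrow> real ^ 'd) \<Rightarrow> real"
  assumes n: "0 < n" and I: "finite I" and K: "0 \<le> K"
    and Lip: "Lipschitz_l2 T I K F"
  defines "Fn \<equiv> \<lambda>\<omega>. F (\<lambda>j\<in>I. path_of n (increments n (\<omega> j)))"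
  shows "exp_moment (PiM I (\<lambda>_. P)) Fn l * exp_moment (PiM I (\<lambda>_. P)) Fn (- l) \<le> ennreal (exp (l\<^sup>2 * K\<^sup>2 * T))"
proof -
  let ?J = "{..<n} \<times> (UNIV :: 'd set)"
  let ?Z = "PiM I (\<lambda>_. gauss_vector n)" and ?B = "PiM ?J (\<lambda>_. borel :: real measure)"
  let ?R = "\<lambda>z. \<lambda>j\<in>I. path_of n (z j)"
  have law: "distr (PiM I (\<lambda>_. P)) ?Z (compose I (increments n)) = ?Z"
    using distr_PiM_finite_prob_space'[OF I, of "\<lambda>_. P" "\<lambda>_. gauss_vector n" "increments n"]
    by (simp add: prob_space_axioms prob_space_gauss_vector[OF n] measurable_increments_P distr_increments'[OF n])
  have comp: "compose I (increments n) \<in> measurable (PiM I (\<lambda>_. P)) ?Z"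
    unfolding compose_def
    by (intro measurable_restrict measurable_compose[OF measurable_component_singleton] measurable_increments_P)
  have R: "?R \<in> measurable ?Z (PiM I (\<lambda>_. path_borel T))"
    using measurable_path_of measurable_cong_sets[OF sets_gauss_vector refl]
    by (intro measurable_restrict measurable_compose[OF measurable_component_singleton]) auto
  have [measurable]: "(\<lambda>z. F (?R z)) \<in> borel_measurable ?Z"
    by (rule measurable_compose[OF R measurable_Lipschitz_l2[OF I K Lip]])
  have Fn: "Fn = (\<lambda>\<omega>. F (?R (compose I (increments n) \<omega>)))"
    by (simp add: Fn_def compose_def fun_eq_iff cong: restrict_cong)
  have transfer: "exp_moment (PiM I (\<lambda>_. P)) Fn r = exp_moment ?Z (\<lambda>z. F (?R z)) r" for r
    unfolding Fn using nn_integral_distr[OF comp, of "\<lambda>z. ennreal (exp (r * F (?R z)))"] by (simp add: law)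
  let ?c = "l\<^sup>2 * K\<^sup>2 * T"
  let ?F = "\<lambda>z. F (?R z)"
  have "exp_moment ?Z ?F l * (\<integral>\<^sup>+ z. ennreal (exp (- ?c)) * ennreal (exp (- l * F (?R z))) \<partial>?Z) \<le> 1"
  proof (rule property_tauD[OF property_tau_gauss_paths[OF n I]])
    fix z w :: "nat \<Rightarrow> nat \<times> 'd \<Rightarrow> real"
    let ?q = "\<Sum>j\<in>I. \<Sum>p\<in>?J. real n * (z j p - w j p)\<^sup>2 / (4 * T)"
    let ?r = "sqrt (\<Sum>j\<in>I. (pdist T (path_of n (z j)) (path_of n (w j)))\<^sup>2)"
    have "?r\<^sup>2 = (\<Sum>j\<in>I. (pdist T (path_of n (z j)) (path_of n (w j)))\<^sup>2)"
      by (simp add: sum_nonneg)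
    also have "\<dots> \<le> (\<Sum>j\<in>I. real n * (\<Sum>p\<in>?J. (z j p - w j p)\<^sup>2))"
      by (intro sum_mono pdist_path_of_le)
    also have "\<dots> = 4 * T * ?q"
      using T_pos by (simp add: sum_distrib_left)
    finally have r: "?r\<^sup>2 / (4 * T) \<le> ?q" using T_pos by (simp add: field_simps)
    have R_dist: "l2_dist (path_metric T) I (?R z) (?R w) = ?r" by (simp add: l2_dist_def)
    have "l * F (?R z) - l * F (?R w) = l * (F (?R z) - F (?R w))" by (simp add: algebra_simps)
    also have "\<dots> \<le> \<bar>l\<bar> * \<bar>F (?R z) - F (?R w)\<bar>" by (metis abs_ge_self abs_mult)
    also have "\<dots> \<le> \<bar>l\<bar> * (K * ?r)"
      unfolding R_dist[symmetric]
      by (intro mult_left_mono Lipschitz_l2D[OF Lip]) (auto simp: path_of_in_paths)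
    also have "\<dots> \<le> ?c + ?r\<^sup>2 / (4 * T)"
    proof -
      have "0 \<le> (2 * T * (\<bar>l\<bar> * K) - ?r)\<^sup>2" by simp
      also have "\<dots> = 4 * T * (?c + ?r\<^sup>2 / (4 * T) - \<bar>l\<bar> * (K * ?r))"
        using T_pos by (simp add: power2_diff field_simps power2_eq_square)
      finally show ?thesis using T_pos by (simp add: zero_le_mult_iff)
    qed
    finally have le: "l * F (?R z) + (- ?c + - l * F (?R w)) \<le> ?q" using r by simp
    have "ennreal (exp (l * F (?R z))) * (ennreal (exp (- ?c)) * ennreal (exp (- l * F (?R w))))
      = ennreal (exp (l * F (?R z) + (- ?c + - l * F (?R w))))"
      by (simp only: exp_add ennreal_mult exp_ge_zero mult_nonneg_nonneg)
    also have "\<dots> \<le> ennreal (exp ?q)" using le by (intro ennreal_leI) simp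
    finally show "ennreal (exp (l * F (?R z))) * (ennreal (exp (- ?c)) * ennreal (exp (- l * F (?R w)))) \<le> ennreal (exp ?q)" .
  qed measurable
  then have *: "exp_moment ?Z ?F l * (ennreal (exp (- ?c)) * exp_moment ?Z ?F (- l)) \<le> 1"
    by (subst (asm) nn_integral_cmult) auto
  have "ennreal (exp ?c) * ennreal (exp (- ?c)) = 1"
    by (simp flip: ennreal_mult exp_add)
  then have "exp_moment ?Z ?F l * exp_moment ?Z ?F (- l) = (ennreal (exp ?c) * ennreal (exp (- ?c))) * (exp_moment ?Z ?F l * exp_moment ?Z ?F (- l))"
    by (simp only: mult_1)
  also have "\<dots> = ennreal (exp ?c) * (exp_moment ?Z ?F l * (ennreal (exp (- ?c)) * exp_moment ?Z ?F (- l)))"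
    by (simp only: mult_ac)
  also have "\<dots> \<le> ennreal (exp ?c) * 1" by (rule mult_left_mono[OF *]) simp
  finally show ?thesis unfolding transfer by simp
qed

text \<open>
  Interpolating on finer and finer grids leaves the bound unchanged and converges to \<open>F\<close> almost
  surely, so Fatou's lemma applies to both factors. Since the moments are extended nonnegative reals, the
  inequality also contains the information that they are finite.
\<close>

theorem exp_Lipschitz:
  fixes F :: "(nat \<Rightarrow> real \<Rightarrow> real ^ 'd) \<Rightarrow> real"
  assumes I: "finite I" and K: "0 \<le> K"
    and Lip: "Lipschitz_l2 T I K F"
  shows "exp_moment (PiM I (\<lambda>_. P)) F l * exp_moment (PiM I (\<lambda>_. P)) F (- l) \<le> ennreal (exp (l\<^sup>2 * K\<^sup>2 * T))"
proof -
  let ?M = "PiM I (\<lambda>_. P)"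
  define Fn where "Fn n \<omega> = F (\<lambda>j\<in>I. path_of (Suc n) (increments (Suc n) (\<omega> j)))" for n \<omega>
  have Fmeas: "F \<in> borel_measurable (PiM I (\<lambda>_. path_borel T))"
    by (rule measurable_Lipschitz_l2[OF I K Lip])
  have "(\<lambda>\<omega>. path_of n (increments n \<omega>)) \<in> measurable P (path_borel T)" for n
    by (rule measurable_compose[OF measurable_increments[OF measurable_eval] measurable_path_of])
  then have "(\<lambda>\<omega>. \<lambda>j\<in>I. path_of n (increments n (\<omega> j))) \<in> measurable ?M (PiM I (\<lambda>_. path_borel T))" for n
    by (intro measurable_restrict measurable_compose[OF measurable_component_singleton])
  then have [measurable]: "Fn n \<in> borel_measurable ?M" for n
    unfolding Fn_def by (rule measurable_compose[OF _ Fmeas])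
  have sp: "space ?M = I \<rightarrow>\<^sub>E paths T" by (simp add: space_PiM space_P)
  have "AE \<omega> in ?M. \<forall>j\<in>I. \<omega> j 0 = 0"
    using I by (intro AE_finite_allI AE_PiM_component AE_start prob_space_axioms) auto
  then have lim: "AE \<omega> in ?M. (\<lambda>n. Fn n \<omega>) \<longlonglongrightarrow> F \<omega>"
    using AE_space
  proof eventually_elim
    fix \<omega> assume 0: "\<forall>j\<in>I. \<omega> j 0 = 0" and \<omega>: "\<omega> \<in> space ?M"
    let ?b = "\<lambda>n. K * sqrt (\<Sum>j\<in>I. (pdist T (interpolate T (Suc n) (\<omega> j)) (\<omega> j))\<^sup>2)"
    show "(\<lambda>n. Fn n \<omega>) \<longlonglongrightarrow> F \<omega>"
    proof (rule LIM_zero_cancel, rule Lim_null_comparison)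
      show "\<forall>\<^sub>F n in sequentially. norm (Fn n \<omega> - F \<omega>) \<le> ?b n"
      proof (intro always_eventually allI)
        fix n
        have "\<bar>Fn n \<omega> - F \<omega>\<bar> \<le> K * l2_dist (path_metric T) I (\<lambda>j\<in>I. path_of (Suc n) (increments (Suc n) (\<omega> j))) \<omega>"
          unfolding Fn_def using \<omega> by (intro Lipschitz_l2D[OF Lip]) (auto simp: sp path_of_in_paths)
        then show "norm (Fn n \<omega> - F \<omega>) \<le> ?b n"
          using 0 by (simp add: l2_dist_def path_of_increments cong: sum.cong)
      qed
      have "?b \<longlonglongrightarrow> K * sqrt (\<Sum>j\<in>I. 0\<^sup>2)"
      proof (intro tendsto_intros)
        fix j assume "j \<in> I"
        then have "\<omega> j \<in> paths T" using \<omega> by (auto simp: sp)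
        then show "(\<lambda>n. pdist T (interpolate T (Suc n) (\<omega> j)) (\<omega> j)) \<longlonglongrightarrow> 0"
          by (rule LIMSEQ_Suc[OF interpolate_tendsto[OF T_pos]])
      qed
      then show "?b \<longlonglongrightarrow> 0" by simp
    qed
  qed
  have fatou: "exp_moment ?M F r \<le> liminf (\<lambda>n. exp_moment ?M (Fn n) r)" for r
  proof -
    have "exp_moment ?M F r = (\<integral>\<^sup>+ \<omega>. liminf (\<lambda>n. ennreal (exp (r * Fn n \<omega>))) \<partial>?M)"
    proof (rule nn_integral_cong_AE)
      show "AE \<omega> in ?M. ennreal (exp (r * F \<omega>)) = liminf (\<lambda>n. ennreal (exp (r * Fn n \<omega>)))"
        using lim
      proof eventually_elim
        fix \<omega> assume "(\<lambda>n. Fn n \<omega>) \<longlonglongrightarrow> F \<omega>"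
        then have "(\<lambda>n. ennreal (exp (r * Fn n \<omega>))) \<longlonglongrightarrow> ennreal (exp (r * F \<omega>))"
          by (intro tendsto_intros tendsto_ennrealI)
        then show "ennreal (exp (r * F \<omega>)) = liminf (\<lambda>n. ennreal (exp (r * Fn n \<omega>)))"
          using lim_imp_Liminf[OF sequentially_bot] by metis
      qed
    qed
    also have "\<dots> \<le> liminf (\<lambda>n. exp_moment ?M (Fn n) r)"
      by (intro nn_integral_liminf) measurable
    finally show ?thesis .
  qed
  have "exp_moment ?M (Fn n) l * exp_moment ?M (Fn n) (- l) \<le> ennreal (exp (l\<^sup>2 * K\<^sup>2 * T))" for n
    unfolding Fn_def by (rule exp_Lipschitz_polygonal[OF _ I K Lip]) simp
  then have "liminf (\<lambda>n. exp_moment ?M (Fn n) l) * liminf (\<lambda>n. exp_moment ?M (Fn n) (- l)) \<le> ennreal (exp (l\<^sup>2 * K\<^sup>2 * T))"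
    by (rule ennreal_liminf_mult_le)
  then show ?thesis
    by (rule order_trans[rotated]) (intro mult_mono fatou zero_le)
qed

definition zero_path :: "real \<Rightarrow> real ^ 'd" where
  "zero_path = (\<lambda>t\<in>{0..T}. 0)"

lemma zero_path_in_paths: "zero_path \<in> paths T"
  by (auto simp: zero_path_def mspace_path_metric intro: continuous_on_eq[OF continuous_on_const])

lemma nn_integral_single_path:
  fixes f :: "(real \<Rightarrow> real ^ 'd) \<Rightarrow> ennreal"
  assumes "f \<in> borel_measurable P"
  shows "(\<integral>\<^sup>+ \<omega>. f (\<omega> 0) \<partial>PiM {0::nat} (\<lambda>_. P)) = (\<integral>\<^sup>+ \<omega>. f \<omega> \<partial>P)"
proof -
  interpret product_sigma_finite "\<lambda>_::nat. P" ..
  show ?thesis using assms by (intro product_nn_integral_singleton)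
qed

lemma Lipschitz_measurable:
  fixes f :: "(real \<Rightarrow> real ^ 'd) \<Rightarrow> real"
  assumes "\<And>x y. x \<in> paths T \<Longrightarrow> y \<in> paths T \<Longrightarrow> \<bar>f x - f y\<bar> \<le> K * pdist T x y"
  shows "f \<in> borel_measurable P"
proof -
  let ?K = "max K 0"
  have "(\<lambda>\<omega>. f ((\<lambda>j\<in>{0::nat}. \<omega>) 0)) \<in> borel_measurable P"
  proof (rule borel_measurable_Lipschitz_paths[OF T_pos, where K="?K" and F="\<lambda>x. f (x 0)"])
    fix x y :: "nat \<Rightarrow> real \<Rightarrow> real ^ 'd" assume "x \<in> {0} \<rightarrow>\<^sub>E paths T" "y \<in> {0} \<rightarrow>\<^sub>E paths T"
    then have "\<bar>f (x 0) - f (y 0)\<bar> \<le> K * pdist T (x 0) (y 0)" by (intro assms) auto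
    also have "\<dots> \<le> ?K * pdist T (x 0) (y 0)" by (intro mult_right_mono) auto
    finally show "\<bar>f (x 0) - f (y 0)\<bar> \<le> ?K * (\<Sum>j\<in>{0}. pdist T (x j) (y j))" by simp
  qed (use measurable_eval in \<open>auto simp: space_P\<close>)
  then show ?thesis by simp
qed

lemma norm_measurable: "(\<lambda>\<omega>. pdist T \<omega> zero_path) \<in> borel_measurable P"
  by (rule Lipschitz_measurable[where K=1]) (simp add: mdist_triangle_abs zero_path_in_paths)

text \<open>
  The concentration inequality for the norm itself: its second factor is positive, so the first one is finite.
\<close>

lemma exp_norm_finite: "(\<integral>\<^sup>+ \<omega>. ennreal (exp (pdist T \<omega> zero_path)) \<partial>P) < \<infinity>"
proof -
  let ?f = "\<lambda>\<omega>. pdist T \<omega> zero_path"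
  have [measurable]: "?f \<in> borel_measurable P" by (rule norm_measurable)
  have Lip: "Lipschitz_l2 T {0} 1 (\<lambda>x. ?f (x 0))"
  proof (rule Lipschitz_l2I)
    fix x y :: "nat \<Rightarrow> real \<Rightarrow> real ^ 'd" assume "x \<in> {0} \<rightarrow>\<^sub>E paths T" "y \<in> {0} \<rightarrow>\<^sub>E paths T"
    then have "x 0 \<in> paths T" "y 0 \<in> paths T" by (auto dest: PiE_mem)
    then have "\<bar>?f (x 0) - ?f (y 0)\<bar> \<le> pdist T (x 0) (y 0)"
      by (rule mdist_triangle_abs[OF _ _ zero_path_in_paths])
    then show "\<bar>?f (x 0) - ?f (y 0)\<bar> \<le> 1 * l2_dist (path_metric T) {0} x y" by (simp add: l2_dist_def)
  qed
  have single: "exp_moment (PiM {0::nat} (\<lambda>_. P)) (\<lambda>x. ?f (x 0)) r = exp_moment P ?f r" for r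
    by (rule nn_integral_single_path) measurable
  have "exp_moment P ?f 1 * exp_moment P ?f (- 1) \<le> ennreal (exp (1\<^sup>2 * 1\<^sup>2 * T))"
    using exp_Lipschitz[OF _ zero_le_one Lip, of 1] unfolding single by simp
  then have le: "(\<integral>\<^sup>+ \<omega>. ennreal (exp (?f \<omega>)) \<partial>P) * (\<integral>\<^sup>+ \<omega>. ennreal (exp (- ?f \<omega>)) \<partial>P) \<le> ennreal (exp T)"
    by simp
  have "(\<integral>\<^sup>+ \<omega>. ennreal (exp (- ?f \<omega>)) \<partial>P) \<noteq> 0"
  proof
    assume "(\<integral>\<^sup>+ \<omega>. ennreal (exp (- ?f \<omega>)) \<partial>P) = 0"
    then have "AE \<omega> in P. ennreal (exp (- ?f \<omega>)) = 0" by (subst (asm) nn_integral_0_iff_AE) auto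
    then have "AE \<omega> in P. False" by (simp add: ennreal_eq_0_iff not_le)
    then show False by simp
  qed
  with le show ?thesis
    by (metis ennreal_mult_eq_top_iff ennreal_less_top infinity_ennreal_def less_le_not_le mult.commute top.not_eq_extremum)
qed

lemma integrable_norm: "integrable P (\<lambda>\<omega>. pdist T \<omega> zero_path)"
proof (rule integrableI_bounded)
  have "(\<integral>\<^sup>+ \<omega>. ennreal (norm (pdist T \<omega> zero_path)) \<partial>P) \<le> (\<integral>\<^sup>+ \<omega>. ennreal (exp (pdist T \<omega> zero_path)) \<partial>P)"
    by (intro nn_integral_mono ennreal_leI) (use exp_ge_add_one_self in \<open>smt (verit) mdist_nonneg real_norm_def\<close>)
  then show "(\<integral>\<^sup>+ \<omega>. ennreal (norm (pdist T \<omega> zero_path)) \<partial>P) < \<infinity>"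
    using exp_norm_finite by (rule le_less_trans)
qed (rule norm_measurable)

lemma integrable_Lipschitz:
  fixes f :: "(real \<Rightarrow> real ^ 'd) \<Rightarrow> real"
  assumes "\<And>x y. x \<in> paths T \<Longrightarrow> y \<in> paths T \<Longrightarrow> \<bar>f x - f y\<bar> \<le> K * pdist T x y"
  shows "integrable P f"
proof (rule Bochner_Integration.integrable_bound)
  show "integrable P (\<lambda>\<omega>. \<bar>f zero_path\<bar> + \<bar>K\<bar> * pdist T \<omega> zero_path)"
    using integrable_norm by simp
  show "AE \<omega> in P. norm (f \<omega>) \<le> norm (\<bar>f zero_path\<bar> + \<bar>K\<bar> * pdist T \<omega> zero_path)"
  proof (intro AE_I2)
    fix \<omega> assume "\<omega> \<in> space P"
    then have "\<bar>f \<omega> - f zero_path\<bar> \<le> K * pdist T \<omega> zero_path"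
      using assms zero_path_in_paths by (simp add: space_P)
    also have "\<dots> \<le> \<bar>K\<bar> * pdist T \<omega> zero_path" by (intro mult_right_mono) auto
    finally show "norm (f \<omega>) \<le> norm (\<bar>f zero_path\<bar> + \<bar>K\<bar> * pdist T \<omega> zero_path)" by simp
  qed
qed (rule Lipschitz_measurable[OF assms])

section \<open>The Markov property of Wiener measure\<close>

text \<open>
  The path that follows \<open>\<omega>\<close> up to time \<open>s\<close> and then continues with the increments of \<open>\<eta>\<close>.
\<close>

definition concat_path :: "real \<Rightarrow> (real \<Rightarrow> real ^ 'd) \<Rightarrow> (real \<Rightarrow> real ^ 'd) \<Rightarrow> real \<Rightarrow> real ^ 'd" where
  "concat_path s \<omega> \<eta> = (\<lambda>t\<in>{0..T}. \<omega> (min t s) + (\<eta> (max t s) - \<eta> s))"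

lemma concat_path_in_paths:
  assumes "s \<in> {0..T}" "\<omega> \<in> paths T" "\<eta> \<in> paths T"
  shows "concat_path s \<omega> \<eta> \<in> paths T"
proof -
  have c: "continuous_on {0..T} \<omega>" "continuous_on {0..T} \<eta>" using assms by (auto simp: mspace_path_metric)
  have "continuous_on {0..T} (\<lambda>t. \<omega> (min t s) + (\<eta> (max t s) - \<eta> s))"
    using assms(1)
    by (intro continuous_intros continuous_on_compose2[OF c(1)] continuous_on_compose2[OF c(2)]) auto
  then show ?thesis
    unfolding mspace_path_metric concat_path_def by (auto intro: continuous_on_eq)
qed

text \<open>
  Paths with the same later increments keep the distance that their pasts have; in particular
  averaging over the later increments does not increase a Lipschitz constant.
\<close>

lemma pdist_concat_path_le:
  assumes "s \<in> {0..T}" "\<omega> \<in> paths T" "\<omega>' \<in> paths T" "\<eta> \<in> paths T"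
  shows "pdist T (concat_path s \<omega> \<eta>) (concat_path s \<omega>' \<eta>) \<le> pdist T \<omega> \<omega>'"
proof (rule pdist_le[OF T_nonneg])
  fix t assume t: "t \<in> {0..T}"
  then have "dist (\<omega> (min t s)) (\<omega>' (min t s)) \<le> pdist T \<omega> \<omega>'"
    using assms by (intro pdist_ge[OF T_nonneg]) auto
  then show "dist (concat_path s \<omega> \<eta> t) (concat_path s \<omega>' \<eta> t) \<le> pdist T \<omega> \<omega>'"
    using t by (simp add: concat_path_def dist_norm)
qed (use assms concat_path_in_paths in auto)

lemma measurable_concat_path:
  assumes "s \<in> {0..T}"
  shows "(\<lambda>(\<omega>, \<eta>). concat_path s \<omega> \<eta>) \<in> measurable (P \<Otimes>\<^sub>M P) (path_borel T)"
proof (rule measurable_path_borelI[OF T_pos])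
  fix p assume "p \<in> space (P \<Otimes>\<^sub>M P)"
  then show "(case p of (\<omega>, \<eta>) \<Rightarrow> concat_path s \<omega> \<eta>) \<in> paths T"
    using assms by (auto simp: space_pair_measure space_P intro: concat_path_in_paths)
next
  fix t assume t: "t \<in> {0..T}"
  have [measurable]: "(\<lambda>p. fst p r) \<in> borel_measurable (P \<Otimes>\<^sub>M P)" "(\<lambda>p. snd p r) \<in> borel_measurable (P \<Otimes>\<^sub>M P)"
    if "r \<in> {0..T}" for r
    using measurable_compose[OF measurable_fst measurable_eval[OF that]] measurable_compose[OF measurable_snd measurable_eval[OF that]] by auto
  have "min t s \<in> {0..T}" "max t s \<in> {0..T}" using t assms by auto
  then have "(\<lambda>p. fst p (min t s) + (snd p (max t s) - snd p s)) \<in> borel_measurable (P \<Otimes>\<^sub>M P)"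
    using assms by measurable
  then show "(\<lambda>p. (case p of (\<omega>, \<eta>) \<Rightarrow> concat_path s \<omega> \<eta>) t) \<in> borel_measurable (P \<Otimes>\<^sub>M P)"
    using t by (simp add: concat_path_def case_prod_beta)
qed

lemma increments_concat_path:
  assumes "m \<le> n" "0 < n"
  shows "increments n (concat_path (gridpt T n m) \<omega> \<eta>)
    = merge ({..<m} \<times> UNIV) ({m..<n} \<times> UNIV) (restrict (increments n \<omega>) ({..<m} \<times> UNIV), restrict (increments n \<eta>) ({m..<n} \<times> UNIV))"
proof
  fix p :: "nat \<times> 'd"
  obtain k i where p: "p = (k, i)" by (cases p)
  have mono: "gridpt T n a \<le> gridpt T n b \<longleftrightarrow> a \<le> b" for a b
    using T_pos assms by (simp add: gridpt_def field_simps)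
  consider "k < m" | "m \<le> k" "k < n" | "n \<le> k" by linarith
  then show "increments n (concat_path (gridpt T n m) \<omega> \<eta>) p = merge ({..<m} \<times> UNIV) ({m..<n} \<times> UNIV)
      (restrict (increments n \<omega>) ({..<m} \<times> UNIV), restrict (increments n \<eta>) ({m..<n} \<times> UNIV)) p"
  proof cases
    case 1
    then have "gridpt T n (Suc k) \<in> {0..T}" "gridpt T n k \<in> {0..T}"
      using assms gridpt_bounds[OF T_nonneg] by auto
    then show ?thesis using 1 assms mono[of k m] mono[of "Suc k" m]
      by (simp add: p increments_def concat_path_def merge_def min_absorb1 max_absorb2)
  next
    case 2
    then have "gridpt T n (Suc k) \<in> {0..T}" "gridpt T n k \<in> {0..T}"
      using assms gridpt_bounds[OF T_nonneg] by auto
    then show ?thesis using 2 assms mono[of m k] mono[of m "Suc k"]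
      by (simp add: p increments_def concat_path_def merge_def min_absorb2 max_absorb1)
  next
    case 3
    then show ?thesis using assms by (simp add: p increments_def merge_def)
  qed
qed

lemma distr_increments_concat_path:
  assumes "m \<le> n" "0 < n"
  shows "distr (P \<Otimes>\<^sub>M P) (gauss_vector n) (\<lambda>(\<omega>, \<eta>). increments n (concat_path (gridpt T n m) \<omega> \<eta>)) = gauss_vector n"
proof -
  interpret G: product_prob_space "\<lambda>_::nat \<times> 'd. gauss n"
    by (rule product_prob_spaceI) (rule prob_space_gauss[OF assms(2)])
  let ?J = "{..<n} \<times> (UNIV :: 'd set)" and ?J1 = "{..<m} \<times> (UNIV :: 'd set)" and ?J2 = "{m..<n} \<times> (UNIV :: 'd set)"
  let ?G = "\<lambda>J. PiM J (\<lambda>_. gauss n)"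
  have J: "?J1 \<union> ?J2 = ?J" "?J1 \<inter> ?J2 = {}" using assms by auto
  have part: "distr P (?G J') (\<lambda>\<omega>. restrict (increments n \<omega>) J') = ?G J'" if J': "J' \<subseteq> ?J" for J'
  proof -
    have "distr P (?G J') (\<lambda>\<omega>. restrict (increments n \<omega>) J') = distr (distr P (?G ?J) (increments n)) (?G J') (\<lambda>z. restrict z J')"
      using J' by (subst distr_distr) (auto simp: comp_def intro: measurable_restrict_subset measurable_increments_P)
    also have "\<dots> = ?G J'"
      unfolding distr_increments'[OF assms(2)] using J' by (intro G.distr_restrict[symmetric]) auto
    finally show ?thesis .
  qed
  have mres: "(\<lambda>\<omega>. restrict (increments n \<omega>) J') \<in> measurable P (?G J')" if "J' \<subseteq> ?J" for J'
    by (rule measurable_compose[OF measurable_increments_P measurable_restrict_subset[OF that]])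
  have sub: "?J1 \<subseteq> ?J" "?J2 \<subseteq> ?J" using assms by auto
  have pair: "distr (P \<Otimes>\<^sub>M P) (?G ?J1 \<Otimes>\<^sub>M ?G ?J2) (\<lambda>(\<omega>, \<eta>). (restrict (increments n \<omega>) ?J1, restrict (increments n \<eta>) ?J2)) = ?G ?J1 \<Otimes>\<^sub>M ?G ?J2"
  proof -
    have "sigma_finite_measure (distr P (?G ?J2) (\<lambda>\<eta>. restrict (increments n \<eta>) ?J2))"
      using prob_space_distr[OF mres[OF sub(2)]] by (simp add: prob_space_imp_sigma_finite)
    then show ?thesis
      using pair_measure_distr[OF mres[OF sub(1)] mres[OF sub(2)]] by (simp add: part[OF sub(1)] part[OF sub(2)])
  qed
  have mp: "(\<lambda>(\<omega>, \<eta>). (restrict (increments n \<omega>) ?J1, restrict (increments n \<eta>) ?J2)) \<in> measurable (P \<Otimes>\<^sub>M P) (?G ?J1 \<Otimes>\<^sub>M ?G ?J2)"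
    using mres[OF sub(1)] mres[OF sub(2)] by measurable
  have "?G (?J1 \<union> ?J2) = distr (?G ?J1 \<Otimes>\<^sub>M ?G ?J2) (?G (?J1 \<union> ?J2)) (merge ?J1 ?J2)"
    by (rule G.distr_merge[OF J(2), symmetric]) auto
  also have "\<dots> = distr (distr (P \<Otimes>\<^sub>M P) (?G ?J1 \<Otimes>\<^sub>M ?G ?J2) (\<lambda>(\<omega>, \<eta>). (restrict (increments n \<omega>) ?J1, restrict (increments n \<eta>) ?J2))) (?G (?J1 \<union> ?J2)) (merge ?J1 ?J2)"
    unfolding pair ..
  also have "\<dots> = distr (P \<Otimes>\<^sub>M P) (?G (?J1 \<union> ?J2)) (\<lambda>(\<omega>, \<eta>). increments n (concat_path (gridpt T n m) \<omega> \<eta>))"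
    by (subst distr_distr[OF measurable_merge mp]) (simp add: comp_def case_prod_beta' increments_concat_path[OF assms])
  finally show ?thesis unfolding J(1) by simp
qed

lemma nn_integral_polygonal_limit:
  fixes f :: "(real \<Rightarrow> real ^ 'd) \<Rightarrow> real"
  assumes "prob_space Q" and Y: "Y \<in> measurable Q (path_borel T)" and Y0: "AE \<omega> in Q. Y \<omega> 0 = 0"
    and f: "f \<in> borel_measurable (path_borel T)" "\<And>x. 0 \<le> f x" "\<And>x. f x \<le> 1"
    and Lip: "0 \<le> K" "\<And>x y. x \<in> paths T \<Longrightarrow> y \<in> paths T \<Longrightarrow> \<bar>f x - f y\<bar> \<le> K * pdist T x y"
    and N: "filterlim N at_top sequentially"
  shows "(\<lambda>n. \<integral>\<^sup>+ \<omega>. ennreal (f (path_of (N n) (increments (N n) (Y \<omega>)))) \<partial>Q) \<longlonglongrightarrow> (\<integral>\<^sup>+ \<omega>. ennreal (f (Y \<omega>)) \<partial>Q)"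
proof -
  interpret Q: prob_space Q by fact
  have Ysp: "Y \<omega> \<in> paths T" if "\<omega> \<in> space Q" for \<omega> using measurable_space[OF Y that] by simp
  have ev: "t \<in> {0..T} \<Longrightarrow> (\<lambda>\<omega>. Y \<omega> t) \<in> borel_measurable Q" for t
    by (rule measurable_compose[OF Y measurable_evaluation[OF T_nonneg]])
  show ?thesis
  proof (rule nn_integral_dominated_convergence[where w="\<lambda>_. 1"])
    show "(\<lambda>\<omega>. ennreal (f (path_of (N n) (increments (N n) (Y \<omega>))))) \<in> borel_measurable Q" for n
      by (intro measurable_compose[OF measurable_compose[OF measurable_compose[OF measurable_increments[OF ev] measurable_path_of] f(1)] measurable_ennreal])
    show "(\<lambda>\<omega>. ennreal (f (Y \<omega>))) \<in> borel_measurable Q"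
      by (intro measurable_compose[OF measurable_compose[OF Y f(1)] measurable_ennreal])
    show "AE \<omega> in Q. (\<lambda>n. ennreal (f (path_of (N n) (increments (N n) (Y \<omega>))))) \<longlonglongrightarrow> ennreal (f (Y \<omega>))"
      using Y0 AE_space
    proof eventually_elim
      fix \<omega> assume 0: "Y \<omega> 0 = 0" and \<omega>: "\<omega> \<in> space Q"
      have "(\<lambda>n. f (interpolate T (N n) (Y \<omega>))) \<longlonglongrightarrow> f (Y \<omega>)"
      proof (rule LIM_zero_cancel, rule Lim_null_comparison)
        show "\<forall>\<^sub>F n in sequentially. norm (f (interpolate T (N n) (Y \<omega>)) - f (Y \<omega>)) \<le> K * pdist T (interpolate T (N n) (Y \<omega>)) (Y \<omega>)"
          using Lip(2)[OF interpolate_in_paths Ysp[OF \<omega>]] by simp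
        have "(\<lambda>n. pdist T (interpolate T (N n) (Y \<omega>)) (Y \<omega>)) \<longlonglongrightarrow> 0"
          using filterlim_compose[OF interpolate_tendsto[OF T_pos Ysp[OF \<omega>]] N] .
        then show "(\<lambda>n. K * pdist T (interpolate T (N n) (Y \<omega>)) (Y \<omega>)) \<longlonglongrightarrow> 0"
          by (rule tendsto_mult_right_zero)
      qed
      then show "(\<lambda>n. ennreal (f (path_of (N n) (increments (N n) (Y \<omega>))))) \<longlonglongrightarrow> ennreal (f (Y \<omega>))"
        using 0 by (simp add: path_of_increments tendsto_ennrealI)
    qed
  qed (use f in \<open>auto simp: Q.emeasure_space_1\<close>)
qed

text \<open>
  Both sides are limits of the laws of polygonal interpolations on grids that contain \<open>s\<close>. On such a
  grid the increments of the concatenated path are those of \<open>\<omega>\<close> before \<open>s\<close> and those of \<open>\<eta>\<close> after \<open>s\<close>, and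
  this vector is again a vector of independent Gaussian variables. Restricting \<open>s\<close> to rational fractions of \<open>T\<close>
  makes equidistant grids suffice.
\<close>

theorem distr_concat_path:
  assumes "m \<le> q" "0 < q"
  shows "distr (P \<Otimes>\<^sub>M P) P (\<lambda>(\<omega>, \<eta>). concat_path (gridpt T q m) \<omega> \<eta>) = P"
proof -
  let ?s = "gridpt T q m"
  interpret PP: pair_prob_space P P ..
  have s: "?s \<in> {0..T}" using gridpt_bounds[OF T_nonneg assms(1)] .
  let ?C = "\<lambda>(\<omega>, \<eta>). concat_path ?s \<omega> \<eta>"
  have mC: "?C \<in> measurable (P \<Otimes>\<^sub>M P) (path_borel T)" by (rule measurable_concat_path[OF s])
  then have mC': "?C \<in> measurable (P \<Otimes>\<^sub>M P) P" using measurable_cong_sets[OF refl sets_P] by blast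
  show ?thesis
  proof (rule metric_borel_eqI[where m="path_metric T"])
    show "prob_space (distr (P \<Otimes>\<^sub>M P) P ?C)" by (rule PP.prob_space_distr[OF mC'])
    fix f :: "(real \<Rightarrow> real ^ 'd) \<Rightarrow> real"
    assume f: "f \<in> borel_measurable (path_borel T)" "\<And>x. 0 \<le> f x" "\<And>x. f x \<le> 1"
      and "\<exists>K\<ge>0. \<forall>x\<in>paths T. \<forall>y\<in>paths T. \<bar>f x - f y\<bar> \<le> K * pdist T x y"
    then obtain K where K: "0 \<le> K" "\<And>x y. x \<in> paths T \<Longrightarrow> y \<in> paths T \<Longrightarrow> \<bar>f x - f y\<bar> \<le> K * pdist T x y" by blast
    \<comment> \<open>grids with a multiple of q steps contain the time of concatenation\<close>
    define N where "N n = Suc n * q" for n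
    have N: "filterlim N at_top sequentially"
    proof (rule filterlim_at_top_mono[OF filterlim_Suc], intro always_eventually allI)
      fix n
      have "Suc n * 1 \<le> Suc n * q" using assms(2) by (intro mult_le_mono) auto
      then show "Suc n \<le> N n" by (simp add: N_def)
    qed
    have Npos: "0 < N n" "Suc n * m \<le> N n" "gridpt T (N n) (Suc n * m) = ?s" for n
      using assms mult_le_mono[OF le_refl assms(1), of "Suc n"] gridpt_refine[of T n q m] unfolding N_def by auto
    have start: "AE p in P \<Otimes>\<^sub>M P. ?C p 0 = 0"
    proof -
      have "AE p in P \<Otimes>\<^sub>M P. fst p 0 = 0"
        using AE_start by (intro AE_distrD[where f=fst and M'=P]) (simp_all only: distr_pair_fst measurable_fst)
      then show ?thesis
      proof eventually_elim
        fix p :: "(real \<Rightarrow> real ^ 'd) \<times> (real \<Rightarrow> real ^ 'd)" assume "fst p 0 = 0"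
        then show "?C p 0 = 0"
          using s T_nonneg by (simp add: concat_path_def min_absorb1 max_absorb2 case_prod_beta)
      qed
    qed
    have fm: "(\<lambda>z. ennreal (f (path_of n z))) \<in> borel_measurable (gauss_vector n)" for n
      using measurable_compose[OF measurable_compose[OF measurable_path_of f(1)] measurable_ennreal] measurable_cong_sets[OF sets_gauss_vector refl] by blast
    have same: "(\<integral>\<^sup>+ p. ennreal (f (path_of (N n) (increments (N n) (?C p)))) \<partial>(P \<Otimes>\<^sub>M P))
      = (\<integral>\<^sup>+ \<omega>. ennreal (f (path_of (N n) (increments (N n) \<omega>))) \<partial>P)" for n
    proof -
      have minc: "(\<lambda>(\<omega>, \<eta>). increments (N n) (concat_path ?s \<omega> \<eta>)) \<in> measurable (P \<Otimes>\<^sub>M P) (gauss_vector (N n))"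
        using measurable_compose[OF mC' measurable_increments_P[of "N n"]] by (simp add: case_prod_beta')
      have "(\<integral>\<^sup>+ p. ennreal (f (path_of (N n) (increments (N n) (?C p)))) \<partial>(P \<Otimes>\<^sub>M P))
        = (\<integral>\<^sup>+ z. ennreal (f (path_of (N n) z)) \<partial>distr (P \<Otimes>\<^sub>M P) (gauss_vector (N n)) (\<lambda>(\<omega>, \<eta>). increments (N n) (concat_path ?s \<omega> \<eta>)))"
        by (subst nn_integral_distr[OF minc]) (simp_all add: fm case_prod_beta')
      also have "\<dots> = (\<integral>\<^sup>+ z. ennreal (f (path_of (N n) z)) \<partial>distr P (gauss_vector (N n)) (increments (N n)))"
        by (simp only: distr_increments_concat_path[OF Npos(2,1)[of n], unfolded Npos(3)] distr_increments'[OF Npos(1)[of n]])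
      also have "\<dots> = (\<integral>\<^sup>+ \<omega>. ennreal (f (path_of (N n) (increments (N n) \<omega>))) \<partial>P)"
        by (rule nn_integral_distr[OF measurable_increments_P]) (simp add: fm)
      finally show ?thesis .
    qed
    have "(\<lambda>n. \<integral>\<^sup>+ p. ennreal (f (path_of (N n) (increments (N n) (?C p)))) \<partial>(P \<Otimes>\<^sub>M P)) \<longlonglongrightarrow> (\<integral>\<^sup>+ p. ennreal (f (?C p)) \<partial>(P \<Otimes>\<^sub>M P))"
      by (rule nn_integral_polygonal_limit[OF PP.prob_space_axioms mC start f K N])
    moreover have "(\<lambda>n. \<integral>\<^sup>+ \<omega>. ennreal (f (path_of (N n) (increments (N n) \<omega>))) \<partial>P) \<longlonglongrightarrow> (\<integral>\<^sup>+ \<omega>. ennreal (f \<omega>) \<partial>P)"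
    proof -
      have "(\<lambda>\<omega>. \<omega>) \<in> measurable P (path_borel T)" by (rule measurable_ident_sets[OF sets_P, unfolded id_def])
      from nn_integral_polygonal_limit[OF prob_space_axioms this AE_start f K N] show ?thesis .
    qed
    ultimately have "(\<integral>\<^sup>+ p. ennreal (f (?C p)) \<partial>(P \<Otimes>\<^sub>M P)) = (\<integral>\<^sup>+ \<omega>. ennreal (f \<omega>) \<partial>P)"
      unfolding same by (rule LIMSEQ_unique)
    moreover have "(\<lambda>x. ennreal (f x)) \<in> borel_measurable P"
      using measurable_compose[OF f(1) measurable_ennreal] measurable_cong_sets[OF sets_P refl] by blast
    ultimately show "(\<integral>\<^sup>+ x. ennreal (f x) \<partial>distr (P \<Otimes>\<^sub>M P) P ?C) = (\<integral>\<^sup>+ x. ennreal (f x) \<partial>P)"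
      by (subst nn_integral_distr[OF mC']) auto
  qed (auto simp: sets_P prob_space_axioms)
qed

end

section \<open>The completed filtration and conditional means\<close>

context wiener_space
begin

abbreviation "P' \<equiv> completion P"
abbreviation "\<F> \<equiv> completed_filtration T P"

sublocale P': prob_space P' by (rule prob_space_completion)

definition past_events :: "real \<Rightarrow> (real \<Rightarrow> real ^ 'd) set set" where
  "past_events t = {(\<lambda>\<omega>. \<omega> s) -` B \<inter> space P | s B. 0 \<le> s \<and> s \<le> t \<and> s \<le> T \<and> B \<in> sets borel}"

lemma past_events_sets: "past_events t \<subseteq> sets P"
proof
  fix A assume "A \<in> past_events t"
  then obtain s B where "A = (\<lambda>\<omega>. \<omega> s) -` B \<inter> space P" "0 \<le> s" "s \<le> T" "B \<in> sets borel"
    by (auto simp: past_events_def)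
  then show "A \<in> sets P" using measurable_sets[OF measurable_eval] by auto
qed

lemma generator_subset: "past_events t \<union> null_sets P' \<subseteq> Pow (space P)"
proof (rule Un_least)
  show "past_events t \<subseteq> Pow (space P)" using past_events_sets sets.space_closed[of P] by (rule order_trans)
  show "null_sets P' \<subseteq> Pow (space P)" using sets.space_closed[of P'] by (auto simp: null_sets_def)
qed

lemma sets_filtration: "sets (\<F> t) = sigma_sets (space P) (past_events t \<union> null_sets P')"
  unfolding completed_filtration_def past_events_def[symmetric] using generator_subset by (rule sets_measure_of)

lemma space_filtration [simp]: "space (\<F> t) = space P"
  unfolding completed_filtration_def past_events_def[symmetric] using generator_subset by (rule space_measure_of)

lemma filtration_mono:
  assumes "s \<le> t" shows "sets (\<F> s) \<subseteq> sets (\<F> t)"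
proof -
  have "past_events s \<subseteq> past_events t" using assms unfolding past_events_def by fastforce
  then show ?thesis unfolding sets_filtration by (intro sigma_sets_mono') auto
qed

lemma filtration_subset: "sets (\<F> t) \<subseteq> sets P'"
proof -
  have "past_events t \<union> null_sets P' \<subseteq> sets P'"
    using past_events_sets by (auto simp: null_sets_def)
  then show ?thesis
    unfolding sets_filtration using sets.sigma_sets_subset[of _ P'] by simp
qed

lemma subalgebra_filtration: "subalgebra P' (\<F> t)"
  using filtration_subset by (simp add: subalgebra_def)

text \<open>
  The events that agree almost surely with an event of the uncompleted filtration form a \<open>\<sigma>\<close>-algebra. This
  reduces statements about the completed filtration to events that depend on the path before \<open>t\<close> only.
\<close>

lemma sets_filtration_raw:
  assumes "A \<in> sets (\<F> t)"
  obtains A0 where "A0 \<in> sigma_sets (space P) (past_events t)" "AE \<omega> in P'. \<omega> \<in> A \<longleftrightarrow> \<omega> \<in> A0"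
proof -
  have "\<exists>A0\<in>sigma_sets (space P) (past_events t). AE \<omega> in P'. \<omega> \<in> A \<longleftrightarrow> \<omega> \<in> A0"
    using assms unfolding sets_filtration
  proof (induction rule: sigma_sets.induct)
    case (Basic A)
    then show ?case
    proof
      assume "A \<in> null_sets P'"
      then have "AE \<omega> in P'. \<omega> \<in> A \<longleftrightarrow> \<omega> \<in> {}" by (auto dest: AE_not_in)
      then show ?thesis using sigma_sets.Empty by blast
    qed auto
  next
    case Empty
    then show ?case using sigma_sets.Empty by blast
  next
    case (Compl A)
    then obtain A0 where A0: "A0 \<in> sigma_sets (space P) (past_events t)" "AE \<omega> in P'. \<omega> \<in> A \<longleftrightarrow> \<omega> \<in> A0" by blast
    from A0(2) have "AE \<omega> in P'. \<omega> \<in> space P - A \<longleftrightarrow> \<omega> \<in> space P - A0" by eventually_elim auto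
    then show ?case using sigma_sets.Compl[OF A0(1)] by blast
  next
    case (Union A)
    then have "\<forall>i::nat. \<exists>A0. A0 \<in> sigma_sets (space P) (past_events t) \<and> (AE \<omega> in P'. \<omega> \<in> A i \<longleftrightarrow> \<omega> \<in> A0)"
      by (simp add: Bex_def)
    from choice[OF this] obtain A0
      where A0: "\<And>i::nat. A0 i \<in> sigma_sets (space P) (past_events t)" "\<And>i. AE \<omega> in P'. \<omega> \<in> A i \<longleftrightarrow> \<omega> \<in> A0 i"
      by auto
    have "AE \<omega> in P'. \<forall>i. \<omega> \<in> A i \<longleftrightarrow> \<omega> \<in> A0 i" unfolding AE_all_countable using A0(2) by blast
    then have "AE \<omega> in P'. \<omega> \<in> \<Union>(range A) \<longleftrightarrow> \<omega> \<in> \<Union>(range A0)"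
    proof eventually_elim
      fix \<omega> assume "\<forall>i. \<omega> \<in> A i \<longleftrightarrow> \<omega> \<in> A0 i"
      then show "\<omega> \<in> \<Union>(range A) \<longleftrightarrow> \<omega> \<in> \<Union>(range A0)" by simp
    qed
    then show ?case using sigma_sets.Union[of A0, OF A0(1)] by (rule bexI)
  qed
  then show ?thesis using that by blast
qed

lemma past_event_concat_path:
  assumes "A \<in> sigma_sets (space P) (past_events s)" and s: "s \<in> {0..T}" and \<omega>: "\<omega> \<in> paths T" "\<eta> \<in> paths T"
  shows "concat_path s \<omega> \<eta> \<in> A \<longleftrightarrow> \<omega> \<in> A"
  using assms(1)
proof (induction rule: sigma_sets.induct)
  case (Basic A)
  then obtain r B where "A = (\<lambda>\<omega>. \<omega> r) -` B \<inter> space P" "0 \<le> r" "r \<le> s" "r \<le> T"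
    by (auto simp: past_events_def)
  moreover from this have "concat_path s \<omega> \<eta> r = \<omega> r" by (simp add: concat_path_def min_absorb1 max_absorb2)
  ultimately show ?case
    using concat_path_in_paths[OF s \<omega>] \<omega> by (simp add: space_P)
next
  case (Compl A)
  then show ?case using concat_path_in_paths[OF s \<omega>] \<omega> by (simp add: space_P)
qed auto

lemma measurable_filtration_eval:
  assumes "0 \<le> s" "s \<le> t" "s \<le> T"
  shows "(\<lambda>\<omega>. \<omega> s) \<in> borel_measurable (\<F> t)"
proof (rule measurableI)
  fix B :: "(real ^ 'd) set" assume "B \<in> sets borel"
  then have "(\<lambda>\<omega>. \<omega> s) -` B \<inter> space P \<in> past_events t" using assms by (auto simp: past_events_def)
  then show "(\<lambda>\<omega>. \<omega> s) -` B \<inter> space (\<F> t) \<in> sets (\<F> t)" by (auto simp: sets_filtration)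
qed simp

definition Lipschitz_path :: "real \<Rightarrow> ((real \<Rightarrow> real ^ 'd) \<Rightarrow> real) \<Rightarrow> bool" where
  "Lipschitz_path L u \<longleftrightarrow> (\<forall>x\<in>paths T. \<forall>y\<in>paths T. \<bar>u x - u y\<bar> \<le> L * pdist T x y)"

lemma Lipschitz_pathD: "Lipschitz_path L u \<Longrightarrow> x \<in> paths T \<Longrightarrow> y \<in> paths T \<Longrightarrow> \<bar>u x - u y\<bar> \<le> L * pdist T x y"
  by (auto simp: Lipschitz_path_def)

lemma Lipschitz_path_integrable: "Lipschitz_path L u \<Longrightarrow> integrable P u"
  by (rule integrable_Lipschitz) (auto dest: Lipschitz_pathD)

lemma Lipschitz_path_measurable: "Lipschitz_path L u \<Longrightarrow> u \<in> borel_measurable P"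
  by (rule Lipschitz_measurable) (auto dest: Lipschitz_pathD)

lemma Lipschitz_path_integrable': "Lipschitz_path L u \<Longrightarrow> integrable P' u"
  using Lipschitz_path_integrable Lipschitz_path_measurable integrable_completion by blast

text \<open>
  An everywhere defined version of the conditional expectation given \<open>\<F> s\<close>: the past of the path is kept and the
  increments after \<open>s\<close> are averaged. Lipschitz continuity is meaningful for this version only, since
  a conditional expectation is a class of almost surely equal functions.
\<close>

definition conditional_mean :: "real \<Rightarrow> ((real \<Rightarrow> real ^ 'd) \<Rightarrow> real) \<Rightarrow> (real \<Rightarrow> real ^ 'd) \<Rightarrow> real" where
  "conditional_mean s u \<omega> = (\<integral>\<eta>. u (concat_path s \<omega> \<eta>) \<partial>P)"

lemma integrable_concat_path:
  assumes u: "Lipschitz_path L u" and s: "s \<in> {0..T}" and \<omega>: "\<omega> \<in> paths T" and L: "0 \<le> L"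
  shows "integrable P (\<lambda>\<eta>. u (concat_path s \<omega> \<eta>))"
proof (rule integrable_Lipschitz)
  fix x y :: "real \<Rightarrow> real ^ 'd" assume xy: "x \<in> paths T" "y \<in> paths T"
  have "pdist T (concat_path s \<omega> x) (concat_path s \<omega> y) \<le> 2 * pdist T x y"
  proof (rule pdist_le[OF T_nonneg concat_path_in_paths[OF s \<omega> xy(1)] concat_path_in_paths[OF s \<omega> xy(2)]])
    fix t assume t: "t \<in> {0..T}"
    have "dist (concat_path s \<omega> x t) (concat_path s \<omega> y t) = norm ((x (max t s) - y (max t s)) - (x s - y s))"
      using t by (simp add: concat_path_def dist_norm algebra_simps)
    also have "\<dots> \<le> dist (x (max t s)) (y (max t s)) + dist (x s) (y s)"
      by (simp add: dist_norm norm_triangle_ineq4)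
    also have "\<dots> \<le> pdist T x y + pdist T x y"
      using t s xy by (intro add_mono pdist_ge[OF T_nonneg]) auto
    finally show "dist (concat_path s \<omega> x t) (concat_path s \<omega> y t) \<le> 2 * pdist T x y" by simp
  qed
  then have "L * pdist T (concat_path s \<omega> x) (concat_path s \<omega> y) \<le> L * (2 * pdist T x y)"
    using L by (intro mult_left_mono)
  then show "\<bar>u (concat_path s \<omega> x) - u (concat_path s \<omega> y)\<bar> \<le> (2 * L) * pdist T x y"
    using Lipschitz_pathD[OF u concat_path_in_paths[OF s \<omega> xy(1)] concat_path_in_paths[OF s \<omega> xy(2)]] by simp
qed

lemma Lipschitz_conditional_mean:
  assumes u: "Lipschitz_path L u" and s: "s \<in> {0..T}" and L: "0 \<le> L"
  shows "Lipschitz_path L (conditional_mean s u)"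
  unfolding Lipschitz_path_def
proof (intro ballI)
  fix x y :: "real \<Rightarrow> real ^ 'd" assume xy: "x \<in> paths T" "y \<in> paths T"
  note int = integrable_concat_path[OF u s _ L]
  have "\<bar>conditional_mean s u x - conditional_mean s u y\<bar> = \<bar>\<integral>\<eta>. u (concat_path s x \<eta>) - u (concat_path s y \<eta>) \<partial>P\<bar>"
    using int xy by (simp add: conditional_mean_def)
  also have "\<dots> \<le> (\<integral>\<eta>. \<bar>u (concat_path s x \<eta>) - u (concat_path s y \<eta>)\<bar> \<partial>P)"
    by (rule integral_abs_bound)
  also have "\<dots> \<le> (\<integral>\<eta>. L * pdist T x y \<partial>P)"
  proof (rule integral_mono)
    fix \<eta> assume "\<eta> \<in> space P"
    then have \<eta>: "\<eta> \<in> paths T" by (simp add: space_P)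
    have "\<bar>u (concat_path s x \<eta>) - u (concat_path s y \<eta>)\<bar> \<le> L * pdist T (concat_path s x \<eta>) (concat_path s y \<eta>)"
      using Lipschitz_pathD[OF u] concat_path_in_paths[OF s _ \<eta>] xy by blast
    also have "\<dots> \<le> L * pdist T x y" using L by (intro mult_left_mono pdist_concat_path_le s xy \<eta>)
    finally show "\<bar>u (concat_path s x \<eta>) - u (concat_path s y \<eta>)\<bar> \<le> L * pdist T x y" .
  qed (use int xy in auto)
  also have "\<dots> = L * pdist T x y" by (simp add: prob_space)
  finally show "\<bar>conditional_mean s u x - conditional_mean s u y\<bar> \<le> L * pdist T x y" .
qed

text \<open>
  Freezing the path at time \<open>s\<close> is measurable for \<open>\<F> s\<close> and does not change the conditional mean.
\<close>

lemma measurable_conditional_mean: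
  assumes u: "Lipschitz_path L u" and s: "s \<in> {0..T}" and L: "0 \<le> L"
  shows "conditional_mean s u \<in> borel_measurable (\<F> s)"
proof -
  let ?stop = "\<lambda>\<omega>. concat_path s \<omega> zero_path"
  have "?stop \<in> measurable (\<F> s) (path_borel T)"
  proof (rule measurable_path_borelI[OF T_pos])
    fix t assume t: "t \<in> {0..T}"
    then have "(\<lambda>\<omega>. \<omega> (min t s) + (zero_path (max t s) - zero_path s)) \<in> borel_measurable (\<F> s)"
      using s by (intro borel_measurable_add measurable_filtration_eval) auto
    then show "(\<lambda>\<omega>. concat_path s \<omega> zero_path t) \<in> borel_measurable (\<F> s)"
      using t by (simp add: concat_path_def)
  qed (auto simp: space_P intro: concat_path_in_paths[OF s _ zero_path_in_paths])
  moreover have "conditional_mean s u \<in> borel_measurable (path_borel T)"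
    using Lipschitz_path_measurable[OF Lipschitz_conditional_mean[OF u s L]] measurable_cong_sets[OF sets_P refl] by blast
  ultimately have "(\<lambda>\<omega>. conditional_mean s u (?stop \<omega>)) \<in> borel_measurable (\<F> s)"
    by (rule measurable_compose)
  moreover have "conditional_mean s u (?stop \<omega>) = conditional_mean s u \<omega>" for \<omega>
  proof -
    have "concat_path s (?stop \<omega>) \<eta> = concat_path s \<omega> \<eta>" for \<eta>
      using s by (auto simp: concat_path_def fun_eq_iff restrict_def zero_path_def)
    then show ?thesis by (simp add: conditional_mean_def)
  qed
  ultimately show ?thesis by simp
qed

text \<open>
  Wiener measure is the law of the concatenation of two independent paths, and an event of the past
  does not notice the second path, so Fubini's theorem yields the defining identity of conditional expectation.
\<close>

lemma set_integral_conditional_mean: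
  assumes u: "Lipschitz_path L u" and L: "0 \<le> L" and mq: "m \<le> q" "0 < q"
    and A: "A \<in> sets (\<F> (gridpt T q m))"
  shows "(LINT \<omega>:A|P'. u \<omega>) = (LINT \<omega>:A|P'. conditional_mean (gridpt T q m) u \<omega>)"
proof -
  let ?s = "gridpt T q m"
  have s: "?s \<in> {0..T}" using gridpt_bounds[OF T_nonneg mq(1)] .
  interpret PP: pair_prob_space P P ..
  obtain A0 where A0: "A0 \<in> sigma_sets (space P) (past_events ?s)" and AE: "AE \<omega> in P'. \<omega> \<in> A \<longleftrightarrow> \<omega> \<in> A0"
    using sets_filtration_raw[OF A] by blast
  have [measurable]: "A0 \<in> sets P" using A0 past_events_sets sets.sigma_sets_subset[of "past_events ?s" P] by auto
  have reduce: "(LINT \<omega>:A|P'. f \<omega>) = (LINT \<omega>|P. indicator A0 \<omega> * f \<omega>)" if [measurable]: "f \<in> borel_measurable P" for f :: "_ \<Rightarrow> real"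
  proof -
    have [measurable]: "A \<in> sets P'" using A filtration_subset by blast
    have "(LINT \<omega>:A|P'. f \<omega>) = (LINT \<omega>|P'. indicator A0 \<omega> * f \<omega>)"
      unfolding set_lebesgue_integral_def
    proof (rule integral_cong_AE)
      show "AE \<omega> in P'. indicator A \<omega> *\<^sub>R f \<omega> = indicator A0 \<omega> * f \<omega>"
        using AE by eventually_elim (auto simp: indicator_def)
      show "(\<lambda>\<omega>. indicator A \<omega> *\<^sub>R f \<omega>) \<in> borel_measurable P'"
        using measurable_completion[OF that] by measurable
      show "(\<lambda>\<omega>. indicator A0 \<omega> * f \<omega>) \<in> borel_measurable P'"
        by (intro measurable_completion) measurable
    qed
    also have "\<dots> = (LINT \<omega>|P. indicator A0 \<omega> * f \<omega>)" by (rule integral_completion) measurable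
    finally show ?thesis .
  qed
  let ?C = "\<lambda>(\<omega>, \<eta>). concat_path ?s \<omega> \<eta>"
  have mC: "?C \<in> measurable (P \<Otimes>\<^sub>M P) P"
    using measurable_concat_path[OF s] measurable_cong_sets[OF refl sets_P] by blast
  have law: "distr (P \<Otimes>\<^sub>M P) P ?C = P" by (rule distr_concat_path[OF mq])
  have [measurable]: "u \<in> borel_measurable P" by (rule Lipschitz_path_measurable[OF u])
  have "integrable P (\<lambda>\<omega>. indicator A0 \<omega> * u \<omega>)"
    using integrable_mult_indicator[of A0 P u] Lipschitz_path_integrable[OF u] by simp
  then have int: "integrable (P \<Otimes>\<^sub>M P) (\<lambda>p. indicator A0 (?C p) * u (?C p))"
    using integrable_distr_eq[OF mC, of "\<lambda>\<omega>. indicator A0 \<omega> * u \<omega>"] law by simp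
  have "(LINT \<omega>|P. indicator A0 \<omega> * u \<omega>) = (LINT \<omega>|distr (P \<Otimes>\<^sub>M P) P ?C. indicator A0 \<omega> * u \<omega>)"
    by (simp only: law)
  also have "\<dots> = (LINT p|(P \<Otimes>\<^sub>M P). indicator A0 (?C p) * u (?C p))"
    by (rule integral_distr[OF mC]) measurable
  also have "\<dots> = (LINT \<omega>|P. LINT \<eta>|P. indicator A0 (?C (\<omega>, \<eta>)) * u (?C (\<omega>, \<eta>)))"
    by (rule PP.integral_fst'[OF int, symmetric])
  also have "\<dots> = (LINT \<omega>|P. indicator A0 \<omega> * conditional_mean ?s u \<omega>)"
  proof (rule Bochner_Integration.integral_cong[OF refl])
    fix \<omega> assume \<omega>: "\<omega> \<in> space P"
    have "(LINT \<eta>|P. indicator A0 (?C (\<omega>, \<eta>)) * u (?C (\<omega>, \<eta>))) = (LINT \<eta>|P. indicator A0 \<omega> * u (concat_path ?s \<omega> \<eta>))"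
      using \<omega> past_event_concat_path[OF A0 s] by (intro Bochner_Integration.integral_cong) (auto simp: indicator_def space_P)
    then show "(LINT \<eta>|P. indicator A0 (?C (\<omega>, \<eta>)) * u (?C (\<omega>, \<eta>))) = indicator A0 \<omega> * conditional_mean ?s u \<omega>"
      by (simp add: conditional_mean_def)
  qed
  finally show ?thesis
    using reduce[of u] reduce[of "conditional_mean ?s u"] Lipschitz_path_measurable[OF Lipschitz_conditional_mean[OF u s L]] by simp
qed

end

section \<open>Optimal stopping on finite grids\<close>

locale optimal_stopping = wiener_space T P for T and P :: "(real \<Rightarrow> real ^ 'd::finite) measure" +
  fixes \<Gamma> :: "real \<Rightarrow> (real \<Rightarrow> real ^ 'd) \<Rightarrow> real" and L :: real
  assumes adapted: "\<And>t. t \<in> {0..T} \<Longrightarrow> \<Gamma> t \<in> borel_measurable (\<F> t)"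
    and continuous: "\<And>\<omega>. \<omega> \<in> space P \<Longrightarrow> continuous_on {0..T} (\<lambda>t. \<Gamma> t \<omega>)"
    and L_nonneg: "0 \<le> L"
    and Lipschitz_reward: "\<And>t. t \<in> {0..T} \<Longrightarrow> Lipschitz_path L (\<Gamma> t)"
begin

lemma reward_bound:
  "\<exists>C\<ge>0. \<forall>t\<in>{0..T}. \<forall>\<omega>\<in>paths T. \<bar>\<Gamma> t \<omega>\<bar> \<le> C + L * pdist T \<omega> zero_path"
proof -
  have "compact ((\<lambda>t. \<Gamma> t zero_path) ` {0..T})"
    using continuous zero_path_in_paths by (intro compact_continuous_image) (auto simp: space_P)
  then obtain C where "\<forall>x\<in>(\<lambda>t. \<Gamma> t zero_path) ` {0..T}. norm x \<le> C"
    using compact_imp_bounded bounded_iff by blast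
  then have C: "\<bar>\<Gamma> t zero_path\<bar> \<le> C" if "t \<in> {0..T}" for t using that by auto
  have "0 \<le> C" using order_trans[OF abs_ge_zero C[of 0]] T_nonneg by simp
  moreover have "\<bar>\<Gamma> t \<omega>\<bar> \<le> C + L * pdist T \<omega> zero_path" if "t \<in> {0..T}" "\<omega> \<in> paths T" for t \<omega>
    using C[OF that(1)] Lipschitz_pathD[OF Lipschitz_reward[OF that(1)] that(2) zero_path_in_paths] by linarith
  ultimately show ?thesis by blast
qed

lemma integrable_envelope: "integrable P' (\<lambda>\<omega>. C + L * pdist T \<omega> zero_path)"
  using integrable_norm norm_measurable integrable_completion[of "\<lambda>\<omega>. C + L * pdist T \<omega> zero_path" P] by simp

text \<open>
  Stopping times with values in the grid of \<open>n\<close> steps, encoded by the index \<open>\<kappa>\<close> of the grid point.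
\<close>

definition grid_stopping :: "nat \<Rightarrow> ((real \<Rightarrow> real ^ 'd) \<Rightarrow> nat) \<Rightarrow> bool" where
  "grid_stopping n \<kappa> \<longleftrightarrow> (\<forall>\<omega>\<in>space P. \<kappa> \<omega> \<le> n) \<and> (\<forall>k\<le>n. {\<omega> \<in> space P. \<kappa> \<omega> \<le> k} \<in> sets (\<F> (gridpt T n k)))"

abbreviation stopped :: "nat \<Rightarrow> ((real \<Rightarrow> real ^ 'd) \<Rightarrow> nat) \<Rightarrow> (real \<Rightarrow> real ^ 'd) \<Rightarrow> real" where
  "stopped n \<kappa> \<omega> \<equiv> \<Gamma> (gridpt T n (\<kappa> \<omega>)) \<omega>"

lemma gridpt_le: "k \<le> n \<Longrightarrow> gridpt T n k \<in> {0..T}"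
  by (rule gridpt_bounds[OF T_nonneg])

lemma gridpt_mono: "j \<le> k \<Longrightarrow> gridpt T n j \<le> gridpt T n k"
  unfolding gridpt_def using T_nonneg by (intro divide_right_mono mult_left_mono) auto

lemma measurable_reward: "t \<in> {0..T} \<Longrightarrow> \<Gamma> t \<in> borel_measurable P'"
  by (rule measurable_from_subalg[OF subalgebra_filtration adapted])

lemma measurable_stopped:
  assumes "grid_stopping n \<kappa>"
  shows "stopped n \<kappa> \<in> borel_measurable P'"
proof -
  have le: "{\<omega> \<in> space P. \<kappa> \<omega> \<le> k} \<in> sets P'" for k
  proof (cases "k \<le> n")
    case True
    then show ?thesis using assms filtration_subset by (auto simp: grid_stopping_def)
  next
    case False
    then have "{\<omega> \<in> space P. \<kappa> \<omega> \<le> k} = space P'" using assms by (auto simp: grid_stopping_def intro: order_trans)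
    then show ?thesis by (metis sets.top)
  qed
  have "\<kappa> \<in> measurable P' (count_space UNIV)"
  proof (rule measurable_count_space_eq2_countable[THEN iffD2], intro conjI ballI)
    fix k :: nat
    have "\<kappa> -` {k} \<inter> space P' = {\<omega> \<in> space P. \<kappa> \<omega> \<le> k} - (if k = 0 then {} else {\<omega> \<in> space P. \<kappa> \<omega> \<le> k - 1})"
      by auto
    then show "\<kappa> -` {k} \<inter> space P' \<in> sets P'" using le[of k] le[of "k - 1"] by (auto split: if_splits)
  qed auto
  then have "(\<lambda>\<omega>. min n (\<kappa> \<omega>)) \<in> measurable P' (count_space UNIV)" by measurable
  then have "(\<lambda>\<omega>. \<Gamma> (gridpt T n (min n (min n (\<kappa> \<omega>)))) \<omega>) \<in> borel_measurable P'"
    by (rule measurable_compose_countable[where f="\<lambda>k. \<Gamma> (gridpt T n (min n k))", rotated])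
       (auto intro!: measurable_reward gridpt_le)
  then show ?thesis
    by (rule measurable_cong[THEN iffD1, rotated]) (use assms in \<open>auto simp: grid_stopping_def min_absorb2\<close>)
qed

lemma integrable_of_reward_bound:
  assumes "f \<in> borel_measurable P'" and "\<And>\<omega>. \<omega> \<in> space P \<Longrightarrow> \<exists>t\<in>{0..T}. f \<omega> = \<Gamma> t \<omega>"
  shows "integrable P' f"
proof -
  obtain C where C: "0 \<le> C" "\<And>t \<omega>. t \<in> {0..T} \<Longrightarrow> \<omega> \<in> paths T \<Longrightarrow> \<bar>\<Gamma> t \<omega>\<bar> \<le> C + L * pdist T \<omega> zero_path"
    using reward_bound by blast
  show ?thesis
  proof (rule Bochner_Integration.integrable_bound[OF integrable_envelope[of C] assms(1)])
    show "AE \<omega> in P'. norm (f \<omega>) \<le> norm (C + L * pdist T \<omega> zero_path)"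
    proof (rule AE_I2)
      fix \<omega> assume "\<omega> \<in> space P'"
      then have \<omega>: "\<omega> \<in> space P" "\<omega> \<in> paths T" by (simp_all add: space_P)
      obtain t where "t \<in> {0..T}" "f \<omega> = \<Gamma> t \<omega>" using assms(2)[OF \<omega>(1)] by blast
      with \<omega> show "norm (f \<omega>) \<le> norm (C + L * pdist T \<omega> zero_path)" using C(2)[of t \<omega>] by simp
    qed
  qed
qed

lemma integrable_stopped: "grid_stopping n \<kappa> \<Longrightarrow> integrable P' (stopped n \<kappa>)"
  by (rule integrable_of_reward_bound[OF measurable_stopped]) (auto simp: grid_stopping_def intro!: gridpt_le bexI)

lemma set_integrable: "integrable P' f \<Longrightarrow> A \<in> sets (\<F> t) \<Longrightarrow> set_integrable P' A f" for f :: "_ \<Rightarrow> real"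
  unfolding set_integrable_def using filtration_subset by (intro integrable_mult_indicator) auto

lemma set_integral_split:
  fixes f :: "_ \<Rightarrow> real"
  assumes "integrable P' f" "A \<in> sets (\<F> t)" "B \<in> sets (\<F> t)"
  shows "(LINT \<omega>:A|P'. f \<omega>) = (LINT \<omega>:A \<inter> B|P'. f \<omega>) + (LINT \<omega>:A - B|P'. f \<omega>)"
proof -
  have "A = (A \<inter> B) \<union> (A - B)" by auto
  then have "(LINT \<omega>:A|P'. f \<omega>) = (LINT \<omega>:(A \<inter> B) \<union> (A - B)|P'. f \<omega>)" by simp
  also have "\<dots> = (LINT \<omega>:A \<inter> B|P'. f \<omega>) + (LINT \<omega>:A - B|P'. f \<omega>)"
    using assms by (intro set_integral_Un set_integrable[of _ _ t]) auto
  finally show ?thesis .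
qed

lemma set_integral_mono_filtration:
  fixes f g :: "_ \<Rightarrow> real"
  assumes "integrable P' f" "integrable P' g" "A \<in> sets (\<F> t)" "\<And>\<omega>. \<omega> \<in> A \<Longrightarrow> f \<omega> \<le> g \<omega>"
  shows "(LINT \<omega>:A|P'. f \<omega>) \<le> (LINT \<omega>:A|P'. g \<omega>)"
  using assms by (intro set_integral_mono set_integrable[of _ _ t])

lemma set_integral_cong_filtration:
  fixes f g :: "_ \<Rightarrow> real"
  assumes "\<And>\<omega>. \<omega> \<in> A \<Longrightarrow> f \<omega> = g \<omega>"
  shows "(LINT \<omega>:A|P'. f \<omega>) = (LINT \<omega>:A|P'. g \<omega>)"
  unfolding set_lebesgue_integral_def using assms by (intro Bochner_Integration.integral_cong) (auto simp: indicator_def)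

text \<open>
  The Snell envelope of the reward on the grid of \<open>n\<close> steps, indexed by the number \<open>j\<close> of steps to go.
\<close>

fun snell :: "nat \<Rightarrow> nat \<Rightarrow> (real \<Rightarrow> real ^ 'd) \<Rightarrow> real" where
  "snell n 0 = \<Gamma> T"
| "snell n (Suc j) = (\<lambda>\<omega>. max (\<Gamma> (gridpt T n (n - Suc j)) \<omega>) (conditional_mean (gridpt T n (n - Suc j)) (snell n j) \<omega>))"

lemma Lipschitz_snell: "Lipschitz_path L (snell n j)"
proof (induction j)
  case 0
  then show ?case using Lipschitz_reward T_nonneg by simp
next
  case (Suc j)
  let ?t = "gridpt T n (n - Suc j)"
  have t: "?t \<in> {0..T}" by (rule gridpt_le) simp
  show ?case
    unfolding Lipschitz_path_def
  proof (intro ballI)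
    fix x y :: "real \<Rightarrow> real ^ 'd" assume xy: "x \<in> paths T" "y \<in> paths T"
    have "\<bar>\<Gamma> ?t x - \<Gamma> ?t y\<bar> \<le> L * pdist T x y"
      by (rule Lipschitz_pathD[OF Lipschitz_reward[OF t] xy])
    moreover have "\<bar>conditional_mean ?t (snell n j) x - conditional_mean ?t (snell n j) y\<bar> \<le> L * pdist T x y"
      by (rule Lipschitz_pathD[OF Lipschitz_conditional_mean[OF Suc t L_nonneg] xy])
    ultimately show "\<bar>snell n (Suc j) x - snell n (Suc j) y\<bar> \<le> L * pdist T x y"
      unfolding snell.simps by (smt (verit))
  qed
qed

lemma measurable_snell:
  assumes "0 < n" "j \<le> n"
  shows "snell n j \<in> borel_measurable (\<F> (gridpt T n (n - j)))"
proof (cases j)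
  case 0
  have "gridpt T n n = T" using assms by (simp add: gridpt_def)
  then show ?thesis using adapted[of T] T_nonneg 0 by simp
next
  case (Suc i)
  have "gridpt T n (n - Suc i) \<in> {0..T}" by (rule gridpt_le) simp
  then show ?thesis
    unfolding Suc snell.simps by (intro borel_measurable_max adapted measurable_conditional_mean[OF Lipschitz_snell _ L_nonneg])
qed

lemma integrable_snell: "integrable P' (snell n j)"
  by (rule Lipschitz_path_integrable'[OF Lipschitz_snell])

text \<open>
  No grid stopping time does better than the Snell envelope. On the event that stopping happens at once the
  reward is a lower bound of the envelope; on its complement the later stopping time is bounded by
  the envelope one step ahead, whose conditional mean is again a lower bound. Integrals over events
  of the filtration stand in for conditional expectations.
\<close>

lemma snell_upper:
  assumes "0 < n" "j \<le> n" "grid_stopping n \<kappa>" "\<And>\<omega>. \<omega> \<in> space P \<Longrightarrow> n - j \<le> \<kappa> \<omega>"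
    and "A \<in> sets (\<F> (gridpt T n (n - j)))"
  shows "(LINT \<omega>:A|P'. stopped n \<kappa> \<omega>) \<le> (LINT \<omega>:A|P'. snell n j \<omega>)"
  using assms(2-)
proof (induction j arbitrary: \<kappa> A)
  case 0
  have "A \<subseteq> space P" using sets.sets_into_space[OF 0(4)] by simp
  moreover have "\<kappa> \<omega> = n" if "\<omega> \<in> space P" for \<omega> using 0(2,3) that by (auto simp: grid_stopping_def intro: antisym)
  moreover have "gridpt T n n = T" using assms(1) by (simp add: gridpt_def)
  ultimately have "(LINT \<omega>:A|P'. stopped n \<kappa> \<omega>) = (LINT \<omega>:A|P'. snell n 0 \<omega>)"
    by (intro set_integral_cong_filtration) auto
  then show ?case by simp
next
  case (Suc j)
  define k where "k = n - Suc j"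
  have k: "k < n" "n - j = Suc k" using Suc.prems(1) by (auto simp: k_def)
  let ?t = "gridpt T n k"
  have t: "?t \<in> {0..T}" using k by (intro gridpt_le) simp
  have A: "A \<in> sets (\<F> ?t)" using Suc.prems(4) by (simp add: k_def)
  define B where "B = {\<omega> \<in> space P. \<kappa> \<omega> \<le> k}"
  have B: "B \<in> sets (\<F> ?t)" using Suc.prems(2) k by (auto simp: grid_stopping_def B_def)
  have Asub: "A \<subseteq> space P" using sets.sets_into_space[OF A] by simp
  have \<kappa>B: "\<kappa> \<omega> = k" if "\<omega> \<in> B" for \<omega> using Suc.prems(3)[of \<omega>] that by (auto simp: B_def k_def)
  define \<kappa>' where "\<kappa>' \<omega> = max (\<kappa> \<omega>) (Suc k)" for \<omega>
  have stop': "grid_stopping n \<kappa>'"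
    unfolding grid_stopping_def
  proof (intro conjI ballI allI impI)
    fix i assume i: "i \<le> n"
    show "{\<omega> \<in> space P. \<kappa>' \<omega> \<le> i} \<in> sets (\<F> (gridpt T n i))"
    proof (cases "Suc k \<le> i")
      case True
      then have "{\<omega> \<in> space P. \<kappa>' \<omega> \<le> i} = {\<omega> \<in> space P. \<kappa> \<omega> \<le> i}" by (auto simp: \<kappa>'_def)
      then show ?thesis using Suc.prems(2) i by (auto simp: grid_stopping_def)
    next
      case False
      then have "{\<omega> \<in> space P. \<kappa>' \<omega> \<le> i} = {}" by (auto simp: \<kappa>'_def)
      then show ?thesis by (metis sets.empty_sets)
    qed
  qed (use k Suc.prems(2) in \<open>auto simp: \<kappa>'_def grid_stopping_def\<close>)
  have AB: "A \<inter> B \<in> sets (\<F> ?t)" "A - B \<in> sets (\<F> ?t)" using A B by auto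
  have AB': "A - B \<in> sets (\<F> (gridpt T n (n - j)))"
    using AB(2) filtration_mono[OF gridpt_mono[of k "Suc k" n]] k by auto
  note int = integrable_stopped[OF Suc.prems(2)] integrable_stopped[OF stop'] integrable_snell
  have cm: "Lipschitz_path L (conditional_mean ?t (snell n j))"
    by (rule Lipschitz_conditional_mean[OF Lipschitz_snell t L_nonneg])
  have "(LINT \<omega>:A|P'. stopped n \<kappa> \<omega>) = (LINT \<omega>:A \<inter> B|P'. stopped n \<kappa> \<omega>) + (LINT \<omega>:A - B|P'. stopped n \<kappa> \<omega>)"
    by (rule set_integral_split[OF int(1) A B])
  also have "(LINT \<omega>:A - B|P'. stopped n \<kappa> \<omega>) = (LINT \<omega>:A - B|P'. stopped n \<kappa>' \<omega>)"
  proof (intro set_integral_cong_filtration)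
    fix \<omega> assume "\<omega> \<in> A - B"
    then have "k < \<kappa> \<omega>" using Asub by (auto simp: B_def)
    then have "\<kappa>' \<omega> = \<kappa> \<omega>" by (simp add: \<kappa>'_def)
    then show "stopped n \<kappa> \<omega> = stopped n \<kappa>' \<omega>" by simp
  qed
  also have "\<dots> \<le> (LINT \<omega>:A - B|P'. snell n j \<omega>)"
  proof (rule Suc.IH[OF _ stop' _ AB'])
    show "j \<le> n" using Suc.prems(1) by simp
    show "n - j \<le> \<kappa>' \<omega>" for \<omega> by (simp add: k(2) \<kappa>'_def)
  qed
  also have "(LINT \<omega>:A - B|P'. snell n j \<omega>) = (LINT \<omega>:A - B|P'. conditional_mean ?t (snell n j) \<omega>)"
    using k by (intro set_integral_conditional_mean[OF Lipschitz_snell L_nonneg _ _ AB(2)]) auto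
  also have "\<dots> \<le> (LINT \<omega>:A - B|P'. snell n (Suc j) \<omega>)"
    by (rule set_integral_mono_filtration[OF Lipschitz_path_integrable'[OF cm] int(3) AB(2)]) (simp add: k_def)
  also have "(LINT \<omega>:A \<inter> B|P'. stopped n \<kappa> \<omega>) \<le> (LINT \<omega>:A \<inter> B|P'. snell n (Suc j) \<omega>)"
    by (rule set_integral_mono_filtration[OF int(1,3) AB(1)]) (simp add: \<kappa>B k_def)
  also have "(LINT \<omega>:A \<inter> B|P'. snell n (Suc j) \<omega>) + (LINT \<omega>:A - B|P'. snell n (Suc j) \<omega>) = (LINT \<omega>:A|P'. snell n (Suc j) \<omega>)"
    by (rule set_integral_split[OF int(3) A B, symmetric])
  finally show ?case by simp
qed

text \<open>
  Stopping when the reward first reaches the continuation value attains the envelope.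
\<close>

lemma snell_attained:
  assumes "0 < n" "j \<le> n"
  shows "\<exists>\<kappa>. grid_stopping n \<kappa> \<and> (\<forall>\<omega>\<in>space P. n - j \<le> \<kappa> \<omega>) \<and>
    (\<forall>A\<in>sets (\<F> (gridpt T n (n - j))). (LINT \<omega>:A|P'. stopped n \<kappa> \<omega>) = (LINT \<omega>:A|P'. snell n j \<omega>))"
  using assms(2)
proof (induction j)
  case 0
  have "gridpt T n n = T" using assms(1) by (simp add: gridpt_def)
  moreover have "grid_stopping n (\<lambda>_. n)"
    unfolding grid_stopping_def
  proof (intro conjI ballI allI impI)
    fix k assume "k \<le> n"
    have "{\<omega> \<in> space P. n \<le> k} = {} \<or> {\<omega> \<in> space P. n \<le> k} = space (\<F> (gridpt T n k))" by auto
    then show "{\<omega> \<in> space P. n \<le> k} \<in> sets (\<F> (gridpt T n k))" by (metis sets.empty_sets sets.top)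
  qed simp
  ultimately show ?case by (intro exI[of _ "\<lambda>_. n"]) simp
next
  case (Suc j)
  define k where "k = n - Suc j"
  have k: "k < n" "n - j = Suc k" using Suc.prems(1) by (auto simp: k_def)
  let ?t = "gridpt T n k"
  have t: "?t \<in> {0..T}" using k by (intro gridpt_le) simp
  obtain \<kappa> where \<kappa>: "grid_stopping n \<kappa>" "\<And>\<omega>. \<omega> \<in> space P \<Longrightarrow> Suc k \<le> \<kappa> \<omega>"
    and eq: "\<And>A. A \<in> sets (\<F> (gridpt T n (Suc k))) \<Longrightarrow> (LINT \<omega>:A|P'. stopped n \<kappa> \<omega>) = (LINT \<omega>:A|P'. snell n j \<omega>)"
    using Suc k by auto
  have cm: "Lipschitz_path L (conditional_mean ?t (snell n j))"
    by (rule Lipschitz_conditional_mean[OF Lipschitz_snell t L_nonneg])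
  have [measurable]: "\<Gamma> ?t \<in> borel_measurable (\<F> ?t)" "conditional_mean ?t (snell n j) \<in> borel_measurable (\<F> ?t)"
    by (rule adapted[OF t], rule measurable_conditional_mean[OF Lipschitz_snell t L_nonneg])
  define B where "B = {\<omega> \<in> space P. conditional_mean ?t (snell n j) \<omega> \<le> \<Gamma> ?t \<omega>}"
  have "{\<omega> \<in> space (\<F> ?t). conditional_mean ?t (snell n j) \<omega> \<le> \<Gamma> ?t \<omega>} \<in> sets (\<F> ?t)" by measurable
  then have B: "B \<in> sets (\<F> ?t)" by (simp add: B_def)
  define \<kappa>' where "\<kappa>' \<omega> = (if \<omega> \<in> B then k else \<kappa> \<omega>)" for \<omega>
  have stop': "grid_stopping n \<kappa>'"
    unfolding grid_stopping_def
  proof (intro conjI ballI allI impI)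
    fix i assume i: "i \<le> n"
    show "{\<omega> \<in> space P. \<kappa>' \<omega> \<le> i} \<in> sets (\<F> (gridpt T n i))"
    proof (cases "k \<le> i")
      case True
      then have "{\<omega> \<in> space P. \<kappa>' \<omega> \<le> i} = B \<union> ({\<omega> \<in> space P. \<kappa> \<omega> \<le> i} - B)" by (auto simp: \<kappa>'_def B_def)
      moreover have "B \<in> sets (\<F> (gridpt T n i))" using B filtration_mono[OF gridpt_mono[OF True]] by blast
      ultimately show ?thesis using \<kappa>(1) i by (auto simp: grid_stopping_def)
    next
      case False
      have "\<not> \<kappa>' \<omega> \<le> i" if "\<omega> \<in> space P" for \<omega>
        using \<kappa>(2)[OF that] False by (auto simp: \<kappa>'_def)
      then have "{\<omega> \<in> space P. \<kappa>' \<omega> \<le> i} = {}" by blast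
      then show ?thesis by (metis sets.empty_sets)
    qed
  qed (use k \<kappa>(1) in \<open>auto simp: \<kappa>'_def grid_stopping_def\<close>)
  have "(LINT \<omega>:A|P'. stopped n \<kappa>' \<omega>) = (LINT \<omega>:A|P'. snell n (Suc j) \<omega>)" if A: "A \<in> sets (\<F> ?t)" for A
  proof -
    have AB: "A \<inter> B \<in> sets (\<F> ?t)" "A - B \<in> sets (\<F> ?t)" using A B by auto
    have AB': "A - B \<in> sets (\<F> (gridpt T n (Suc k)))"
      using AB(2) filtration_mono[OF gridpt_mono[of k "Suc k" n]] k by auto
    have Asub: "A \<subseteq> space P" using sets.sets_into_space[OF A] by simp
    have "(LINT \<omega>:A|P'. stopped n \<kappa>' \<omega>) = (LINT \<omega>:A \<inter> B|P'. stopped n \<kappa>' \<omega>) + (LINT \<omega>:A - B|P'. stopped n \<kappa>' \<omega>)"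
      by (rule set_integral_split[OF integrable_stopped[OF stop'] A B])
    also have "(LINT \<omega>:A \<inter> B|P'. stopped n \<kappa>' \<omega>) = (LINT \<omega>:A \<inter> B|P'. snell n (Suc j) \<omega>)"
      by (intro set_integral_cong_filtration) (simp add: \<kappa>'_def B_def k_def)
    also have "(LINT \<omega>:A - B|P'. stopped n \<kappa>' \<omega>) = (LINT \<omega>:A - B|P'. stopped n \<kappa> \<omega>)"
      by (intro set_integral_cong_filtration) (simp add: \<kappa>'_def)
    also have "\<dots> = (LINT \<omega>:A - B|P'. snell n j \<omega>)" by (rule eq[OF AB'])
    also have "\<dots> = (LINT \<omega>:A - B|P'. conditional_mean ?t (snell n j) \<omega>)"
      using k by (intro set_integral_conditional_mean[OF Lipschitz_snell L_nonneg _ _ AB(2)]) auto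
    also have "\<dots> = (LINT \<omega>:A - B|P'. snell n (Suc j) \<omega>)"
      using Asub by (intro set_integral_cong_filtration) (auto simp: B_def k_def max_def)
    also have "(LINT \<omega>:A \<inter> B|P'. snell n (Suc j) \<omega>) + (LINT \<omega>:A - B|P'. snell n (Suc j) \<omega>) = (LINT \<omega>:A|P'. snell n (Suc j) \<omega>)"
      by (rule set_integral_split[OF integrable_snell A B, symmetric])
    finally show ?thesis .
  qed
  moreover have "\<forall>\<omega>\<in>space P. n - Suc j \<le> \<kappa>' \<omega>" using \<kappa>(2)[THEN Suc_leD] by (simp add: \<kappa>'_def k_def[symmetric])
  ultimately show ?case using stop' by (intro exI[of _ \<kappa>']) (simp add: k_def)
qed

lemma stopping_time_of_grid:
  assumes "0 < n" and \<kappa>: "grid_stopping n \<kappa>"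
  shows "stopping_time \<F> (\<lambda>\<omega>. gridpt T n (\<kappa> \<omega>))"
  unfolding stopping_time_def
proof (rule allI)
  fix t
  show "Measurable.pred (\<F> t) (\<lambda>\<omega>. gridpt T n (\<kappa> \<omega>) \<le> t)"
  proof (cases "0 \<le> t")
    case True
    define k where "k = min n (nat \<lfloor>t * real n / T\<rfloor>)"
    have "real (nat \<lfloor>t * real n / T\<rfloor>) \<le> t * real n / T" using True T_pos by (simp add: of_nat_floor)
    then have k: "k \<le> n" "real k \<le> t * real n / T" by (auto simp: k_def min_def)
    have kt: "gridpt T n k \<le> t" using k(2) T_pos assms(1) by (simp add: gridpt_def field_simps)
    have iff: "gridpt T n i \<le> t \<longleftrightarrow> i \<le> k" if "i \<le> n" for i
    proof
      assume "gridpt T n i \<le> t"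
      then have "real i \<le> t * real n / T" using T_pos assms(1) by (simp add: gridpt_def field_simps)
      then have "i \<le> nat \<lfloor>t * real n / T\<rfloor>" by (simp add: le_nat_floor)
      then show "i \<le> k" using that by (simp add: k_def)
    next
      assume "i \<le> k"
      then show "gridpt T n i \<le> t" using gridpt_mono[of i k n] kt by linarith
    qed
    have "{\<omega> \<in> space (\<F> t). gridpt T n (\<kappa> \<omega>) \<le> t} = {\<omega> \<in> space P. \<kappa> \<omega> \<le> k}"
      using iff \<kappa> by (auto simp: grid_stopping_def)
    also have "\<dots> \<in> sets (\<F> t)"
      using \<kappa> k(1) filtration_mono[OF kt] by (auto simp: grid_stopping_def)
    finally show ?thesis by (simp add: pred_def)
  next
    case False
    have "0 \<le> gridpt T n (\<kappa> \<omega>)" for \<omega> using T_pos by (simp add: gridpt_def)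
    then have "{\<omega> \<in> space (\<F> t). gridpt T n (\<kappa> \<omega>) \<le> t} = {}" using False by (auto intro: order_trans)
    then show ?thesis unfolding pred_def by (simp only: sets.empty_sets)
  qed
qed

text \<open>
  Rounding up, instead of down, looks only into the past: the rounded time is at most the \<open>k\<close>-th grid point if and only if
  the original time is.
\<close>

definition round_up :: "nat \<Rightarrow> ((real \<Rightarrow> real ^ 'd) \<Rightarrow> real) \<Rightarrow> (real \<Rightarrow> real ^ 'd) \<Rightarrow> nat" where
  "round_up n \<tau> \<omega> = nat \<lceil>\<tau> \<omega> * real n / T\<rceil>"

lemma round_up_le_iff:
  assumes "0 < n" shows "round_up n \<tau> \<omega> \<le> k \<longleftrightarrow> \<tau> \<omega> \<le> gridpt T n k"
proof -
  have "round_up n \<tau> \<omega> \<le> k \<longleftrightarrow> \<tau> \<omega> * real n / T \<le> real k"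
    by (simp add: round_up_def nat_le_iff ceiling_le_iff)
  also have "\<dots> \<longleftrightarrow> \<tau> \<omega> \<le> gridpt T n k" using T_pos assms by (simp add: gridpt_def field_simps)
  finally show ?thesis .
qed

lemma round_up_approx:
  assumes "0 < n" "0 \<le> \<tau> \<omega>"
  shows "\<bar>gridpt T n (round_up n \<tau> \<omega>) - \<tau> \<omega>\<bar> \<le> T / real n"
proof -
  have "0 \<le> \<tau> \<omega> * real n / T" using assms T_pos by simp
  then have "\<tau> \<omega> * real n / T \<le> real (round_up n \<tau> \<omega>)" "real (round_up n \<tau> \<omega>) \<le> \<tau> \<omega> * real n / T + 1"
    unfolding round_up_def by linarith+
  then have "\<tau> \<omega> \<le> gridpt T n (round_up n \<tau> \<omega>)" "gridpt T n (round_up n \<tau> \<omega>) \<le> \<tau> \<omega> + T / real n"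
    using T_pos assms(1) by (auto simp: gridpt_def field_simps)
  then show ?thesis by simp
qed

lemma grid_stopping_round_up:
  assumes "0 < n" "stopping_time \<F> \<tau>" "\<And>\<omega>. \<omega> \<in> space P \<Longrightarrow> \<tau> \<omega> \<le> T"
  shows "grid_stopping n (round_up n \<tau>)"
proof -
  have "gridpt T n n = T" using assms(1) by (simp add: gridpt_def)
  moreover have "{\<omega> \<in> space P. \<tau> \<omega> \<le> t} \<in> sets (\<F> t)" for t
    using assms(2) by (auto simp: stopping_time_def pred_def)
  ultimately show ?thesis
    using assms(1,3) by (auto simp: grid_stopping_def round_up_le_iff)
qed

section \<open>Lipschitz continuity of the value process\<close>

lemma AE_le_of_set_integral_le:
  fixes f g :: "_ \<Rightarrow> real"
  assumes "f \<in> borel_measurable (\<F> t)" "g \<in> borel_measurable (\<F> t)" "integrable P' f" "integrable P' g"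
    and le: "\<And>A. A \<in> sets (\<F> t) \<Longrightarrow> (LINT \<omega>:A|P'. f \<omega>) \<le> (LINT \<omega>:A|P'. g \<omega>)"
  shows "AE \<omega> in P'. f \<omega> \<le> g \<omega>"
proof -
  let ?A = "{\<omega> \<in> space P. g \<omega> < f \<omega>}"
  have "{\<omega> \<in> space (\<F> t). g \<omega> < f \<omega>} \<in> sets (\<F> t)" using assms(1,2) by measurable
  then have A: "?A \<in> sets (\<F> t)" by simp
  have int: "integrable P' (\<lambda>\<omega>. indicator ?A \<omega> * (f \<omega> - g \<omega>))"
    using set_integrable[OF Bochner_Integration.integrable_diff[OF assms(3,4)] A] by (simp add: set_integrable_def)
  have "(LINT \<omega>|P'. indicator ?A \<omega> * (f \<omega> - g \<omega>)) = (LINT \<omega>:?A|P'. f \<omega>) - (LINT \<omega>:?A|P'. g \<omega>)"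
    using set_integral_diff(2)[OF set_integrable[OF assms(3) A] set_integrable[OF assms(4) A]]
    by (simp add: set_lebesgue_integral_def)
  also have "\<dots> \<le> 0" using le[OF A] by simp
  finally have "(LINT \<omega>|P'. indicator ?A \<omega> * (f \<omega> - g \<omega>)) \<le> 0" .
  moreover have nn: "0 \<le> indicator ?A \<omega> * (f \<omega> - g \<omega>)" for \<omega> by (simp add: indicator_def)
  ultimately have "(LINT \<omega>|P'. indicator ?A \<omega> * (f \<omega> - g \<omega>)) = 0"
    by (intro antisym Bochner_Integration.integral_nonneg)
  then have "AE \<omega> in P'. indicator ?A \<omega> * (f \<omega> - g \<omega>) = 0"
    using integral_nonneg_eq_0_iff_AE[OF int] nn by simp
  then show ?thesis
    using AE_space by eventually_elim (auto simp: indicator_def split: if_splits)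
qed

lemma sigma_finite_subalgebra_filtration: "sigma_finite_subalgebra P' (\<F> t)"
proof -
  interpret finite_measure_subalgebra P' "\<F> t"
    by standard (rule subalgebra_filtration)
  show ?thesis ..
qed

definition value_family :: "real \<Rightarrow> ((real \<Rightarrow> real ^ 'd) \<Rightarrow> real) set" where
  "value_family t = {real_cond_exp P' (\<F> t) (\<lambda>\<omega>. \<Gamma> (\<tau> \<omega>) \<omega>) | \<tau>.
     stopping_time \<F> \<tau> \<and> (\<forall>\<omega>\<in>space P. t \<le> \<tau> \<omega> \<and> \<tau> \<omega> \<le> T)}"

lemma set_integral_round_up_limit:
  assumes q: "0 < q" and \<tau>: "stopping_time \<F> \<tau>" "\<And>\<omega>. \<omega> \<in> space P \<Longrightarrow> 0 \<le> \<tau> \<omega> \<and> \<tau> \<omega> \<le> T"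
  shows "(\<lambda>\<omega>. \<Gamma> (\<tau> \<omega>) \<omega>) \<in> borel_measurable P'"
    and "A \<in> sets (\<F> t) \<Longrightarrow> (\<lambda>r. LINT \<omega>:A|P'. stopped (Suc r * q) (round_up (Suc r * q) \<tau>) \<omega>) \<longlonglongrightarrow> (LINT \<omega>:A|P'. \<Gamma> (\<tau> \<omega>) \<omega>)"
proof -
  let ?f = "\<lambda>r. stopped (Suc r * q) (round_up (Suc r * q) \<tau>)"
  have stop: "grid_stopping (Suc r * q) (round_up (Suc r * q) \<tau>)" for r
    using q \<tau> by (intro grid_stopping_round_up) auto
  have lim: "(\<lambda>r. ?f r \<omega>) \<longlonglongrightarrow> \<Gamma> (\<tau> \<omega>) \<omega>" if \<omega>: "\<omega> \<in> space P" for \<omega>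
  proof -
    have "(\<lambda>r. gridpt T (Suc r * q) (round_up (Suc r * q) \<tau> \<omega>)) \<longlonglongrightarrow> \<tau> \<omega>"
    proof (rule LIM_zero_cancel, rule Lim_null_comparison)
      show "\<forall>\<^sub>F r in sequentially. norm (gridpt T (Suc r * q) (round_up (Suc r * q) \<tau> \<omega>) - \<tau> \<omega>) \<le> T * inverse (real (Suc r))"
      proof (intro always_eventually allI)
        fix r
        have "\<bar>gridpt T (Suc r * q) (round_up (Suc r * q) \<tau> \<omega>) - \<tau> \<omega>\<bar> \<le> T / real (Suc r * q)"
          using q \<tau>(2)[OF \<omega>] by (intro round_up_approx) auto
        also have "\<dots> \<le> T / real (Suc r)"
        proof (rule divide_left_mono)
          have "Suc r * 1 \<le> Suc r * q" using q by (intro mult_le_mono) auto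
          then show "real (Suc r) \<le> real (Suc r * q)" by (simp only: of_nat_le_iff mult_1_right)
          show "0 < real (Suc r * q) * real (Suc r)"
            unfolding of_nat_mult[symmetric] of_nat_0_less_iff using q by simp
        qed (rule T_nonneg)
        finally show "norm (gridpt T (Suc r * q) (round_up (Suc r * q) \<tau> \<omega>) - \<tau> \<omega>) \<le> T * inverse (real (Suc r))"
          by (simp add: divide_inverse)
      qed
      show "(\<lambda>r. T * inverse (real (Suc r))) \<longlonglongrightarrow> 0"
        by (rule tendsto_mult_right_zero[OF LIMSEQ_inverse_real_of_nat])
    qed
    moreover have "gridpt T (Suc r * q) (round_up (Suc r * q) \<tau> \<omega>) \<in> {0..T}" for r
      using stop[of r] \<omega> unfolding grid_stopping_def by (intro gridpt_le) blast
    ultimately show ?thesis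
      using \<tau>(2)[OF \<omega>] by (intro continuous_on_tendsto_compose[OF continuous[OF \<omega>]]) (auto intro: always_eventually)
  qed
  show meas: "(\<lambda>\<omega>. \<Gamma> (\<tau> \<omega>) \<omega>) \<in> borel_measurable P'"
    by (rule borel_measurable_LIMSEQ_real[of _ ?f]) (use lim measurable_stopped[OF stop] in auto)
  obtain C where C: "0 \<le> C" "\<And>t \<omega>. t \<in> {0..T} \<Longrightarrow> \<omega> \<in> paths T \<Longrightarrow> \<bar>\<Gamma> t \<omega>\<bar> \<le> C + L * pdist T \<omega> zero_path"
    using reward_bound by blast
  show "(\<lambda>r. LINT \<omega>:A|P'. ?f r \<omega>) \<longlonglongrightarrow> (LINT \<omega>:A|P'. \<Gamma> (\<tau> \<omega>) \<omega>)" if A: "A \<in> sets (\<F> t)"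
    unfolding set_lebesgue_integral_def
  proof (rule integral_dominated_convergence[where w="\<lambda>\<omega>. C + L * pdist T \<omega> zero_path"])
    have [measurable]: "A \<in> sets P'" using A filtration_subset by blast
    show "(\<lambda>\<omega>. indicator A \<omega> *\<^sub>R \<Gamma> (\<tau> \<omega>) \<omega>) \<in> borel_measurable P'"
      using meas by measurable
    show "(\<lambda>\<omega>. indicator A \<omega> *\<^sub>R ?f r \<omega>) \<in> borel_measurable P'" for r
      using measurable_stopped[OF stop[of r]] by measurable
    show "AE \<omega> in P'. (\<lambda>r. indicator A \<omega> *\<^sub>R ?f r \<omega>) \<longlonglongrightarrow> indicator A \<omega> *\<^sub>R \<Gamma> (\<tau> \<omega>) \<omega>"
      using lim by (intro AE_I2 tendsto_scaleR tendsto_const) simp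
    show "AE \<omega> in P'. norm (indicator A \<omega> *\<^sub>R ?f r \<omega>) \<le> C + L * pdist T \<omega> zero_path" for r
    proof (rule AE_I2)
      fix \<omega> assume \<omega>: "\<omega> \<in> space P'"
      have "\<bar>?f r \<omega>\<bar> \<le> C + L * pdist T \<omega> zero_path"
      proof (rule C(2))
        show "gridpt T (Suc r * q) (round_up (Suc r * q) \<tau> \<omega>) \<in> {0..T}"
          using stop[of r] \<omega> unfolding grid_stopping_def space_completion by (intro gridpt_le) blast
        show "\<omega> \<in> paths T" using \<omega> by (simp add: space_P)
      qed
      moreover have "0 \<le> C + L * pdist T \<omega> zero_path" using C(1) L_nonneg by simp
      ultimately show "norm (indicator A \<omega> *\<^sub>R ?f r \<omega>) \<le> C + L * pdist T \<omega> zero_path"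
        by (simp add: indicator_def)
    qed
  qed (rule integrable_envelope)
qed

text \<open>
  At \<open>t\<close> the Snell envelopes on refining grids that contain \<open>t\<close> are \<open>L\<close>-Lipschitz functions. Each of them is the
  conditional reward of an admissible stopping time, hence almost surely below \<open>S\<close>. Their supremum \<open>W\<close>
  dominates the conditional reward of every grid stopping time, hence, after rounding up, of every stopping time, and
  so it is almost surely above \<open>S\<close> by the minimality of the essential supremum.
\<close>

theorem ess_sup_Lipschitz:
  assumes mq: "m \<le> q" "0 < q" and S: "is_ess_sup P' (value_family (gridpt T q m)) S"
  shows "\<exists>W. Lipschitz_path L W \<and> (AE \<omega> in P'. S \<omega> = W \<omega>)"
proof -
  let ?t = "gridpt T q m"
  have t: "?t \<in> {0..T}" by (rule gridpt_le[OF mq(1)])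
  interpret sigma_finite_subalgebra P' "\<F> ?t" by (rule sigma_finite_subalgebra_filtration)
  define n k V where "n r = Suc r * q" and "k r = Suc r * m" and "V r = snell (n r) (n r - k r)" for r
  have n: "0 < n r" "k r \<le> n r" "n r - (n r - k r) = k r" for r
  proof -
    show "0 < n r" using mq by (simp add: n_def)
    show "k r \<le> n r" using mult_le_mono[OF le_refl mq(1)] by (simp only: n_def k_def)
    then show "n r - (n r - k r) = k r" by simp
  qed
  have tr: "gridpt T (n r) (k r) = ?t" for r by (simp only: n_def k_def gridpt_refine)
  have V_meas: "V r \<in> borel_measurable (\<F> ?t)" for r
    using measurable_snell[OF n(1)[of r], of "n r - k r"] n[of r] tr[of r] by (simp add: V_def)
  have V_Lip: "Lipschitz_path L (V r)" for r unfolding V_def by (rule Lipschitz_snell)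
  have V_int: "integrable P' (V r)" for r unfolding V_def by (rule integrable_snell)
  have V_le_S: "AE \<omega> in P'. V r \<omega> \<le> S \<omega>" for r
  proof -
    obtain \<kappa> where \<kappa>: "grid_stopping (n r) \<kappa>" "\<And>\<omega>. \<omega> \<in> space P \<Longrightarrow> k r \<le> \<kappa> \<omega>"
      and eq: "\<And>A. A \<in> sets (\<F> ?t) \<Longrightarrow> (LINT \<omega>:A|P'. stopped (n r) \<kappa> \<omega>) = (LINT \<omega>:A|P'. V r \<omega>)"
      using snell_attained[OF n(1)[of r], of "n r - k r"] n[of r] tr[of r] by (auto simp: V_def)
    have "real_cond_exp P' (\<F> ?t) (stopped (n r) \<kappa>) \<in> value_family ?t"
      unfolding value_family_def
    proof (rule CollectI, intro exI[of _ "\<lambda>\<omega>. gridpt T (n r) (\<kappa> \<omega>)"] conjI ballI refl)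
      show "stopping_time \<F> (\<lambda>\<omega>. gridpt T (n r) (\<kappa> \<omega>))" by (rule stopping_time_of_grid[OF n(1) \<kappa>(1)])
      fix \<omega> assume \<omega>: "\<omega> \<in> space P"
      show "?t \<le> gridpt T (n r) (\<kappa> \<omega>)" using gridpt_mono[OF \<kappa>(2)[OF \<omega>], of "n r"] by (simp add: tr)
      show "gridpt T (n r) (\<kappa> \<omega>) \<le> T" using \<kappa>(1) \<omega> gridpt_le[of "\<kappa> \<omega>" "n r"] by (auto simp: grid_stopping_def)
    qed
    then have "AE \<omega> in P'. real_cond_exp P' (\<F> ?t) (stopped (n r) \<kappa>) \<omega> \<le> S \<omega>"
      using S by (auto simp: is_ess_sup_def)
    moreover have "AE \<omega> in P'. real_cond_exp P' (\<F> ?t) (stopped (n r) \<kappa>) \<omega> = V r \<omega>"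
      by (rule real_cond_exp_charact[OF eq integrable_stopped[OF \<kappa>(1)] V_int V_meas])
    ultimately show ?thesis by eventually_elim simp
  qed
  then have AE_V: "AE \<omega> in P'. \<forall>r. V r \<omega> \<le> S \<omega>" by (simp add: AE_all_countable)
  \<comment> \<open>one path at which the envelopes are bounded suffices, as they are equi-Lipschitz\<close>
  obtain \<omega>0 where \<omega>0: "\<omega>0 \<in> paths T" "\<And>r. V r \<omega>0 \<le> S \<omega>0"
  proof -
    have "\<exists>\<omega>\<in>space P'. \<forall>r. V r \<omega> \<le> S \<omega>"
    proof (rule ccontr)
      assume "\<not> (\<exists>\<omega>\<in>space P'. \<forall>r. V r \<omega> \<le> S \<omega>)"
      then have "AE \<omega> in P'. (\<forall>r. V r \<omega> \<le> S \<omega>) \<longrightarrow> False" by (intro AE_I2) blast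
      with AE_V have "AE \<omega> in P'. False" by (rule AE_mp)
      then show False by simp
    qed
    then show ?thesis using that by (auto simp: space_P)
  qed
  have bdd: "bdd_above (range (\<lambda>r. V r \<omega>))" if "\<omega> \<in> paths T" for \<omega>
  proof (rule bdd_aboveI2)
    fix r show "V r \<omega> \<le> S \<omega>0 + L * pdist T \<omega> \<omega>0"
      using Lipschitz_pathD[OF V_Lip that \<omega>0(1), of r] \<omega>0(2)[of r] by linarith
  qed
  define W where "W \<omega> = (SUP r. V r \<omega>)" for \<omega>
  have V_le_W: "V r \<omega> \<le> W \<omega>" if "\<omega> \<in> paths T" for r \<omega>
    unfolding W_def using bdd[OF that] by (rule cSUP_upper[OF UNIV_I])
  have W_Lip: "Lipschitz_path L W"
    unfolding Lipschitz_path_def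
  proof (intro ballI)
    fix x y :: "real \<Rightarrow> real ^ 'd" assume xy: "x \<in> paths T" "y \<in> paths T"
    have le: "W x \<le> W y + L * pdist T x y" if "x \<in> paths T" "y \<in> paths T" for x y
      unfolding W_def[of x]
    proof (rule cSUP_least)
      fix r show "V r x \<le> W y + L * pdist T x y"
        using Lipschitz_pathD[OF V_Lip that, of r] V_le_W[OF that(2), of r] by linarith
    qed simp
    show "\<bar>W x - W y\<bar> \<le> L * pdist T x y"
      using le[OF xy] le[OF xy(2,1)] by (simp add: mdist_commute abs_le_iff)
  qed
  have W_meas: "W \<in> borel_measurable (\<F> ?t)"
    unfolding W_def using V_meas bdd by (intro borel_measurable_cSUP) (auto simp: space_P)
  have W_int: "integrable P' W" by (rule Lipschitz_path_integrable'[OF W_Lip])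
  have "AE \<omega> in P'. X \<omega> \<le> W \<omega>" if X_in: "X \<in> value_family ?t" for X
  proof -
    obtain \<tau> where X: "X = real_cond_exp P' (\<F> ?t) (\<lambda>\<omega>. \<Gamma> (\<tau> \<omega>) \<omega>)"
      and \<tau>: "stopping_time \<F> \<tau>" "\<And>\<omega>. \<omega> \<in> space P \<Longrightarrow> ?t \<le> \<tau> \<omega> \<and> \<tau> \<omega> \<le> T"
      using X_in unfolding value_family_def by blast
    have \<tau>': "\<And>\<omega>. \<omega> \<in> space P \<Longrightarrow> 0 \<le> \<tau> \<omega> \<and> \<tau> \<omega> \<le> T" using \<tau>(2) t by fastforce
    have lim: "(\<lambda>r. LINT \<omega>:A|P'. stopped (Suc r * q) (round_up (Suc r * q) \<tau>) \<omega>) \<longlonglongrightarrow> (LINT \<omega>:A|P'. \<Gamma> (\<tau> \<omega>) \<omega>)"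
      if "A \<in> sets (\<F> ?t)" for A
      by (rule set_integral_round_up_limit(2)[OF mq(2) \<tau>(1) \<tau>' that])
    have \<tau>_meas: "(\<lambda>\<omega>. \<Gamma> (\<tau> \<omega>) \<omega>) \<in> borel_measurable P'"
      by (rule set_integral_round_up_limit(1)[OF mq(2) \<tau>(1) \<tau>'])
    have int: "integrable P' (\<lambda>\<omega>. \<Gamma> (\<tau> \<omega>) \<omega>)"
      using \<tau>' by (intro integrable_of_reward_bound \<tau>_meas) auto
    have stop: "grid_stopping (n r) (round_up (n r) \<tau>)" for r
      by (rule grid_stopping_round_up[OF n(1) \<tau>(1)]) (use \<tau>' in auto)
    have ge: "k r \<le> round_up (n r) \<tau> \<omega>" if \<omega>: "\<omega> \<in> space P" for r \<omega>
    proof (cases "k r")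
      case (Suc i)
      have "\<not> \<tau> \<omega> \<le> gridpt T (n r) i"
      proof -
        have "gridpt T (n r) i < gridpt T (n r) (k r)"
          using T_pos n(1)[of r] Suc by (simp add: gridpt_def divide_strict_right_mono)
        then show ?thesis using \<tau>(2)[OF \<omega>] by (simp add: tr)
      qed
      then show ?thesis using round_up_le_iff[OF n(1)[of r], of \<tau> \<omega> i] Suc by simp
    qed simp
    have le: "(LINT \<omega>:A|P'. \<Gamma> (\<tau> \<omega>) \<omega>) \<le> (LINT \<omega>:A|P'. W \<omega>)" if A: "A \<in> sets (\<F> ?t)" for A
    proof (rule LIMSEQ_le_const2[OF lim[OF A]], intro exI allI impI)
      fix r
      have "(LINT \<omega>:A|P'. stopped (n r) (round_up (n r) \<tau>) \<omega>) \<le> (LINT \<omega>:A|P'. V r \<omega>)"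
        unfolding V_def using A n(3)[of r] tr[of r]
        by (intro snell_upper n(1) stop) (use ge in simp_all)
      also have "\<dots> \<le> (LINT \<omega>:A|P'. W \<omega>)"
        using sets.sets_into_space[OF A] V_le_W by (intro set_integral_mono_filtration[OF V_int W_int A]) (auto simp: space_P)
      finally show "(LINT \<omega>:A|P'. stopped (Suc r * q) (round_up (Suc r * q) \<tau>) \<omega>) \<le> (LINT \<omega>:A|P'. W \<omega>)"
        by (simp only: n_def)
    qed
    show ?thesis
      unfolding X
    proof (rule AE_le_of_set_integral_le[OF _ W_meas _ W_int])
      show "integrable P' (real_cond_exp P' (\<F> ?t) (\<lambda>\<omega>. \<Gamma> (\<tau> \<omega>) \<omega>))" by (rule real_cond_exp_int(1)[OF int])
      fix A assume A: "A \<in> sets (\<F> ?t)"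
      show "(LINT \<omega>:A|P'. real_cond_exp P' (\<F> ?t) (\<lambda>\<omega>. \<Gamma> (\<tau> \<omega>) \<omega>) \<omega>) \<le> (LINT \<omega>:A|P'. W \<omega>)"
        using le[OF A] real_cond_exp_intA[OF int A] by simp
    qed simp
  qed
  moreover have "W \<in> borel_measurable P'" using W_int by auto
  ultimately have "AE \<omega> in P'. S \<omega> \<le> W \<omega>" using S by (auto simp: is_ess_sup_def)
  moreover have "AE \<omega> in P'. W \<omega> \<le> S \<omega>"
    using AE_V by eventually_elim (auto simp: W_def intro: cSUP_least)
  ultimately have "AE \<omega> in P'. S \<omega> = W \<omega>" by eventually_elim simp
  then show ?thesis using W_Lip by blast
qed

text \<open>
  Grid times form a countable dense set of times, so a single null set serves all of them, and the paths of
  \<open>S\<close> are continuous.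
\<close>

theorem value_process_Lipschitz:
  assumes S: "optimal_stopping_value T P \<Gamma> S"
  shows "\<exists>A\<in>sets P. (AE \<omega> in P. \<omega> \<in> A) \<and>
    (\<forall>\<omega>\<in>A. \<forall>\<eta>\<in>A. \<forall>t\<in>{0..T}. \<bar>S t \<omega> - S t \<eta>\<bar> \<le> L * pdist T \<omega> \<eta>)"
proof -
  have "\<exists>W. Lipschitz_path L W \<and> (AE \<omega> in P'. S (gridpt T q m) \<omega> = W \<omega>)" if "m \<le> q" "0 < q" for m q
    using S gridpt_le[OF that(1)] that unfolding optimal_stopping_value_def value_family_def[symmetric]
    by (intro ess_sup_Lipschitz) auto
  then have "\<exists>W. \<forall>m q. m \<le> q \<longrightarrow> 0 < q \<longrightarrow> Lipschitz_path L (W m q) \<and> (AE \<omega> in P'. S (gridpt T q m) \<omega> = W m q \<omega>)"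
    by metis
  then obtain W where W: "\<And>m q. m \<le> q \<Longrightarrow> 0 < q \<Longrightarrow> Lipschitz_path L (W m q)"
    "\<And>m q. m \<le> q \<Longrightarrow> 0 < q \<Longrightarrow> (AE \<omega> in P'. S (gridpt T q m) \<omega> = W m q \<omega>)" by auto
  have "AE \<omega> in P. m \<le> q \<longrightarrow> 0 < q \<longrightarrow> S (gridpt T q m) \<omega> = W m q \<omega>" for m q
    using W(2)[of m q] by (auto simp: AE_completion_iff)
  then have AE: "AE \<omega> in P. \<forall>m q. m \<le> q \<longrightarrow> 0 < q \<longrightarrow> S (gridpt T q m) \<omega> = W m q \<omega>"
    by (simp only: AE_all_countable) blast
  then obtain N where N: "{\<omega> \<in> space P. \<not> (\<forall>m q. m \<le> q \<longrightarrow> 0 < q \<longrightarrow> S (gridpt T q m) \<omega> = W m q \<omega>)} \<subseteq> N"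
    "emeasure P N = 0" "N \<in> sets P" by (rule AE_E)
  show ?thesis
  proof (intro bexI[of _ "space P - N"] conjI ballI)
    show "space P - N \<in> sets P" using N by auto
    have "N \<in> null_sets P" using N by auto
    then show "AE \<omega> in P. \<omega> \<in> space P - N" using AE_not_in AE_space by (smt (verit, best) DiffI eventually_elim2)
    fix \<omega> \<eta> t assume \<omega>: "\<omega> \<in> space P - N" and \<eta>: "\<eta> \<in> space P - N" and t: "t \<in> {0..T}"
    have eq: "S (gridpt T q m) x = W m q x" if "m \<le> q" "0 < q" "x \<in> space P - N" for m q x
      using that N(1) by blast
    have grid: "\<bar>S (gridpt T q m) \<omega> - S (gridpt T q m) \<eta>\<bar> \<le> L * pdist T \<omega> \<eta>" if "m \<le> q" "0 < q" for m q
      using eq[OF that \<omega>] eq[OF that \<eta>] Lipschitz_pathD[OF W(1)[OF that], of \<omega> \<eta>] \<omega> \<eta> by (simp add: space_P)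
    define \<kappa> where "\<kappa> r = round_up (Suc r) (\<lambda>_. t) \<omega>" for r
    have \<kappa>: "\<kappa> r \<le> Suc r" for r
      using round_up_le_iff[of "Suc r" "\<lambda>_. t" \<omega> "Suc r"] t by (simp add: \<kappa>_def gridpt_def)
    have lim: "(\<lambda>r. gridpt T (Suc r) (\<kappa> r)) \<longlonglongrightarrow> t"
    proof (rule LIM_zero_cancel, rule Lim_null_comparison)
      show "\<forall>\<^sub>F r in sequentially. norm (gridpt T (Suc r) (\<kappa> r) - t) \<le> T * inverse (real (Suc r))"
        using round_up_approx[of "Suc _" "\<lambda>_. t" \<omega>] t by (intro always_eventually allI) (simp add: \<kappa>_def divide_inverse)
      show "(\<lambda>r. T * inverse (real (Suc r))) \<longlonglongrightarrow> 0"
        by (rule tendsto_mult_right_zero[OF LIMSEQ_inverse_real_of_nat])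
    qed
    have "(\<lambda>r. S (gridpt T (Suc r) (\<kappa> r)) x) \<longlonglongrightarrow> S t x" if "x \<in> space P" for x
    proof -
      have "continuous_on {0..T} (\<lambda>t. S t x)" using S that by (auto simp: optimal_stopping_value_def)
      then show ?thesis
        using t gridpt_le[OF \<kappa>] by (intro continuous_on_tendsto_compose[OF _ lim]) (auto intro: always_eventually)
    qed
    then have "(\<lambda>r. \<bar>S (gridpt T (Suc r) (\<kappa> r)) \<omega> - S (gridpt T (Suc r) (\<kappa> r)) \<eta>\<bar>) \<longlonglongrightarrow> \<bar>S t \<omega> - S t \<eta>\<bar>"
      using \<omega> \<eta> by (intro tendsto_intros) auto
    then show "\<bar>S t \<omega> - S t \<eta>\<bar> \<le> L * pdist T \<omega> \<eta>"
      by (rule LIMSEQ_le_const2) (use grid \<kappa> in auto)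
  qed
qed

end

section \<open>The Wasserstein distance to an empirical measure\<close>

text \<open>
  The sample indices run over \<open>{1..N}\<close>, which should not be rewritten to \<open>{Suc 0..N}\<close>.
\<close>

declare One_nat_def [simp del]

definition transport_cost :: "'a metric \<Rightarrow> ('a \<times> 'a) measure \<Rightarrow> ennreal" where
  "transport_cost m \<pi> = (\<integral>\<^sup>+ (x, y). ennreal ((mdist m x y)\<^sup>2) \<partial>\<pi>)"

lemma wasserstein2_eq: "wasserstein2 m \<mu> \<nu> = sqrt (enn2real (INF \<pi>\<in>couplings \<mu> \<nu>. transport_cost m \<pi>))"
  by (simp add: wasserstein2_def transport_cost_def)

lemma singleton_metric_borel: "x \<in> mspace m \<Longrightarrow> {x} \<in> sets (metric_borel m)"
proof -
  assume x: "x \<in> mspace m"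
  have "openin (mtopology_of m) (mspace m - {x})"
    unfolding openin_mtopology_of_iff
  proof (intro conjI ballI)
    fix y assume y: "y \<in> mspace m - {x}"
    then have "0 < mdist m y x" using x by (metis DiffE insertI1 mdist_nonneg mdist_zero order_less_le)
    then show "\<exists>r>0. \<forall>z\<in>mspace m. mdist m y z < r \<longrightarrow> z \<in> mspace m - {x}" by (intro exI[of _ "mdist m y x"]) auto
  qed auto
  then have "mspace m - {x} \<in> sets (metric_borel m)" by (auto simp: sets_metric_borel)
  then have "space (metric_borel m) - (mspace m - {x}) \<in> sets (metric_borel m)" by (rule sets.compl_sets)
  then show ?thesis using x by (simp add: double_diff)
qed

lemma sets_empirical_measure [simp, measurable_cong]: "sets (empirical_measure M N x) = sets M"
  by (simp add: empirical_measure_def sets.sigma_sets_eq sets.space_closed)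

lemma space_empirical_measure [simp]: "space (empirical_measure M N x) = space M"
  by (rule sets_eq_imp_space_eq) simp

lemma emeasure_empirical_measure_indicator:
  assumes "A \<in> sets M" "\<And>n. n \<in> {1..N} \<Longrightarrow> x n \<in> space M"
  shows "emeasure (empirical_measure M N x) A = ennreal (1 / real N) * (\<Sum>n = 1..N. indicator A (x n))"
  using assms by (simp add: emeasure_empirical_measure)

text \<open>
  A coupling of \<open>\<mu>\<close> with the empirical measure of the points \<open>x\<close>, and new positions \<open>y\<close> of these points. The measurability
  of the metric is an assumption because it can fail on nonseparable spaces.
\<close>

locale finite_coupling =
  fixes m :: "'a metric" and \<mu> :: "'a measure" and N :: nat and x y :: "nat \<Rightarrow> 'a" and \<pi> :: "('a \<times> 'a) measure"
  assumes mdist_measurable: "(\<lambda>p. mdist m (fst p) (snd p)) \<in> borel_measurable (metric_borel m \<Otimes>\<^sub>M metric_borel m)"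
    and sets_\<mu>: "sets \<mu> = sets (metric_borel m)" and prob_\<mu>: "prob_space \<mu>"
    and N_pos: "0 < N"
    and x: "\<And>n. n \<in> {1..N} \<Longrightarrow> x n \<in> mspace m" and y: "\<And>n. n \<in> {1..N} \<Longrightarrow> y n \<in> mspace m"
    and \<pi>: "\<pi> \<in> couplings \<mu> (empirical_measure (metric_borel m) N x)"
begin

abbreviation "E \<equiv> metric_borel m"

lemma sets_\<pi> [measurable_cong]: "sets \<pi> = sets (E \<Otimes>\<^sub>M E)"
proof -
  have "sets \<pi> = sets (\<mu> \<Otimes>\<^sub>M empirical_measure E N x)" using \<pi> by (simp add: couplings_def)
  also have "\<dots> = sets (E \<Otimes>\<^sub>M E)" by (intro sets_pair_measure_cong) (simp_all add: sets_\<mu>)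
  finally show ?thesis .
qed

lemma space_\<pi>: "space \<pi> = mspace m \<times> mspace m"
  using sets_eq_imp_space_eq[OF sets_\<pi>] by (simp add: space_pair_measure)

lemma measurable_fst_\<pi>: "fst \<in> measurable \<pi> E" and measurable_snd_\<pi>: "snd \<in> measurable \<pi> E"
  using measurable_cong_sets[OF sets_\<pi> refl] by auto

lemma marginal_fst: "A \<in> sets E \<Longrightarrow> emeasure \<pi> (fst -` A \<inter> space \<pi>) = emeasure \<mu> A"
proof -
  assume A: "A \<in> sets E"
  have "fst \<in> measurable \<pi> \<mu>" using measurable_fst_\<pi> measurable_cong_sets[OF refl sets_\<mu>] by blast
  then have "emeasure (distr \<pi> \<mu> fst) A = emeasure \<pi> (fst -` A \<inter> space \<pi>)"
    using A sets_\<mu> by (intro emeasure_distr) auto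
  then show ?thesis using \<pi> by (simp add: couplings_def)
qed

lemma marginal_snd: "A \<in> sets E \<Longrightarrow> emeasure \<pi> (snd -` A \<inter> space \<pi>) = ennreal (1 / real N) * (\<Sum>n = 1..N. indicator A (x n))"
proof -
  assume A: "A \<in> sets E"
  have "snd \<in> measurable \<pi> (empirical_measure E N x)" using measurable_snd_\<pi> measurable_cong_sets[OF refl sets_empirical_measure] by blast
  then have "emeasure (distr \<pi> (empirical_measure E N x) snd) A = emeasure \<pi> (snd -` A \<inter> space \<pi>)"
    using A by (intro emeasure_distr) auto
  moreover have "distr \<pi> (empirical_measure E N x) snd = empirical_measure E N x" using \<pi> by (simp add: couplings_def)
  ultimately have "emeasure \<pi> (snd -` A \<inter> space \<pi>) = emeasure (empirical_measure E N x) A" by metis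
  also have "\<dots> = ennreal (1 / real N) * (\<Sum>n = 1..N. indicator A (x n))"
    by (rule emeasure_empirical_measure_indicator[OF A]) (use x in simp)
  finally show ?thesis .
qed

lemma prob_\<pi>: "prob_space \<pi>"
proof (rule prob_spaceI)
  interpret prob_space \<mu> by (rule prob_\<mu>)
  have "fst -` space E \<inter> space \<pi> = space \<pi>" by (auto simp: space_\<pi>)
  then show "emeasure \<pi> (space \<pi>) = 1"
    using marginal_fst[OF sets.top] emeasure_space_1 sets_eq_imp_space_eq[OF sets_\<mu>] by metis
qed

definition mult :: "'a \<Rightarrow> nat" where
  "mult w = card {j \<in> {1..N}. x j = w}"

text \<open>
  If several sample points coincide, the mass over their common position is shared equally between them. So
  \<open>weight i\<close> is the density of the part of a coupling that belongs to the \<open>i\<close>-th point.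
\<close>

definition weight :: "nat \<Rightarrow> 'a \<Rightarrow> ennreal" where
  "weight i w = ennreal (1 / real (mult (x i))) * indicator {x i} w"

lemma mult_pos: "i \<in> {1..N} \<Longrightarrow> 0 < mult (x i)"
  by (auto simp: mult_def card_gt_0_iff)

lemma measurable_weight [measurable]: "i \<in> {1..N} \<Longrightarrow> weight i \<in> borel_measurable E"
  unfolding weight_def using singleton_metric_borel[OF x] by (intro borel_measurable_times_ennreal borel_measurable_indicator) auto

lemma sum_weight:
  assumes "w \<in> x ` {1..N}" shows "(\<Sum>i = 1..N. weight i w) = 1"
proof -
  have "(\<Sum>i = 1..N. weight i w) = (\<Sum>i \<in> {1..N}. if x i = w then ennreal (1 / real (mult w)) else 0)"
    by (intro sum.cong refl) (auto simp: weight_def indicator_def)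
  also have "\<dots> = (\<Sum>i \<in> {j \<in> {1..N}. x j = w}. ennreal (1 / real (mult w)))"
    by (simp add: sum.inter_filter[symmetric])
  also have "\<dots> = ennreal (real (mult w) * (1 / real (mult w)))"
    by (subst ennreal_mult) (simp_all add: mult_def ennreal_of_nat_eq_real_of_nat)
  also have "real (mult w) * (1 / real (mult w)) = 1" using mult_pos assms by auto
  also have "ennreal 1 = 1" by simp
  finally show ?thesis .
qed

lemma sum_weight_le: "(\<Sum>i = 1..N. weight i w) \<le> 1"
proof (cases "w \<in> x ` {1..N}")
  case False
  then have "(\<Sum>i = 1..N. weight i w) = 0" by (intro sum.neutral) (auto simp: weight_def indicator_def)
  then show ?thesis by simp
qed (simp add: sum_weight)

lemma AE_support: "AE p in \<pi>. snd p \<in> x ` {1..N}"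
proof -
  have "x ` {1..N} = (\<Union>i\<in>{1..N}. {x i})" by auto
  also have "\<dots> \<in> sets E" using singleton_metric_borel[OF x] by (intro sets.finite_UN) auto
  finally have S: "x ` {1..N} \<in> sets E" .
  then have "space E - x ` {1..N} \<in> sets E" by (rule sets.compl_sets)
  then have "emeasure \<pi> (snd -` (space E - x ` {1..N}) \<inter> space \<pi>) = 0"
    by (subst marginal_snd) (auto intro!: sum.neutral)
  moreover have "snd -` (space E - x ` {1..N}) \<inter> space \<pi> \<in> sets \<pi>"
    using \<open>space E - x ` {1..N} \<in> sets E\<close> by (rule measurable_sets[OF measurable_snd_\<pi>])
  moreover have "{p \<in> space \<pi>. snd p \<notin> x ` {1..N}} \<subseteq> snd -` (space E - x ` {1..N}) \<inter> space \<pi>"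
    by (auto simp: space_\<pi>)
  ultimately show ?thesis by (intro AE_I[of _ _ "snd -` (space E - x ` {1..N}) \<inter> space \<pi>"]) auto
qed

lemma nn_integral_weight:
  assumes i: "i \<in> {1..N}"
  shows "(\<integral>\<^sup>+ p. weight i (snd p) \<partial>\<pi>) = ennreal (1 / real N)"
proof -
  have s: "{x i} \<in> sets E" by (rule singleton_metric_borel[OF x[OF i]])
  then have [measurable]: "snd -` {x i} \<inter> space \<pi> \<in> sets \<pi>" by (rule measurable_sets[OF measurable_snd_\<pi>])
  have "(\<integral>\<^sup>+ p. weight i (snd p) \<partial>\<pi>) = (\<integral>\<^sup>+ p. ennreal (1 / real (mult (x i))) * indicator (snd -` {x i} \<inter> space \<pi>) p \<partial>\<pi>)"
    by (intro nn_integral_cong) (auto simp: weight_def indicator_def)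
  also have "\<dots> = ennreal (1 / real (mult (x i))) * (ennreal (1 / real N) * (\<Sum>n = 1..N. indicator {x i} (x n)))"
    using marginal_snd[OF s] by (simp add: nn_integral_cmult)
  also have "(\<Sum>n = 1..N. indicator {x i} (x n)) = ennreal (real (mult (x i)))"
  proof -
    have "(\<Sum>n = 1..N. indicator {x i} (x n)) = (\<Sum>n\<in>{1..N}. if x n = x i then 1 else (0::ennreal))"
      by (intro sum.cong) (auto simp: indicator_def)
    also have "\<dots> = (\<Sum>n\<in>{j\<in>{1..N}. x j = x i}. 1)" by (simp add: sum.inter_filter[symmetric])
    finally show ?thesis by (simp add: mult_def ennreal_of_nat_eq_real_of_nat)
  qed
  also have "ennreal (1 / real (mult (x i))) * (ennreal (1 / real N) * ennreal (real (mult (x i)))) = ennreal (1 / real (mult (x i)) * (1 / real N * real (mult (x i))))"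
    by (subst ennreal_mult[of "1 / real (mult (x i))"], simp, simp, subst ennreal_mult) simp_all
  also have "1 / real (mult (x i)) * (1 / real N * real (mult (x i))) = 1 / real N"
    using mult_pos[OF i] by simp
  finally show ?thesis .
qed

text \<open>
  The part of the coupling that belongs to the \<open>i\<close>-th point is transported to \<open>y i\<close> instead of \<open>x i\<close>.
\<close>

definition moved :: "('a \<times> 'a) measure" where
  "moved = distr (density (count_space {1..N} \<Otimes>\<^sub>M \<pi>) (\<lambda>(i, p). weight i (snd p))) (E \<Otimes>\<^sub>M E) (\<lambda>(i, p). (fst p, y i))"

lemma nn_integral_moved:
  assumes f: "f \<in> borel_measurable (E \<Otimes>\<^sub>M E)"
  shows "(\<integral>\<^sup>+ q. f q \<partial>moved) = (\<Sum>i = 1..N. \<integral>\<^sup>+ p. weight i (snd p) * f (fst p, y i) \<partial>\<pi>)"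
proof -
  interpret \<pi>: prob_space \<pi> by (rule prob_\<pi>)
  have w: "(\<lambda>(i, p). weight i (snd p)) \<in> borel_measurable (count_space {1..N} \<Otimes>\<^sub>M \<pi>)"
    by (rule measurable_pair_measure_countable1) (auto intro: measurable_compose[OF measurable_snd_\<pi> measurable_weight])
  have g0: "(\<lambda>p. (fst p, y i)) \<in> measurable \<pi> (E \<Otimes>\<^sub>M E)" if "i \<in> {1..N}" for i
    using measurable_fst_\<pi> y[OF that] by (intro measurable_Pair measurable_const) auto
  have g: "(\<lambda>(i, p). (fst p, y i)) \<in> measurable (count_space {1..N} \<Otimes>\<^sub>M \<pi>) (E \<Otimes>\<^sub>M E)"
    by (rule measurable_pair_measure_countable1) (auto intro: g0)
  have fg: "(\<lambda>ip. f (fst (snd ip), y (fst ip))) \<in> borel_measurable (count_space {1..N} \<Otimes>\<^sub>M \<pi>)"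
    using measurable_compose[OF g f] by (simp add: case_prod_beta')
  have "(\<integral>\<^sup>+ q. f q \<partial>moved) = (\<integral>\<^sup>+ ip. (case ip of (i, p) \<Rightarrow> weight i (snd p)) * f (case ip of (i, p) \<Rightarrow> (fst p, y i)) \<partial>(count_space {1..N} \<Otimes>\<^sub>M \<pi>))"
    unfolding moved_def using g f w fg
    by (subst nn_integral_distr) (auto simp: nn_integral_density case_prod_beta')
  also have "\<dots> = (\<integral>\<^sup>+ i. \<integral>\<^sup>+ p. weight i (snd p) * f (fst p, y i) \<partial>\<pi> \<partial>count_space {1..N})"
    using borel_measurable_times_ennreal[OF w fg] by (subst \<pi>.nn_integral_fst[symmetric]) (auto simp: case_prod_beta')
  also have "\<dots> = (\<Sum>i = 1..N. \<integral>\<^sup>+ p. weight i (snd p) * f (fst p, y i) \<partial>\<pi>)"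
    by (simp add: nn_integral_count_space_finite)
  finally show ?thesis .
qed

lemma emeasure_moved:
  assumes "A \<in> sets (E \<Otimes>\<^sub>M E)"
  shows "emeasure moved A = (\<Sum>i = 1..N. \<integral>\<^sup>+ p. weight i (snd p) * indicator A (fst p, y i) \<partial>\<pi>)"
proof -
  have "emeasure moved A = (\<integral>\<^sup>+ q. indicator A q \<partial>moved)" using assms by (simp add: moved_def)
  then show ?thesis using assms by (simp add: nn_integral_moved)
qed

lemma moved_coupling: "moved \<in> couplings \<mu> (empirical_measure E N y)"
  unfolding couplings_def
proof (intro CollectI conjI)
  have s: "sets moved = sets (E \<Otimes>\<^sub>M E)" by (simp add: moved_def)
  have "sets (\<mu> \<Otimes>\<^sub>M empirical_measure E N y) = sets (E \<Otimes>\<^sub>M E)"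
    by (intro sets_pair_measure_cong) (simp_all add: sets_\<mu>)
  then show "sets moved = sets (\<mu> \<Otimes>\<^sub>M empirical_measure E N y)" using s by simp
  have sp: "space moved = mspace m \<times> mspace m" using sets_eq_imp_space_eq[OF s] by (simp add: space_pair_measure)
  have fm: "fst \<in> measurable moved E" and sm: "snd \<in> measurable moved E" using measurable_cong_sets[OF s refl] by auto
  show "distr moved \<mu> fst = \<mu>"
  proof (rule measure_eqI)
    fix A assume "A \<in> sets (distr moved \<mu> fst)"
    then have A: "A \<in> sets E" by (simp add: sets_\<mu>)
    have "emeasure (distr moved \<mu> fst) A = emeasure moved (fst -` A \<inter> space moved)"
      using fm A measurable_cong_sets[OF refl sets_\<mu>] by (intro emeasure_distr) (auto simp: sets_\<mu>)
    also have "fst -` A \<inter> space moved = A \<times> mspace m" using sets.sets_into_space[OF A] by (auto simp: sp)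
    also have "emeasure moved (A \<times> mspace m) = (\<Sum>i = 1..N. \<integral>\<^sup>+ p. weight i (snd p) * indicator (A \<times> mspace m) (fst p, y i) \<partial>\<pi>)"
      using A sets.top[of E] by (intro emeasure_moved pair_measureI) auto
    also have "\<dots> = (\<Sum>i = 1..N. \<integral>\<^sup>+ p. weight i (snd p) * indicator A (fst p) \<partial>\<pi>)"
      using y by (intro sum.cong nn_integral_cong refl) (auto simp: indicator_def)
    also have "\<dots> = (\<integral>\<^sup>+ p. (\<Sum>i = 1..N. weight i (snd p) * indicator A (fst p)) \<partial>\<pi>)"
      using A measurable_compose[OF measurable_snd_\<pi> measurable_weight] measurable_compose[OF measurable_fst_\<pi>, of "indicator A"]
      by (intro nn_integral_sum[symmetric] borel_measurable_times_ennreal) auto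
    also have "\<dots> = (\<integral>\<^sup>+ p. indicator (fst -` A \<inter> space \<pi>) p \<partial>\<pi>)"
    proof (rule nn_integral_cong_AE)
      show "AE p in \<pi>. (\<Sum>i = 1..N. weight i (snd p) * indicator A (fst p)) = indicator (fst -` A \<inter> space \<pi>) p"
        using AE_support AE_space
      proof eventually_elim
        fix p assume "snd p \<in> x ` {1..N}" "p \<in> space \<pi>"
        then show "(\<Sum>i = 1..N. weight i (snd p) * indicator A (fst p)) = indicator (fst -` A \<inter> space \<pi>) p"
          using sum_weight by (simp add: sum_distrib_right[symmetric] indicator_def)
      qed
    qed
    also have "\<dots> = emeasure \<mu> A"
      using marginal_fst[OF A] measurable_sets[OF measurable_fst_\<pi> A] by simp
    finally show "emeasure (distr moved \<mu> fst) A = emeasure \<mu> A" .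
  qed simp
  show "distr moved (empirical_measure E N y) snd = empirical_measure E N y"
  proof (rule measure_eqI)
    fix A assume "A \<in> sets (distr moved (empirical_measure E N y) snd)"
    then have A: "A \<in> sets E" by simp
    have "snd \<in> measurable moved (empirical_measure E N y)"
      using sm measurable_cong_sets[OF refl sets_empirical_measure] by blast
    then have "emeasure (distr moved (empirical_measure E N y) snd) A = emeasure moved (snd -` A \<inter> space moved)"
      using A by (intro emeasure_distr) auto
    also have "snd -` A \<inter> space moved = mspace m \<times> A" using sets.sets_into_space[OF A] by (auto simp: sp)
    also have "emeasure moved (mspace m \<times> A) = (\<Sum>i = 1..N. \<integral>\<^sup>+ p. weight i (snd p) * indicator (mspace m \<times> A) (fst p, y i) \<partial>\<pi>)"
      using A sets.top[of E] by (intro emeasure_moved pair_measureI) auto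
    also have "\<dots> = (\<Sum>i = 1..N. ennreal (1 / real N) * indicator A (y i))"
    proof (rule sum.cong[OF refl])
      fix i assume i: "i \<in> {1..N}"
      have "(\<integral>\<^sup>+ p. weight i (snd p) * indicator (mspace m \<times> A) (fst p, y i) \<partial>\<pi>) = (\<integral>\<^sup>+ p. weight i (snd p) * indicator A (y i) \<partial>\<pi>)"
        by (intro nn_integral_cong) (auto simp: indicator_def space_\<pi>)
      also have "\<dots> = (\<integral>\<^sup>+ p. weight i (snd p) \<partial>\<pi>) * indicator A (y i)"
        using measurable_compose[OF measurable_snd_\<pi> measurable_weight[OF i]] by (intro nn_integral_multc) auto
      finally show "(\<integral>\<^sup>+ p. weight i (snd p) * indicator (mspace m \<times> A) (fst p, y i) \<partial>\<pi>) = ennreal (1 / real N) * indicator A (y i)"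
        by (simp add: nn_integral_weight[OF i])
    qed
    also have "\<dots> = ennreal (1 / real N) * (\<Sum>i = 1..N. indicator A (y i))" by (simp only: sum_distrib_left)
    also have "\<dots> = emeasure (empirical_measure E N y) A"
      by (rule emeasure_empirical_measure_indicator[OF A, symmetric]) (use y in simp)
    finally show "emeasure (distr moved (empirical_measure E N y) snd) A = emeasure (empirical_measure E N y) A" .
  qed simp
qed

text \<open>
  The elementary bound \<open>(a + b)\<^sup>2 \<le> (1 + e) * a\<^sup>2 + (1 + 1 / e) * b\<^sup>2\<close> replaces Minkowski's inequality; optimizing over
  \<open>e\<close> afterwards recovers the triangle inequality for the square roots.
\<close>

lemma transport_cost_moved_le:
  assumes e: "0 < e"
  shows "transport_cost m moved \<le> ennreal (1 + e) * transport_cost m \<pi>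
     + ennreal ((1 + 1 / e) * ((\<Sum>i = 1..N. (mdist m (x i) (y i))\<^sup>2) / real N))"
proof -
  let ?d = "\<lambda>z w. ennreal ((mdist m z w)\<^sup>2)"
  have dm: "(\<lambda>q. ?d (fst q) (snd q)) \<in> borel_measurable (E \<Otimes>\<^sub>M E)" using mdist_measurable by measurable
  then have dm': "(\<lambda>p. ?d (fst p) (snd p)) \<in> borel_measurable \<pi>" using measurable_cong_sets[OF sets_\<pi> refl] by blast
  have wm: "(\<lambda>p. weight i (snd p)) \<in> borel_measurable \<pi>" if "i \<in> {1..N}" for i
    by (rule measurable_compose[OF measurable_snd_\<pi> measurable_weight[OF that]])
  have "transport_cost m moved = (\<Sum>i = 1..N. \<integral>\<^sup>+ p. weight i (snd p) * ?d (fst p) (y i) \<partial>\<pi>)"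
    using nn_integral_moved[OF dm] by (simp add: transport_cost_def case_prod_beta')
  also have "\<dots> \<le> (\<Sum>i = 1..N. \<integral>\<^sup>+ p. ennreal (1 + e) * (weight i (snd p) * ?d (fst p) (snd p)) + ennreal ((1 + 1 / e) * (mdist m (x i) (y i))\<^sup>2) * weight i (snd p) \<partial>\<pi>)"
  proof (intro sum_mono nn_integral_mono)
    fix i p assume i: "i \<in> {1..N}" and p: "p \<in> space \<pi>"
    show "weight i (snd p) * ?d (fst p) (y i) \<le> ennreal (1 + e) * (weight i (snd p) * ?d (fst p) (snd p)) + ennreal ((1 + 1 / e) * (mdist m (x i) (y i))\<^sup>2) * weight i (snd p)"
    proof (cases "snd p = x i")
      case True
      let ?a = "mdist m (fst p) (snd p)" and ?b = "mdist m (x i) (y i)"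
      have "mdist m (fst p) (y i) \<le> ?a + ?b"
        using True mdist_triangle[of "fst p" m "x i" "y i"] p x[OF i] y[OF i] by (auto simp: space_\<pi>)
      then have "(mdist m (fst p) (y i))\<^sup>2 \<le> (?a + ?b)\<^sup>2" by (intro power_mono) auto
      also have "\<dots> \<le> (1 + e) * ?a\<^sup>2 + (1 + 1 / e) * ?b\<^sup>2"
      proof -
        have "0 \<le> (e * ?a - ?b)\<^sup>2 / e" using e by simp
        also have "\<dots> = e * ?a\<^sup>2 - 2 * ?a * ?b + (1 / e) * ?b\<^sup>2"
          using e by (simp add: field_simps power2_eq_square)
        finally show ?thesis by (simp add: power2_sum algebra_simps)
      qed
      finally have "?d (fst p) (y i) \<le> ennreal ((1 + e) * ?a\<^sup>2 + (1 + 1 / e) * ?b\<^sup>2)" by (rule ennreal_leI)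
      also have "\<dots> = ennreal (1 + e) * ?d (fst p) (snd p) + ennreal ((1 + 1 / e) * ?b\<^sup>2)"
        using e by (simp add: ennreal_mult ennreal_plus)
      finally have "weight i (snd p) * ?d (fst p) (y i) \<le> weight i (snd p) * (ennreal (1 + e) * ?d (fst p) (snd p) + ennreal ((1 + 1 / e) * ?b\<^sup>2))"
        by (rule mult_left_mono) simp
      then show ?thesis by (simp only: distrib_left mult_ac)
    next
      case False
      then have "weight i (snd p) = 0" by (simp add: weight_def)
      then show ?thesis by simp
    qed
  qed
  also have "\<dots> = (\<Sum>i = 1..N. ennreal (1 + e) * (\<integral>\<^sup>+ p. weight i (snd p) * ?d (fst p) (snd p) \<partial>\<pi>) + ennreal ((1 + 1 / e) * (mdist m (x i) (y i))\<^sup>2) * ennreal (1 / real N))"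
    using wm dm' nn_integral_weight by (intro sum.cong refl) (simp add: nn_integral_add nn_integral_cmult)
  also have "\<dots> = ennreal (1 + e) * (\<integral>\<^sup>+ p. (\<Sum>i = 1..N. weight i (snd p) * ?d (fst p) (snd p)) \<partial>\<pi>)
     + (\<Sum>i = 1..N. ennreal ((1 + 1 / e) * (mdist m (x i) (y i))\<^sup>2) * ennreal (1 / real N))"
    using wm dm' by (subst nn_integral_sum) (auto simp: sum.distrib sum_distrib_left)
  also have "(\<integral>\<^sup>+ p. (\<Sum>i = 1..N. weight i (snd p) * ?d (fst p) (snd p)) \<partial>\<pi>) \<le> (\<integral>\<^sup>+ p. ?d (fst p) (snd p) \<partial>\<pi>)"
  proof (rule nn_integral_mono)
    fix p
    have "(\<Sum>i = 1..N. weight i (snd p) * ?d (fst p) (snd p)) = (\<Sum>i = 1..N. weight i (snd p)) * ?d (fst p) (snd p)"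
      by (simp add: sum_distrib_right)
    also have "\<dots> \<le> 1 * ?d (fst p) (snd p)" by (intro mult_right_mono sum_weight_le) simp
    finally show "(\<Sum>i = 1..N. weight i (snd p) * ?d (fst p) (snd p)) \<le> ?d (fst p) (snd p)" by simp
  qed
  also have "(\<integral>\<^sup>+ p. ?d (fst p) (snd p) \<partial>\<pi>) = transport_cost m \<pi>" by (simp add: transport_cost_def case_prod_beta')
  also have "(\<Sum>i = 1..N. ennreal ((1 + 1 / e) * (mdist m (x i) (y i))\<^sup>2) * ennreal (1 / real N))
     = ennreal ((1 + 1 / e) * ((\<Sum>i = 1..N. (mdist m (x i) (y i))\<^sup>2) / real N))"
  proof -
    have "(\<Sum>i = 1..N. ennreal ((1 + 1 / e) * (mdist m (x i) (y i))\<^sup>2) * ennreal (1 / real N)) = (\<Sum>i = 1..N. ennreal ((1 + 1 / e) * (mdist m (x i) (y i))\<^sup>2 * (1 / real N)))"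
      using e by (intro sum.cong refl) (simp flip: ennreal_mult)
    also have "\<dots> = ennreal (\<Sum>i = 1..N. (1 + 1 / e) * (mdist m (x i) (y i))\<^sup>2 * (1 / real N))"
      using e by (intro sum_ennreal) auto
    also have "(\<Sum>i = 1..N. (1 + 1 / e) * (mdist m (x i) (y i))\<^sup>2 * (1 / real N)) = (1 + 1 / e) * ((\<Sum>i = 1..N. (mdist m (x i) (y i))\<^sup>2) / real N)"
      by (simp add: sum_distrib_left sum_divide_distrib)
    finally show ?thesis .
  qed
  finally show ?thesis by (simp add: add_mono mult_left_mono)
qed

end

text \<open>
  For \<open>a\<close> above the square root of the first cost and \<open>b\<close> above the displacement, the choice \<open>e = b / a\<close> gives the bound
  \<open>(a + b)\<^sup>2\<close>; strict inequalities avoid division by zero.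
\<close>

lemma optimal_cost_empirical_le:
  fixes x y :: "nat \<Rightarrow> 'a"
  defines "I \<equiv> \<lambda>\<mu> z N m. INF \<pi>\<in>couplings \<mu> (empirical_measure (metric_borel m) N z). transport_cost m \<pi>"
  assumes mdist: "(\<lambda>p. mdist m (fst p) (snd p)) \<in> borel_measurable (metric_borel m \<Otimes>\<^sub>M metric_borel m)"
    and \<mu>: "sets \<mu> = sets (metric_borel m)" "prob_space \<mu>" and N: "0 < N"
    and x: "\<And>n. n \<in> {1..N} \<Longrightarrow> x n \<in> mspace m" and y: "\<And>n. n \<in> {1..N} \<Longrightarrow> y n \<in> mspace m"
    and fin: "I \<mu> x N m < \<infinity>"
  shows "I \<mu> y N m < \<infinity>"
    and "sqrt (enn2real (I \<mu> y N m)) \<le> sqrt (enn2real (I \<mu> x N m)) + sqrt ((\<Sum>n = 1..N. (mdist m (x n) (y n))\<^sup>2) / real N)"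
proof -
  let ?c = "sqrt (enn2real (I \<mu> x N m))" and ?\<delta> = "sqrt ((\<Sum>n = 1..N. (mdist m (x n) (y n))\<^sup>2) / real N)"
  have c: "ennreal (?c\<^sup>2) = I \<mu> x N m" using fin by simp
  have \<delta>: "?\<delta>\<^sup>2 = (\<Sum>n = 1..N. (mdist m (x n) (y n))\<^sup>2) / real N" by (simp add: sum_nonneg)
  have key: "I \<mu> y N m \<le> ennreal ((a + b)\<^sup>2)" if a: "?c < a" and b: "?\<delta> < b" for a b
  proof -
    have pos: "0 < a" "0 < b" using a b by (auto intro: le_less_trans[rotated] simp: sum_nonneg)
    have "?c\<^sup>2 < a\<^sup>2" using a by (intro power_strict_mono) auto
    then have "I \<mu> x N m < ennreal (a\<^sup>2)" using c by (metis ennreal_less_iff zero_le_power2)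
    then obtain \<pi> where in_couplings: "\<pi> \<in> couplings \<mu> (empirical_measure (metric_borel m) N x)"
      and cost: "transport_cost m \<pi> < ennreal (a\<^sup>2)"
      unfolding I_def INF_less_iff by blast
    interpret finite_coupling m \<mu> N x y \<pi> by (intro finite_coupling.intro mdist \<mu> N x y in_couplings)
    have "I \<mu> y N m \<le> transport_cost m moved" unfolding I_def by (rule INF_lower[OF moved_coupling])
    also have "\<dots> \<le> ennreal (1 + b / a) * transport_cost m \<pi> + ennreal ((1 + 1 / (b / a)) * ?\<delta>\<^sup>2)"
      unfolding \<delta> using pos by (intro transport_cost_moved_le) simp
    also have "\<dots> \<le> ennreal (1 + b / a) * ennreal (a\<^sup>2) + ennreal ((1 + 1 / (b / a)) * b\<^sup>2)"
      using cost b pos by (intro add_mono mult_left_mono ennreal_leI power_mono) (auto simp: sum_nonneg)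
    also have "\<dots> = ennreal ((1 + b / a) * a\<^sup>2 + (1 + 1 / (b / a)) * b\<^sup>2)"
      using pos by (simp add: ennreal_mult ennreal_plus)
    also have "(1 + b / a) * a\<^sup>2 + (1 + 1 / (b / a)) * b\<^sup>2 = (a + b)\<^sup>2"
      using pos by (simp add: field_simps power2_eq_square)
    finally show ?thesis .
  qed
  have "I \<mu> y N m \<le> ennreal (((?c + 1) + (?\<delta> + 1))\<^sup>2)" by (rule key) auto
  then show fin_y: "I \<mu> y N m < \<infinity>" by (rule le_less_trans) simp
  show "sqrt (enn2real (I \<mu> y N m)) \<le> ?c + ?\<delta>"
  proof (rule field_le_epsilon)
    fix e :: real assume e: "0 < e"
    have nn: "0 \<le> ?c" "0 \<le> ?\<delta>" by (auto simp: sum_nonneg)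
    have "I \<mu> y N m \<le> ennreal (((?c + e / 2) + (?\<delta> + e / 2))\<^sup>2)" using e by (intro key) auto
    then have "enn2real (I \<mu> y N m) \<le> ((?c + e / 2) + (?\<delta> + e / 2))\<^sup>2" by (rule enn2real_leI[rotated]) simp
    then have "sqrt (enn2real (I \<mu> y N m)) \<le> sqrt (((?c + e / 2) + (?\<delta> + e / 2))\<^sup>2)" by (rule real_sqrt_le_mono)
    also have "\<dots> = ?c + ?\<delta> + e" using nn e by (simp only: real_sqrt_abs)
    finally show "sqrt (enn2real (I \<mu> y N m)) \<le> ?c + ?\<delta> + e" .
  qed
qed

text \<open>
  If the optimal cost is infinite for one sample, it is infinite for all, and then \<^const>\<open>wasserstein2\<close>
  vanishes identically. Otherwise the triangle inequality applies in both directions.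
\<close>

theorem wasserstein2_empirical_Lipschitz:
  assumes mdist: "(\<lambda>p. mdist m (fst p) (snd p)) \<in> borel_measurable (metric_borel m \<Otimes>\<^sub>M metric_borel m)"
    and \<mu>: "sets \<mu> = sets (metric_borel m)" "prob_space \<mu>" and N: "0 < N"
    and x: "\<And>n. n \<in> {1..N} \<Longrightarrow> x n \<in> mspace m" and y: "\<And>n. n \<in> {1..N} \<Longrightarrow> y n \<in> mspace m"
  shows "\<bar>wasserstein2 m \<mu> (empirical_measure (metric_borel m) N x) - wasserstein2 m \<mu> (empirical_measure (metric_borel m) N y)\<bar>
     \<le> 1 / sqrt (real N) * sqrt (\<Sum>n = 1..N. (mdist m (x n) (y n))\<^sup>2)"
proof -
  let ?I = "\<lambda>z. INF \<pi>\<in>couplings \<mu> (empirical_measure (metric_borel m) N z). transport_cost m \<pi>"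
  let ?\<delta> = "sqrt ((\<Sum>n = 1..N. (mdist m (x n) (y n))\<^sup>2) / real N)"
  have sym: "(\<Sum>n = 1..N. (mdist m (y n) (x n))\<^sup>2) = (\<Sum>n = 1..N. (mdist m (x n) (y n))\<^sup>2)" by (simp add: mdist_commute)
  have xy: "?I x < \<infinity> \<Longrightarrow> ?I y < \<infinity>" "?I x < \<infinity> \<Longrightarrow> sqrt (enn2real (?I y)) \<le> sqrt (enn2real (?I x)) + ?\<delta>"
    using optimal_cost_empirical_le[OF mdist \<mu> N, of x y] x y by blast+
  have yx: "?I y < \<infinity> \<Longrightarrow> ?I x < \<infinity>" "?I y < \<infinity> \<Longrightarrow> sqrt (enn2real (?I x)) \<le> sqrt (enn2real (?I y)) + ?\<delta>"
    using optimal_cost_empirical_le[OF mdist \<mu> N, of y x] x y unfolding sym by blast+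
  have "\<bar>sqrt (enn2real (?I x)) - sqrt (enn2real (?I y))\<bar> \<le> ?\<delta>"
  proof (cases "?I x < \<infinity>")
    case True
    from xy(2)[OF this] yx(2)[OF xy(1)[OF this]] show ?thesis by (simp only: abs_le_iff) linarith
  next
    case False
    then have "\<not> ?I y < \<infinity>" using yx(1) by blast
    then have "?I y = \<top>" by (metis infinity_ennreal_def top.not_eq_extremum)
    moreover have "?I x = \<top>" using False by (metis infinity_ennreal_def top.not_eq_extremum)
    ultimately have "enn2real (?I x) = 0" "enn2real (?I y) = 0" by simp_all
    then show ?thesis by (simp add: sum_nonneg)
  qed
  also have "?\<delta> = 1 / sqrt (real N) * sqrt (\<Sum>n = 1..N. (mdist m (x n) (y n))\<^sup>2)"
    by (simp add: real_sqrt_divide)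
  finally show ?thesis unfolding wasserstein2_eq .
qed

section \<open>Concentration of the empirical Wasserstein distance\<close>

text \<open>
  McShane's formula \<open>g x = inf {f a + K * d x a | a \<in> A}\<close>.
\<close>

lemma Lipschitz_extension:
  fixes f :: "'a \<Rightarrow> real" and d :: "'a \<Rightarrow> 'a \<Rightarrow> real"
  assumes "A \<subseteq> X" "A \<noteq> {}" "0 \<le> K"
    and d: "\<And>x. x \<in> X \<Longrightarrow> d x x = 0" "\<And>x y. x \<in> X \<Longrightarrow> y \<in> X \<Longrightarrow> d x y = d y x"
      "\<And>x y z. x \<in> X \<Longrightarrow> y \<in> X \<Longrightarrow> z \<in> X \<Longrightarrow> d x z \<le> d x y + d y z"
    and Lip: "\<And>x y. x \<in> A \<Longrightarrow> y \<in> A \<Longrightarrow> \<bar>f x - f y\<bar> \<le> K * d x y"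
  obtains g where "\<And>x. x \<in> A \<Longrightarrow> g x = f x" "\<And>x y. x \<in> X \<Longrightarrow> y \<in> X \<Longrightarrow> \<bar>g x - g y\<bar> \<le> K * d x y"
proof
  obtain a0 where a0: "a0 \<in> A" using assms(2) by blast
  define g where "g x = (INF a\<in>A. f a + K * d x a)" for x
  have tri: "K * d x z \<le> K * d x y + K * d y z" if "x \<in> X" "y \<in> X" "z \<in> X" for x y z
    using mult_left_mono[OF d(3)[OF that] assms(3)] by (simp add: distrib_left)
  have bdd: "bdd_below ((\<lambda>a. f a + K * d x a) ` A)" if x: "x \<in> X" for x
  proof (rule bdd_belowI2)
    fix a assume a: "a \<in> A"
    then have "\<bar>f a0 - f a\<bar> \<le> K * d a0 a" by (rule Lip[OF a0])
    moreover have "K * d a0 a \<le> K * d a0 x + K * d x a" using a a0 x assms(1) by (intro tri) auto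
    ultimately show "f a0 - K * d a0 x \<le> f a + K * d x a" by linarith
  qed
  show "g x = f x" if x: "x \<in> A" for x
  proof (rule antisym)
    have X: "x \<in> X" using x assms(1) by auto
    have "g x \<le> f x + K * d x x" unfolding g_def by (rule cINF_lower[OF bdd[OF X] x])
    then show "g x \<le> f x" by (simp add: d(1)[OF X])
    show "f x \<le> g x" unfolding g_def
    proof (rule cINF_greatest[OF assms(2)])
      fix a assume "a \<in> A"
      from Lip[OF x this] show "f x \<le> f a + K * d x a" by linarith
    qed
  qed
  have le: "g x \<le> g y + K * d x y" if "x \<in> X" "y \<in> X" for x y
  proof -
    have "g x - K * d x y \<le> g y" unfolding g_def[of y]
    proof (rule cINF_greatest[OF assms(2)])
      fix a assume a: "a \<in> A"
      then have "g x \<le> f a + K * d x a" unfolding g_def by (rule cINF_lower[OF bdd[OF that(1)]])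
      moreover have "K * d x a \<le> K * d x y + K * d y a" using that a assms(1) by (intro tri) auto
      ultimately show "g x - K * d x y \<le> f a + K * d y a" by linarith
    qed
    then show ?thesis by simp
  qed
  show "\<bar>g x - g y\<bar> \<le> K * d x y" if "x \<in> X" "y \<in> X" for x y
    using le[OF that] le[OF that(2,1)] d(2)[OF that] by (simp add: abs_le_iff)
qed

lemma empirical_measure_cong:
  "(\<And>n. n \<in> {1..N} \<Longrightarrow> x n = y n) \<Longrightarrow> empirical_measure M N x = empirical_measure M N y"
  unfolding empirical_measure_def by (intro arg_cong[where f="measure_of _ _"] ext arg_cong2[where f="(*)"] sum.cong refl) simp

context wiener_space
begin

text \<open>
  For a centred function \<open>\<integral> exp (- l * F) \<ge> \<integral> (1 - l * F) = 1\<close>, so that factor can be dropped from the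
  product estimate.
\<close>

lemma exp_moment_centered:
  fixes F :: "(nat \<Rightarrow> real \<Rightarrow> real ^ 'd) \<Rightarrow> real"
  assumes I: "finite I" and K: "0 \<le> K"
    and Lip: "Lipschitz_l2 T I K F"
    and int: "integrable (PiM I (\<lambda>_. P)) F" and mean: "(\<integral>\<omega>. F \<omega> \<partial>PiM I (\<lambda>_. P)) = 0"
  shows "exp_moment (PiM I (\<lambda>_. P)) F l \<le> ennreal (exp (l\<^sup>2 * K\<^sup>2 * T))"
proof -
  let ?M = "PiM I (\<lambda>_. P)"
  interpret M: prob_space ?M by (rule prob_space_PiM) (rule prob_space_axioms)
  have "ennreal 1 \<le> exp_moment ?M F (- l)"
  proof (cases "exp_moment ?M F (- l) = \<infinity>")
    case False
    have [measurable]: "F \<in> borel_measurable ?M" using int by auto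
    have int': "integrable ?M (\<lambda>\<omega>. exp (- l * F \<omega>))"
      using False by (intro integrableI_nonneg) (auto simp: less_top)
    have "1 = (\<integral>\<omega>. 1 + - l * F \<omega> \<partial>?M)" using int mean by (simp add: M.prob_space)
    also have "\<dots> \<le> (\<integral>\<omega>. exp (- l * F \<omega>) \<partial>?M)"
      using int int' by (intro integral_mono exp_ge_add_one_self) auto
    finally have "ennreal 1 \<le> ennreal (\<integral>\<omega>. exp (- l * F \<omega>) \<partial>?M)" by (rule ennreal_leI)
    also have "\<dots> = exp_moment ?M F (- l)"
      by (rule nn_integral_eq_integral[OF int', symmetric]) simp
    finally show ?thesis .
  qed simp
  then have "exp_moment ?M F l * ennreal 1 \<le> exp_moment ?M F l * exp_moment ?M F (- l)"
    by (rule mult_left_mono) simp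
  also have "\<dots> \<le> ennreal (exp (l\<^sup>2 * K\<^sup>2 * T))"
    by (rule exp_Lipschitz[OF I K Lip])
  finally show ?thesis by simp
qed

text \<open>
  Chernoff's bound with the optimal parameter \<open>l = x / (2 * K\<^sup>2 * T)\<close>.
\<close>

lemma upper_tail_centered:
  fixes F :: "(nat \<Rightarrow> real \<Rightarrow> real ^ 'd) \<Rightarrow> real"
  assumes I: "finite I" and K: "0 < K"
    and Lip: "Lipschitz_l2 T I K F"
    and int: "integrable (PiM I (\<lambda>_. P)) F" and mean: "(\<integral>\<omega>. F \<omega> \<partial>PiM I (\<lambda>_. P)) = 0"
    and x: "0 < x"
  shows "measure (PiM I (\<lambda>_. P)) {\<omega> \<in> space (PiM I (\<lambda>_. P)). x \<le> F \<omega>} \<le> exp (- (x\<^sup>2 / (4 * K\<^sup>2 * T)))"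
proof -
  let ?M = "PiM I (\<lambda>_. P)"
  interpret M: prob_space ?M by (rule prob_space_PiM) (rule prob_space_axioms)
  have [measurable]: "F \<in> borel_measurable ?M" using int by auto
  define l where "l = x / (2 * K\<^sup>2 * T)"
  have l: "0 < l" using x K T_pos by (simp add: l_def)
  have "emeasure ?M {\<omega> \<in> space ?M. x \<le> F \<omega>} = (\<integral>\<^sup>+ \<omega>. indicator {\<omega> \<in> space ?M. x \<le> F \<omega>} \<omega> \<partial>?M)" by simp
  also have "\<dots> \<le> (\<integral>\<^sup>+ \<omega>. ennreal (exp (- l * x)) * ennreal (exp (l * F \<omega>)) \<partial>?M)"
  proof (rule nn_integral_mono)
    fix \<omega>
    have "1 \<le> ennreal (exp (- l * x)) * ennreal (exp (l * F \<omega>))" if "x \<le> F \<omega>"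
    proof -
      have "0 \<le> - l * x + l * F \<omega>" using mult_left_mono[OF that, of l] l by simp
      then have "1 \<le> exp (- l * x + l * F \<omega>)" by simp
      then have "ennreal 1 \<le> ennreal (exp (- l * x + l * F \<omega>))" by (rule ennreal_leI)
      then show ?thesis by (simp only: exp_add ennreal_mult exp_ge_zero ennreal_1)
    qed
    then show "indicator {\<omega> \<in> space ?M. x \<le> F \<omega>} \<omega> \<le> ennreal (exp (- l * x)) * ennreal (exp (l * F \<omega>))"
      by (simp add: indicator_def)
  qed
  also have "\<dots> = ennreal (exp (- l * x)) * exp_moment ?M F l" by (rule nn_integral_cmult) measurable
  also have "\<dots> \<le> ennreal (exp (- l * x)) * ennreal (exp (l\<^sup>2 * K\<^sup>2 * T))"
    using K by (intro mult_left_mono exp_moment_centered[OF I _ Lip int mean]) auto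
  also have "\<dots> = ennreal (exp (- l * x + l\<^sup>2 * K\<^sup>2 * T))" by (simp only: exp_add ennreal_mult exp_ge_zero)
  also have "- l * x + l\<^sup>2 * K\<^sup>2 * T = - (x\<^sup>2 / (4 * K\<^sup>2 * T))"
    using K T_pos by (simp add: l_def field_simps power2_eq_square)
  finally show ?thesis by (simp add: M.emeasure_eq_measure)
qed

lemma integrable_Lipschitz_product:
  fixes F :: "(nat \<Rightarrow> real \<Rightarrow> real ^ 'd) \<Rightarrow> real"
  assumes I: "finite I" and K: "0 \<le> K"
    and Lip: "Lipschitz_l2 T I K F"
  shows "integrable (PiM I (\<lambda>_. P)) F"
proof -
  let ?M = "PiM I (\<lambda>_. P)"
  let ?z = "\<lambda>j\<in>I. zero_path"
  interpret M: prob_space ?M by (rule prob_space_PiM) (rule prob_space_axioms)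
  have "F \<in> borel_measurable (PiM I (\<lambda>_. path_borel T))"
    by (rule measurable_Lipschitz_l2[OF I K Lip])
  moreover have "sets ?M = sets (PiM I (\<lambda>_. path_borel T))" by (intro sets_PiM_cong refl sets_P)
  ultimately have F: "F \<in> borel_measurable ?M" using measurable_cong_sets by blast
  have comp: "integrable ?M (\<lambda>\<omega>. pdist T (\<omega> j) zero_path)" if j: "j \<in> I" for j
  proof -
    have law: "distr ?M P (\<lambda>\<omega>. \<omega> j) = P" by (rule distr_PiM_component[OF prob_space_axioms j])
    have "(\<lambda>\<omega>. \<omega> j) \<in> measurable ?M P" by (rule measurable_component_singleton[OF j])
    from integrable_distr_eq[OF this norm_measurable] integrable_norm show ?thesis by (simp add: law)
  qed
  show ?thesis
  proof (rule Bochner_Integration.integrable_bound[OF _ F])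
    show "integrable ?M (\<lambda>\<omega>. \<bar>F ?z\<bar> + K * (\<Sum>j\<in>I. pdist T (\<omega> j) zero_path))"
      using comp by (intro Bochner_Integration.integrable_add integrable_mult_right Bochner_Integration.integrable_sum) auto
    show "AE \<omega> in ?M. norm (F \<omega>) \<le> norm (\<bar>F ?z\<bar> + K * (\<Sum>j\<in>I. pdist T (\<omega> j) zero_path))"
    proof (rule AE_I2)
      fix \<omega> assume "\<omega> \<in> space ?M"
      then have \<omega>: "\<omega> \<in> I \<rightarrow>\<^sub>E paths T" by (simp add: space_PiM space_P)
      have "\<bar>F \<omega> - F ?z\<bar> \<le> K * l2_dist (path_metric T) I \<omega> ?z" by (rule Lipschitz_l2D[OF Lip \<omega>]) (auto simp: zero_path_in_paths)
      also have "\<dots> \<le> K * (\<Sum>j\<in>I. pdist T (\<omega> j) zero_path)"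
        using l2_dist_le_sum[of "path_metric T" I \<omega> ?z] by (intro mult_left_mono[OF _ K]) simp
      finally show "norm (F \<omega>) \<le> norm (\<bar>F ?z\<bar> + K * (\<Sum>j\<in>I. pdist T (\<omega> j) zero_path))" by simp
    qed
  qed
qed

theorem concentration_Lipschitz:
  fixes F :: "(nat \<Rightarrow> real \<Rightarrow> real ^ 'd) \<Rightarrow> real"
  assumes I: "finite I" and K: "0 < K"
    and Lip: "Lipschitz_l2 T I K F"
    and x: "0 < x"
  shows "measure (PiM I (\<lambda>_. P)) {\<omega> \<in> space (PiM I (\<lambda>_. P)). x \<le> \<bar>F \<omega> - (\<integral>\<omega>. F \<omega> \<partial>PiM I (\<lambda>_. P))\<bar>}
    \<le> 2 * exp (- (x\<^sup>2 / (4 * K\<^sup>2 * T)))"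
proof -
  let ?M = "PiM I (\<lambda>_. P)"
  interpret M: prob_space ?M by (rule prob_space_PiM) (rule prob_space_axioms)
  have int: "integrable ?M F" using K by (intro integrable_Lipschitz_product[OF I _ Lip]) auto
  then have [measurable]: "F \<in> borel_measurable ?M" by auto
  let ?c = "\<integral>\<omega>. F \<omega> \<partial>?M"
  have up: "measure ?M {\<omega> \<in> space ?M. x \<le> F \<omega> - ?c} \<le> exp (- (x\<^sup>2 / (4 * K\<^sup>2 * T)))"
    using Lip int by (intro upper_tail_centered[OF I K _ _ _ x]) (auto simp: M.prob_space Lipschitz_l2_def)
  have down: "measure ?M {\<omega> \<in> space ?M. x \<le> ?c - F \<omega>} \<le> exp (- (x\<^sup>2 / (4 * K\<^sup>2 * T)))"
    using Lip int by (intro upper_tail_centered[OF I K _ _ _ x]) (auto simp: M.prob_space Lipschitz_l2_def abs_minus_commute)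
  have "{\<omega> \<in> space ?M. x \<le> \<bar>F \<omega> - ?c\<bar>} = {\<omega> \<in> space ?M. x \<le> F \<omega> - ?c} \<union> {\<omega> \<in> space ?M. x \<le> ?c - F \<omega>}"
    by auto
  also have "measure ?M \<dots> \<le> measure ?M {\<omega> \<in> space ?M. x \<le> F \<omega> - ?c} + measure ?M {\<omega> \<in> space ?M. x \<le> ?c - F \<omega>}"
    by (rule measure_Un_le) measurable
  finally show ?thesis using up down by linarith
qed

end

lemma measurable_pdist:
  assumes "0 < T"
  shows "(\<lambda>p. pdist T (fst p) (snd p :: real \<Rightarrow> 'a::euclidean_space)) \<in> borel_measurable (path_borel T \<Otimes>\<^sub>M path_borel T)"
proof -
  let ?Y = "\<lambda>(j::nat) p. if j = 0 then fst p else (snd p :: real \<Rightarrow> 'a)"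
  have "(\<lambda>p. (\<lambda>z. pdist T (z 0) (z (1::nat))) (\<lambda>j\<in>{0, 1}. ?Y j p)) \<in> borel_measurable (path_borel T \<Otimes>\<^sub>M path_borel T)"
  proof (rule borel_measurable_Lipschitz_paths[OF assms, where K=1])
    fix x y :: "nat \<Rightarrow> real \<Rightarrow> 'a" assume "x \<in> {0, 1} \<rightarrow>\<^sub>E paths T" "y \<in> {0, 1} \<rightarrow>\<^sub>E paths T"
    then have "x 0 \<in> paths T" "x 1 \<in> paths T" "y 0 \<in> paths T" "y 1 \<in> paths T" by (auto dest: PiE_mem)
    then have "\<bar>pdist T (x 0) (x 1) - pdist T (y 0) (x 1)\<bar> \<le> pdist T (x 0) (y 0)"
      "\<bar>pdist T (x 1) (y 0) - pdist T (y 1) (y 0)\<bar> \<le> pdist T (x 1) (y 1)"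
      by (auto intro!: mdist_triangle_abs)
    then show "\<bar>pdist T (x 0) (x 1) - pdist T (y 0) (y 1)\<bar> \<le> 1 * (\<Sum>j\<in>{0, 1}. pdist T (x j) (y j))"
      by (simp add: mdist_commute)
  next
    fix j :: nat and t assume t: "t \<in> {0..T}"
    have ev: "(\<lambda>x. x t :: 'a) \<in> borel_measurable (path_borel T)" using assms t by (intro measurable_evaluation) auto
    show "(\<lambda>p. ?Y j p t) \<in> borel_measurable (path_borel T \<Otimes>\<^sub>M path_borel T)"
      using measurable_compose[OF measurable_fst ev] measurable_compose[OF measurable_snd ev] by (cases "j = 0") auto
  qed (auto simp: space_pair_measure)
  then show ?thesis by simp
qed

context optimal_stopping
begin

text \<open>
  The paths of \<open>S\<close> depend on \<open>\<omega>\<close> in a Lipschitz way only on a set \<open>A\<close> of full measure. It is therefore the real-valued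
  functional on \<open>A\<^sup>N\<close> that is extended to all tuples of paths; the extension has the same law. The
  constant \<open>L + 1\<close> is used in place of \<open>L\<close> in order to be positive.
\<close>

theorem wasserstein_law:
  fixes S :: "real \<Rightarrow> (real \<Rightarrow> real ^ 'd) \<Rightarrow> real"
  assumes S: "optimal_stopping_value T P \<Gamma> S" and N: "0 < N"
  defines "\<mu> \<equiv> path_law T P' S"
  obtains F where
    "Lipschitz_l2 T {1..N} ((L + 1) / sqrt (real N)) F"
    "distr (PiM {1..N} (\<lambda>_. \<mu>)) borel (\<lambda>s. wasserstein2 (path_metric T) \<mu> (empirical_measure (path_borel T) N s))
      = distr (PiM {1..N} (\<lambda>_. P)) borel F"
    "(\<lambda>s. wasserstein2 (path_metric T) \<mu> (empirical_measure (path_borel T) N s)) \<in> borel_measurable (PiM {1..N} (\<lambda>_. path_borel T))"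
    "prob_space \<mu>" "sets \<mu> = sets (path_borel T)"
proof -
  let ?E = "path_borel T :: (real \<Rightarrow> real) measure" and ?I = "{1..N}"
  define S' where "S' \<omega> = (\<lambda>t\<in>{0..T}. S t \<omega>)" for \<omega>
  have S'_paths: "S' \<omega> \<in> paths T" if "\<omega> \<in> paths T" for \<omega>
  proof -
    have "continuous_on {0..T} (\<lambda>t. S t \<omega>)" using S that by (simp add: optimal_stopping_value_def space_P)
    then show ?thesis by (auto simp: mspace_path_metric S'_def intro: continuous_on_eq)
  qed
  have S'_meas: "S' \<in> measurable P' ?E"
  proof (rule measurable_path_borelI[OF T_pos])
    fix t assume t: "t \<in> {0..T}"
    then have "S t \<in> borel_measurable P'" using S by (auto simp: optimal_stopping_value_def is_ess_sup_def)
    then show "(\<lambda>\<omega>. S' \<omega> t) \<in> borel_measurable P'" using t by (simp add: S'_def)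
  qed (simp add: S'_paths space_P)
  have \<mu>_eq: "\<mu> = distr P' ?E S'" by (simp add: \<mu>_def path_law_def S'_def[abs_def])
  have \<mu>_prob: "prob_space \<mu>" unfolding \<mu>_eq by (rule P'.prob_space_distr[OF S'_meas])
  have \<mu>_sets: "sets \<mu> = sets ?E" by (simp add: \<mu>_eq)
  have S'_meas': "S' \<in> measurable P' \<mu>" using S'_meas measurable_cong_sets[OF refl \<mu>_sets] by blast
  define G where "G s = wasserstein2 (path_metric T) \<mu> (empirical_measure ?E N s)" for s
  have G_Lip: "Lipschitz_l2 T ?I (1 / sqrt (real N)) G"
  proof (rule Lipschitz_l2I)
    fix x y :: "nat \<Rightarrow> real \<Rightarrow> real" assume xy: "x \<in> ?I \<rightarrow>\<^sub>E paths T" "y \<in> ?I \<rightarrow>\<^sub>E paths T"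
    show "\<bar>G x - G y\<bar> \<le> 1 / sqrt (real N) * l2_dist (path_metric T) ?I x y"
      unfolding G_def l2_dist_def
      by (rule wasserstein2_empirical_Lipschitz[OF measurable_pdist[OF T_pos] \<mu>_sets \<mu>_prob N])
         (rule PiE_mem[OF xy(1)] PiE_mem[OF xy(2)], assumption)+
  qed
  have G_meas: "G \<in> borel_measurable (PiM ?I (\<lambda>_. ?E))"
    by (rule measurable_Lipschitz_l2[OF _ _ G_Lip]) simp_all
  obtain A where A: "A \<in> sets P" "AE \<omega> in P. \<omega> \<in> A"
    and S_Lip: "\<And>\<omega> \<eta> t. \<omega> \<in> A \<Longrightarrow> \<eta> \<in> A \<Longrightarrow> t \<in> {0..T} \<Longrightarrow> \<bar>S t \<omega> - S t \<eta>\<bar> \<le> L * pdist T \<omega> \<eta>"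
    using value_process_Lipschitz[OF S] by blast
  have A_sub: "A \<subseteq> paths T" using sets.sets_into_space[OF A(1)] by (simp add: space_P)
  have A_ne: "A \<noteq> {}" using A(2) by auto
  have S'_Lip: "pdist T (S' \<omega>) (S' \<eta>) \<le> L * pdist T \<omega> \<eta>" if "\<omega> \<in> A" "\<eta> \<in> A" for \<omega> \<eta>
  proof (rule pdist_le[OF T_nonneg])
    show "S' \<omega> \<in> paths T" "S' \<eta> \<in> paths T" using that A_sub S'_paths by auto
    show "dist (S' \<omega> t) (S' \<eta> t) \<le> L * pdist T \<omega> \<eta>" if "t \<in> {0..T}" for t
      using S_Lip[OF \<open>\<omega> \<in> A\<close> \<open>\<eta> \<in> A\<close> that] that by (simp add: S'_def dist_real_def)
  qed
  let ?K = "(L + 1) / sqrt (real N)"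
  have F0_Lip: "\<bar>G (compose ?I S' x) - G (compose ?I S' y)\<bar> \<le> ?K * l2_dist (path_metric T) ?I x y"
    if x: "x \<in> ?I \<rightarrow>\<^sub>E A" and y: "y \<in> ?I \<rightarrow>\<^sub>E A" for x y
  proof -
    have "\<bar>G (compose ?I S' x) - G (compose ?I S' y)\<bar> \<le> 1 / sqrt (real N) * l2_dist (path_metric T) ?I (compose ?I S' x) (compose ?I S' y)"
      using x y A_sub S'_paths by (intro Lipschitz_l2D[OF G_Lip]) (auto simp: compose_def PiE_iff)
    also have "\<dots> \<le> 1 / sqrt (real N) * ((L + 1) * l2_dist (path_metric T) ?I x y)"
    proof (rule mult_left_mono)
      have "l2_dist (path_metric T) ?I (compose ?I S' x) (compose ?I S' y) \<le> L2_set (\<lambda>i. (L + 1) * pdist T (x i) (y i)) ?I"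
        unfolding l2_dist_def L2_set_def[symmetric]
      proof (rule L2_set_mono)
        fix i assume i: "i \<in> ?I"
        have "pdist T (S' (x i)) (S' (y i)) \<le> L * pdist T (x i) (y i)" using PiE_mem[OF x i] PiE_mem[OF y i] by (rule S'_Lip)
        also have "\<dots> \<le> (L + 1) * pdist T (x i) (y i)" by (intro mult_right_mono) auto
        finally show "pdist T (compose ?I S' x i) (compose ?I S' y i) \<le> (L + 1) * pdist T (x i) (y i)"
          using i by (simp add: compose_def)
      qed simp
      also have "\<dots> = (L + 1) * l2_dist (path_metric T) ?I x y"
        using L_nonneg by (subst L2_set_right_distrib[symmetric]) (auto simp: l2_dist_def L2_set_def)
      finally show "l2_dist (path_metric T) ?I (compose ?I S' x) (compose ?I S' y) \<le> (L + 1) * l2_dist (path_metric T) ?I x y" .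
    qed simp
    finally show ?thesis by simp
  qed
  obtain F where F_eq: "\<And>x. x \<in> ?I \<rightarrow>\<^sub>E A \<Longrightarrow> F x = G (compose ?I S' x)"
    and "\<And>x y. x \<in> ?I \<rightarrow>\<^sub>E paths T \<Longrightarrow> y \<in> ?I \<rightarrow>\<^sub>E paths T \<Longrightarrow> \<bar>F x - F y\<bar> \<le> ?K * l2_dist (path_metric T) ?I x y"
  proof (rule Lipschitz_extension[where A="?I \<rightarrow>\<^sub>E A" and X="?I \<rightarrow>\<^sub>E paths T" and K="?K" and d="l2_dist (path_metric T) ?I" and f="\<lambda>x. G (compose ?I S' x)"])
    show "?I \<rightarrow>\<^sub>E A \<subseteq> ?I \<rightarrow>\<^sub>E paths T" using A_sub by (auto simp: PiE_iff)
    show "?I \<rightarrow>\<^sub>E A \<noteq> {}" using A_ne by (simp add: PiE_eq_empty_iff)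
    show "0 \<le> ?K" using L_nonneg by simp
    show "l2_dist (path_metric T) ?I x x = 0" if "x \<in> ?I \<rightarrow>\<^sub>E paths T" for x :: "nat \<Rightarrow> real \<Rightarrow> real ^ 'd"
      using that by (auto simp: l2_dist_def PiE_iff intro!: sum.neutral)
    show "l2_dist (path_metric T) ?I x y = l2_dist (path_metric T) ?I y x" for x y :: "nat \<Rightarrow> real \<Rightarrow> real ^ 'd"
      by (simp add: l2_dist_def mdist_commute)
  qed (use l2_dist_triangle F0_Lip in auto)
  then have F_Lip: "Lipschitz_l2 T ?I ?K F" by (intro Lipschitz_l2I)
  have F_meas: "F \<in> borel_measurable (PiM ?I (\<lambda>_. P))"
  proof -
    have "F \<in> borel_measurable (PiM ?I (\<lambda>_. path_borel T))"
      using L_nonneg by (intro measurable_Lipschitz_l2[OF _ _ F_Lip]) simp_all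
    moreover have "sets (PiM ?I (\<lambda>_. P)) = sets (PiM ?I (\<lambda>_. path_borel T))" by (intro sets_PiM_cong refl sets_P)
    ultimately show ?thesis using measurable_cong_sets by blast
  qed
  have id_meas: "(\<lambda>\<omega>. \<omega>) \<in> measurable P' P" by (rule measurable_completion) simp
  have comp_id: "compose ?I (\<lambda>\<omega>. \<omega>) \<in> measurable (PiM ?I (\<lambda>_. P')) (PiM ?I (\<lambda>_. P))"
    and comp_S: "compose ?I S' \<in> measurable (PiM ?I (\<lambda>_. P')) (PiM ?I (\<lambda>_. \<mu>))"
    unfolding compose_def
    by (intro measurable_restrict measurable_compose[OF measurable_component_singleton] id_meas S'_meas'; assumption)+
  have law_id: "distr (PiM ?I (\<lambda>_. P')) (PiM ?I (\<lambda>_. P)) (compose ?I (\<lambda>\<omega>. \<omega>)) = PiM ?I (\<lambda>_. P)"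
  proof -
    have "distr P' P (\<lambda>\<omega>. \<omega>) = P" by (simp add: distr_completion distr_id[unfolded id_def])
    then show ?thesis
      using distr_PiM_finite_prob_space'[of ?I "\<lambda>_. P'" "\<lambda>_. P" "\<lambda>\<omega>. \<omega>"] id_meas prob_space_axioms P'.prob_space_axioms by simp
  qed
  have law_S: "distr (PiM ?I (\<lambda>_. P')) (PiM ?I (\<lambda>_. \<mu>)) (compose ?I S') = PiM ?I (\<lambda>_. \<mu>)"
  proof -
    have "distr P' \<mu> S' = \<mu>" unfolding \<mu>_eq by (rule distr_cong) simp_all
    then show ?thesis
      using distr_PiM_finite_prob_space'[of ?I "\<lambda>_. P'" "\<lambda>_. \<mu>" S'] S'_meas' \<mu>_prob P'.prob_space_axioms by simp
  qed
  have G_meas': "G \<in> borel_measurable (PiM ?I (\<lambda>_. \<mu>))"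
    using G_meas measurable_cong_sets[OF sets_PiM_cong[OF refl \<mu>_sets] refl] by blast
  have "distr (PiM ?I (\<lambda>_. \<mu>)) borel G = distr (PiM ?I (\<lambda>_. P')) borel (G \<circ> compose ?I S')"
    by (subst law_S[symmetric]) (rule distr_distr[OF G_meas' comp_S])
  also have "\<dots> = distr (PiM ?I (\<lambda>_. P')) borel (F \<circ> compose ?I (\<lambda>\<omega>. \<omega>))"
  proof (rule distr_cong_AE[OF refl refl])
    have "AE \<omega> in PiM ?I (\<lambda>_. P'). \<forall>i\<in>?I. \<omega> i \<in> A"
      using A(2) by (intro AE_finite_allI AE_PiM_component P'.prob_space_axioms) (auto simp: AE_completion_iff)
    then show "AE \<omega> in PiM ?I (\<lambda>_. P'). (G \<circ> compose ?I S') \<omega> = (F \<circ> compose ?I (\<lambda>\<omega>. \<omega>)) \<omega>"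
      using AE_space
    proof eventually_elim
      fix \<omega> assume "\<forall>i\<in>?I. \<omega> i \<in> A" "\<omega> \<in> space (PiM ?I (\<lambda>_. P'))"
      then have "\<omega> \<in> ?I \<rightarrow>\<^sub>E A" "compose ?I (\<lambda>\<omega>. \<omega>) \<omega> = \<omega>"
        by (auto simp: space_PiM PiE_iff compose_def extensional_restrict)
      then show "(G \<circ> compose ?I S') \<omega> = (F \<circ> compose ?I (\<lambda>\<omega>. \<omega>)) \<omega>" by (simp add: F_eq)
    qed
    show "G \<circ> compose ?I S' \<in> borel_measurable (PiM ?I (\<lambda>_. P'))" using measurable_comp[OF comp_S G_meas'] .
    show "F \<circ> compose ?I (\<lambda>\<omega>. \<omega>) \<in> borel_measurable (PiM ?I (\<lambda>_. P'))" using measurable_comp[OF comp_id F_meas] .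
  qed
  also have "\<dots> = distr (PiM ?I (\<lambda>_. P)) borel F"
    using distr_distr[OF F_meas comp_id] by (simp only: law_id)
  finally have "distr (PiM ?I (\<lambda>_. \<mu>)) borel G = distr (PiM ?I (\<lambda>_. P)) borel F" .
  then show ?thesis
    using that[OF F_Lip] G_meas \<mu>_prob \<mu>_sets unfolding G_def[abs_def] by blast
qed

end

text \<open>
  By independence the samples \<open>X 1, ..., X N\<close> have the law \<open>\<mu>\<^sup>N\<close>, so \<open>W N\<close> has the same law as the Lipschitz function \<open>F\<close> of
  \<open>N\<close> independent Brownian paths, and the tail bound for \<open>F\<close> is exactly the claim.
\<close>

theorem corollary1p2:
  fixes T L :: real
    and P :: "(real \<Rightarrow> real ^ 'd::finite) measure"
    and \<Gamma> S :: "real \<Rightarrow> (real \<Rightarrow> real ^ 'd) \<Rightarrow> real"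
    and \<mu> :: "(real \<Rightarrow> real) measure"
    and Pinf :: "(nat \<Rightarrow> real \<Rightarrow> real ^ 'd) measure"
    and X :: "nat \<Rightarrow> (nat \<Rightarrow> real \<Rightarrow> real ^ 'd) \<Rightarrow> real \<Rightarrow> real"
  assumes "T > 0"
    and "wiener_measure T P"
    and "\<forall>t\<in>{0..T}. \<Gamma> t \<in> borel_measurable (completed_filtration T P t)"
    and "\<forall>\<omega>\<in>space P. continuous_on {0..T} (\<lambda>t. \<Gamma> t \<omega>)"
    and "L \<ge> 0"
    and "\<forall>t\<in>{0..T}. \<forall>\<omega>\<in>space P. \<forall>\<eta>\<in>space P.
           \<bar>\<Gamma> t \<omega> - \<Gamma> t \<eta>\<bar> \<le> L * mdist (path_metric T) \<omega> \<eta>"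
    and "optimal_stopping_value T P \<Gamma> S"
    and "\<mu> = path_law T (completion P) S"
    and "Pinf = PiM UNIV (\<lambda>_. completion P)"
    and "prob_space.indep_vars Pinf (\<lambda>_. path_borel T) X UNIV"
    and "\<forall>n. distr Pinf (path_borel T) (X n) = \<mu>"
  defines "W \<equiv> \<lambda>N \<omega>. wasserstein2 (path_metric T) \<mu>
                        (empirical_measure (path_borel T) N (\<lambda>n. X n \<omega>))"
  shows "\<exists>c>0. \<forall>x>0. \<forall>N\<ge>1.
           measure Pinf {\<omega> \<in> space Pinf. \<bar>W N \<omega> - (\<integral>\<omega>'. W N \<omega>' \<partial>Pinf)\<bar> \<ge> x}
             \<le> 2 * exp (- c * x\<^sup>2 * real N)"
proof -
  interpret wiener_space T P using assms(1,2) by (rule wiener_space.intro)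
  interpret optimal_stopping T P \<Gamma> L
    by unfold_locales (use assms(3-6) in \<open>auto simp: Lipschitz_path_def space_P\<close>)
  interpret Pinf: prob_space Pinf
    unfolding assms(9) by (rule prob_space_PiM) (rule P'.prob_space_axioms)
  let ?c = "1 / (4 * (L + 1)\<^sup>2 * T)"
  show ?thesis
  proof (intro exI[of _ ?c] conjI allI impI)
    show "0 < ?c" using L_nonneg T_pos by simp
    fix x :: real and N :: nat assume x: "0 < x" and "1 \<le> N"
    then have N: "0 < N" by simp
    let ?I = "{1..N}"
    let ?G = "\<lambda>s. wasserstein2 (path_metric T) \<mu> (empirical_measure (path_borel T) N s)"
    obtain F where F_Lip: "Lipschitz_l2 T ?I ((L + 1) / sqrt (real N)) F"
      and law: "distr (PiM ?I (\<lambda>_. \<mu>)) borel ?G = distr (PiM ?I (\<lambda>_. P)) borel F"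
      and G_meas: "?G \<in> borel_measurable (PiM ?I (\<lambda>_. path_borel T))"
      and \<mu>: "prob_space \<mu>" "sets \<mu> = sets (path_borel T)"
      using wasserstein_law[OF assms(7) N] unfolding assms(8)[symmetric] by blast
    let ?X = "\<lambda>\<omega>. \<lambda>n\<in>?I. X n \<omega>"
    have X_meas: "X n \<in> measurable Pinf (path_borel T)" for n
      using assms(10) by (auto simp: Pinf.indep_vars_def)
    have "Pinf.indep_vars (\<lambda>_. path_borel T) X ?I" by (rule Pinf.indep_vars_subset[OF assms(10)]) simp
    then have X_law: "distr Pinf (PiM ?I (\<lambda>_. path_borel T)) ?X = PiM ?I (\<lambda>_. \<mu>)"
      using Pinf.indep_vars_iff_distr_eq_PiM'[where I="?I" and M'="\<lambda>_. path_borel T" and X=X] X_meas N assms(11) by simp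
    have X_meas': "?X \<in> measurable Pinf (PiM ?I (\<lambda>_. path_borel T))"
      by (intro measurable_restrict X_meas)
    have W_eq: "W N \<omega> = ?G (?X \<omega>)" for \<omega>
      unfolding W_def by (intro arg_cong[where f="wasserstein2 _ _"] empirical_measure_cong) simp
    have W_meas [measurable]: "W N \<in> borel_measurable Pinf"
      unfolding W_eq[abs_def] by (rule measurable_compose[OF X_meas' G_meas])
    have W_law: "distr Pinf borel (W N) = distr (PiM ?I (\<lambda>_. P)) borel F"
    proof -
      have "distr Pinf borel (W N) = distr (distr Pinf (PiM ?I (\<lambda>_. path_borel T)) ?X) borel ?G"
        by (subst distr_distr[OF G_meas X_meas']) (simp add: comp_def W_eq[abs_def])
      then show ?thesis by (simp only: X_law law)
    qed
    have K: "0 < (L + 1) / sqrt (real N)" using L_nonneg N by simp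
    have F_meas [measurable]: "F \<in> borel_measurable (PiM ?I (\<lambda>_. P))"
      using integrable_Lipschitz_product[OF _ less_imp_le[OF K] F_Lip] by auto
    have mean: "(\<integral>\<omega>. W N \<omega> \<partial>Pinf) = (\<integral>\<omega>. F \<omega> \<partial>PiM ?I (\<lambda>_. P))"
      using integral_distr[OF W_meas, of "\<lambda>r. r"] integral_distr[OF F_meas, of "\<lambda>r. r"] by (simp add: W_law)
    let ?c' = "\<integral>\<omega>. F \<omega> \<partial>PiM ?I (\<lambda>_. P)"
    let ?B = "{r. x \<le> \<bar>r - ?c'\<bar>}"
    have B: "?B \<in> sets borel" by measurable
    have "measure Pinf {\<omega> \<in> space Pinf. x \<le> \<bar>W N \<omega> - ?c'\<bar>} = measure (distr Pinf borel (W N)) ?B"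
      by (subst measure_distr[OF W_meas B]) (auto intro!: arg_cong[where f="measure Pinf"])
    also have "\<dots> = measure (PiM ?I (\<lambda>_. P)) {\<omega> \<in> space (PiM ?I (\<lambda>_. P)). x \<le> \<bar>F \<omega> - ?c'\<bar>}"
      unfolding W_law by (subst measure_distr[OF F_meas B]) (auto intro!: arg_cong[where f="measure _"])
    also have "\<dots> \<le> 2 * exp (- (x\<^sup>2 / (4 * ((L + 1) / sqrt (real N))\<^sup>2 * T)))"
      by (rule concentration_Lipschitz[OF _ K F_Lip x]) simp
    also have "- (x\<^sup>2 / (4 * ((L + 1) / sqrt (real N))\<^sup>2 * T)) = - ?c * x\<^sup>2 * real N"
      using N by (simp add: power_divide)
    finally show "measure Pinf {\<omega> \<in> space Pinf. \<bar>W N \<omega> - (\<integral>\<omega>'. W N \<omega>' \<partial>Pinf)\<bar> \<ge> x} \<le> 2 * exp (- ?c * x\<^sup>2 * real N)"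
      by (simp only: mean)
  qed
qed

end
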